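(* Let $d\ge 2$, $\alpha>0$, and let $\Xi$ be an $\mathbb{R}^{d-1}$-stationary and ergodic random closed set in $\mathbb{R}^d$ with $\mathbb{E}\big[\gamma_{\Xi}(o,H_{\mathsf O})\,\mathbf 1\{o\in\mathcal C_{\Xi}(H_{\mathsf O})\}\big]<\infty$. For a positive integer $N$ let $$R^{\alpha}_N=\big\{\gamma_{\Xi}(x,H_{\mathsf O})=\gamma_{\Xi\cap W^\alpha_N}(x,H_{\mathsf O})\ \text{for all } x\in H_{\mathsf I,N}\cap\mathbb Q^d\big\},$$ $$\widehat\tau^{\alpha}_N=\frac{1}{\mathcal H_{d-1}(\mathcal C_{\Xi\cap W^\alpha_N}(H_{\mathsf O})\cap H_{\mathsf I,N})}\int_{\mathcal C_{\Xi\cap W^\alpha_N}(H_{\mathsf O})\cap H_{\mathsf I,N}}\gamma_{\Xi\cap W^\alpha_N}(x,H_{\mathsf O})\,\mathcal H_{d-1}(\mathrm dx).$$ Then the following statements are true: (i) If there exists an almost surely finite random variable $N_0\ge1$ such that the event $R^\alpha_N$ occurs for all $N\ge N_0$, then $\widehat\tau^\alpha_N$ is a strongly consistent estimator of the mean geodesic tortuosity $\tau$ of $\Xi$ as $N\to\infty$, i.e. $\widehat\tau^\alpha_N\to\tau$ almost surely. (ii) If $\lim_{N\to\infty}\mathbb P(R^\alpha_N)=1$, then $\widehat\tau^\alpha_N$ is a weakly consistent estimator of $\tau$ as $N\to\infty$, i.e. $\widehat\tau^\alpha_N\to\tau$ in probability.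
   Context: $o$ is the origin of $\mathbb R^d$; $\mathcal H_k$ is the $k$-dimensional Hausdorff measure; $\mathcal F$ is the family of closed subsets of $\mathbb R^d$ with the Borel $\sigma$-algebra of the Fell topology. The underlying probability space $(\Omega,\mathcal A,\mathbb P)$ is complete. $H_{\mathsf I}=\{x\in\mathbb R^d:x_d=0\}$, $H_{\mathsf O}=\{x\in\mathbb R^d:x_d=1\}$, $W_N=[-N/2,N/2]^{d-1}\times[0,1]$, $H_{\mathsf I,N}=H_{\mathsf I}\cap W_N$, and the dilated window is $W^\alpha_N=W_N\oplus([-N^\alpha,N^\alpha]^{d-1}\times[-N^\alpha,0])$, with $\oplus$ Minkowski addition. For $F_0,F_1\in\mathcal F$ and $x\in\mathbb R^d$, $\mathcal P_{F_0}(x,F_1)$ is the set of Lipschitz maps $f:[0,1]\to\mathring F_0$ (the interior of $F_0$) with $f(0)=x$, $f(1)\in F_1$. Put $\mathcal C_{F_0}(F_1)=\{x\in\mathbb R^d:\mathcal P_{F_0}(x,F_1)\ne\emptyset\}$ and $\gamma_{F_0}(x,F_1)=\inf_{f\in\mathcal P_{F_0}(x,F_1)}\mathcal H_1(f([0,1]))$ (with $\inf\emptyset=\infty$). The event $R^\alpha_N$ is meant to express that all shortest paths in $\Xi$ from $H_{\mathsf I,N}$ to $H_{\mathsf O}$ are completely contained in $W^\alpha_N$. $\mathbb R^{d-1}$-stationary and ergodic: there is a group $\{\mathbf T_x\}_{x\in H_{\mathsf I}}$ of $\mathbb P$-preserving maps $\mathbf T_x:\Omega\to\Omega$ with $\Xi(\mathbf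 T_x\omega)=\Xi(\omega)-x$, and $\Xi$ is stationary and ergodic with respect to this group. Mean geodesic tortuosity: $\tau=\mathbb E[\gamma_\Xi(o,H_{\mathsf O})\mid o\in\mathcal C_\Xi(H_{\mathsf O})]$ if $\mathbb P(o\in\mathcal C_\Xi(H_{\mathsf O}))>0$, and $\tau=\infty$ otherwise.
   Formalization: As H_O meets only the boundary of the window, no path in the interior of Ξ∩W^α_N reaches H_O and the estimator reads 0/0; the formal theorem covers this literal reading and also takes the interior relative to W^α_N, and sets the estimator to ∞ when its denominator vanishes. *)

theory Defs
  imports "HOL-Probability.Probability"
begin

section \<open>Hausdorff measure\<close>

text \<open>The normalisation by the volume of the \<open>k\<close>-dimensional unit ball makes the measure agree with
  \<open>k\<close>-dimensional volume; for \<open>k = 1\<close> each covering set is weighted by its diameter.  Covering sets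
  are required to be bounded because \<^const>\<open>diameter\<close> is unspecified on unbounded sets, and the empty
  set gets weight 0 also for \<open>k = 0\<close>.\<close>

definition hausdorff_weight :: "nat \<Rightarrow> 'a::metric_space set \<Rightarrow> ennreal" where
  "hausdorff_weight k U =
     (if U = {} then 0 else ennreal (unit_ball_vol (real k) * (diameter U / 2) ^ k))"

definition hausdorff_outer :: "nat \<Rightarrow> 'a::metric_space set \<Rightarrow> ennreal" where
  "hausdorff_outer k A =
     (SUP \<delta>\<in>{0::real<..}.
        INF U\<in>{U :: nat \<Rightarrow> 'a set. A \<subseteq> (\<Union>i. U i) \<and> (\<forall>i. bounded (U i) \<and> diameter (U i) \<le> \<delta>)}.
          (\<Sum>i. hausdorff_weight k (U i)))"

text \<open>\<^const>\<open>hausdorff_outer\<close> is a metric outer measure, hence countably additive on Borel sets, so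
  that \<^const>\<open>emeasure\<close> of the following measure agrees with it on Borel sets.\<close>

definition hausdorff_measure :: "nat \<Rightarrow> 'a::metric_space measure" where
  "hausdorff_measure k = measure_of UNIV (sets borel) (hausdorff_outer k)"


section \<open>Random closed sets\<close>

definition fell_topology :: "'a::topological_space set topology" where
  "fell_topology = topology_generated_by
     ({{F. closed F \<and> F \<inter> K = {}} | K. compact K} \<union>
      {{F. closed F \<and> F \<inter> G \<noteq> {}} | G. open G})"

definition fell_borel :: "'a::topological_space set measure" where
  "fell_borel = sigma {F. closed F} {U. openin fell_topology U}"

definition random_closed_set :: "'w measure \<Rightarrow> ('w \<Rightarrow> 'a::topological_space set) \<Rightarrow> bool" where
  "random_closed_set M \<Xi> \<longleftrightarrow> \<Xi> \<in> measurable M fell_borel"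

definition shift :: "'a::ab_group_add \<Rightarrow> 'a set \<Rightarrow> 'a set" where
  "shift x F = (\<lambda>y. y - x) ` F"

definition preserving_group :: "'w measure \<Rightarrow> 'a::ab_group_add set \<Rightarrow> ('a \<Rightarrow> 'w \<Rightarrow> 'w) \<Rightarrow> bool" where
  "preserving_group M H T \<longleftrightarrow>
     (\<forall>x\<in>H. T x \<in> measurable M M \<and> distr M M (T x) = M) \<and>
     (\<forall>\<omega>\<in>space M. T 0 \<omega> = \<omega>) \<and>
     (\<forall>x\<in>H. \<forall>y\<in>H. \<forall>\<omega>\<in>space M. T (x + y) \<omega> = T x (T y \<omega>))"

definition stationary_on ::
    "'w measure \<Rightarrow> 'a::{topological_space, ab_group_add} set \<Rightarrow> ('w \<Rightarrow> 'a set) \<Rightarrow> bool" where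
  "stationary_on M H \<Xi> \<longleftrightarrow>
     (\<forall>x\<in>H. distr M fell_borel (\<lambda>\<omega>. shift x (\<Xi> \<omega>)) = distr M fell_borel \<Xi>)"

text \<open>Ergodicity is required only for the invariant events generated by \<open>\<Xi>\<close>; it follows from the
  zero-one law for all invariant events of \<open>M\<close>.\<close>

definition ergodic_under ::
    "'w measure \<Rightarrow> 'a::topological_space set \<Rightarrow> ('a \<Rightarrow> 'w \<Rightarrow> 'w) \<Rightarrow> ('w \<Rightarrow> 'a set) \<Rightarrow> bool" where
  "ergodic_under M H T \<Xi> \<longleftrightarrow>
     (\<forall>B\<in>sets fell_borel. let E = \<Xi> -` B \<inter> space M in
        (\<forall>x\<in>H. T x -` E \<inter> space M = E) \<longrightarrow> measure M E = 0 \<or> measure M E = 1)"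

definition stationary_ergodic ::
    "'w measure \<Rightarrow> 'a::{topological_space, ab_group_add} set \<Rightarrow> ('w \<Rightarrow> 'a set) \<Rightarrow> bool" where
  "stationary_ergodic M H \<Xi> \<longleftrightarrow>
     (\<exists>T. preserving_group M H T \<and>
          (\<forall>x\<in>H. \<forall>\<omega>\<in>space M. \<Xi> (T x \<omega>) = shift x (\<Xi> \<omega>)) \<and>
          stationary_on M H \<Xi> \<and> ergodic_under M H T \<Xi>)"

definition converges_in_prob ::
    "'w measure \<Rightarrow> (nat \<Rightarrow> 'w \<Rightarrow> ennreal) \<Rightarrow> ennreal \<Rightarrow> bool" where
  "converges_in_prob M X c \<longleftrightarrow>
     (\<forall>n. X n \<in> borel_measurable M) \<and>
     (\<forall>U. open U \<and> c \<in> U \<longrightarrow> (\<lambda>n. measure M {\<omega>\<in>space M. X n \<omega> \<notin> U}) \<longlonglongrightarrow> 0)"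


section \<open>Geodesic lengths\<close>

text \<open>The topology \<open>X\<close> is the one in which the interior of \<open>F0\<close> is taken.  It is
  \<^term>\<open>euclidean\<close> for sets in the whole space.  A window \<open>W\<close> may have the target hyperplane on its
  boundary; then the Euclidean interior of \<open>\<Xi> \<inter> W\<close> never meets the target and no path is admissible.
  In this case the interior relative to \<open>W\<close>, i.e. \<open>X = top_of_set W\<close>, gives the paths that stay
  in \<open>W\<close> and avoid the boundary of \<open>\<Xi>\<close> within \<open>W\<close>.\<close>

definition lipschitz_paths ::
    "'a::metric_space topology \<Rightarrow> 'a set \<Rightarrow> 'a \<Rightarrow> 'a set \<Rightarrow> (real \<Rightarrow> 'a) set" where
  "lipschitz_paths X F0 x F1 =
     {f. (\<exists>L. L-lipschitz_on {0..1} f) \<and> f ` {0..1} \<subseteq> X interior_of F0 \<and> f 0 = x \<and> f 1 \<in> F1}"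

lemma lipschitz_paths_euclidean:
  "lipschitz_paths euclidean F0 x F1 =
     {f. (\<exists>L. L-lipschitz_on {0..1} f) \<and> f ` {0..1} \<subseteq> interior F0 \<and> f 0 = x \<and> f 1 \<in> F1}"
  by (simp add: lipschitz_paths_def)

definition connected_points :: "'a::metric_space topology \<Rightarrow> 'a set \<Rightarrow> 'a set \<Rightarrow> 'a set" where
  "connected_points X F0 F1 = {x. lipschitz_paths X F0 x F1 \<noteq> {}}"

definition geodesic_length :: "'a::metric_space topology \<Rightarrow> 'a set \<Rightarrow> 'a \<Rightarrow> 'a set \<Rightarrow> ennreal" where
  "geodesic_length X F0 x F1 = (INF f\<in>lipschitz_paths X F0 x F1. hausdorff_outer 1 (f ` {0..1}))"


section \<open>Windows and tortuosity\<close>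

text \<open>The index \<open>d\<close> designates the transport coordinate, the last one in the usual enumeration of
  coordinates; the dimension of the space is \<^term>\<open>CARD('n)\<close>.\<close>

definition H_in :: "'n::finite \<Rightarrow> (real^'n) set" where
  "H_in d = {x. x $ d = 0}"

definition H_out :: "'n::finite \<Rightarrow> (real^'n) set" where
  "H_out d = {x. x $ d = 1}"

definition window :: "'n::finite \<Rightarrow> nat \<Rightarrow> (real^'n) set" where
  "window d N = {x. (\<forall>i. i \<noteq> d \<longrightarrow> x $ i \<in> {- real N / 2 .. real N / 2}) \<and> x $ d \<in> {0..1}}"

definition H_in_window :: "'n::finite \<Rightarrow> nat \<Rightarrow> (real^'n) set" where
  "H_in_window d N = H_in d \<inter> window d N"

definition dilated_window :: "'n::finite \<Rightarrow> real \<Rightarrow> nat \<Rightarrow> (real^'n) set" where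
  "dilated_window d \<alpha> N = window d N +
     {x. (\<forall>i. i \<noteq> d \<longrightarrow> x $ i \<in> {- (real N powr \<alpha>) .. real N powr \<alpha>}) \<and> x $ d \<in> {- (real N powr \<alpha>) .. 0}}"

definition rational_points :: "(real^'n::finite) set" where
  "rational_points = {x. \<forall>i. x $ i \<in> \<rat>}"

definition mean_tortuosity :: "'w measure \<Rightarrow> 'n::finite \<Rightarrow> ('w \<Rightarrow> (real^'n) set) \<Rightarrow> ennreal" where
  "mean_tortuosity M d \<Xi> =
     (let A = {\<omega>\<in>space M. 0 \<in> connected_points euclidean (\<Xi> \<omega>) (H_out d)} in
      if measure M A > 0
      then (\<integral>\<^sup>+\<omega>\<in>A. geodesic_length euclidean (\<Xi> \<omega>) 0 (H_out d) \<partial>M) / emeasure M A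
      else \<infinity>)"

definition R_event ::
    "'w measure \<Rightarrow> 'n::finite \<Rightarrow> ('w \<Rightarrow> (real^'n) set) \<Rightarrow> (nat \<Rightarrow> (real^'n) topology) \<Rightarrow> real \<Rightarrow> nat \<Rightarrow> 'w set"
  where
  "R_event M d \<Xi> X \<alpha> N =
     {\<omega>\<in>space M. \<forall>x\<in>H_in_window d N \<inter> rational_points.
        geodesic_length euclidean (\<Xi> \<omega>) x (H_out d) =
        geodesic_length (X N) (\<Xi> \<omega> \<inter> dilated_window d \<alpha> N) x (H_out d)}"

text \<open>The indeterminate quotient \<open>0 / 0\<close> is read as \<open>\<infinity>\<close>, in line with the value of
  \<^const>\<open>mean_tortuosity\<close> when the conditioning event has probability 0.\<close>

definition tortuosity_estimator ::
    "'n::finite \<Rightarrow> (nat \<Rightarrow> (real^'n) topology) \<Rightarrow> real \<Rightarrow> nat \<Rightarrow> (real^'n) set \<Rightarrow> ennreal" where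
  "tortuosity_estimator d X \<alpha> N F =
     (let F0 = F \<inter> dilated_window d \<alpha> N;
          S = connected_points (X N) F0 (H_out d) \<inter> H_in_window d N;
          \<mu> = hausdorff_measure (CARD('n) - 1)
      in if emeasure \<mu> S = 0 then \<infinity>
         else (\<integral>\<^sup>+x\<in>S. geodesic_length (X N) F0 x (H_out d) \<partial>\<mu>) / emeasure \<mu> S)"

end

(* By Wiener's pointwise ergodic theorem, spatial averages of the geodesic length and of the
   indicator of the connected points over growing windows converge almost surely to their means, so
   the ratio computed in the whole space converges to the mean tortuosity.  On R_N this ratio is the
   estimator, because geodesic lengths are locally 1-Lipschitz in their starting point.

   The pointwise theorem is obtained from the maximal inequality and the mean ergodic theorem;
   measurability from the fact that a geodesic length is an infimum over polygons with vertices in a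
   countable dense set; and Hausdorff measure on the hyperplane is compared with Lebesgue measure by
   uniqueness of translation invariant measures, up to a factor that cancels in the ratio. *)

theory Submission
  imports Defs "HOL-Library.Transitive_Closure_Table"
begin

section \<open>Hausdorff measure\<close>

definition hausdorff_pre :: "nat \<Rightarrow> real \<Rightarrow> 'a::metric_space set \<Rightarrow> ennreal" where
  "hausdorff_pre k \<delta> A =
     (INF U\<in>{U :: nat \<Rightarrow> 'a set. A \<subseteq> (\<Union>i. U i) \<and> (\<forall>i. bounded (U i) \<and> diameter (U i) \<le> \<delta>)}.
          (\<Sum>i. hausdorff_weight k (U i)))"

lemma hausdorff_outer_pre: "hausdorff_outer k A = (SUP \<delta>\<in>{0<..}. hausdorff_pre k \<delta> A)"
  by (simp add: hausdorff_outer_def hausdorff_pre_def)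

lemma hausdorff_pre_le_outer: "\<delta> > 0 \<Longrightarrow> hausdorff_pre k \<delta> A \<le> hausdorff_outer k A"
  unfolding hausdorff_outer_pre by (rule SUP_upper) auto

lemma hausdorff_pre_le:
  assumes "A \<subseteq> (\<Union>i. U i)" "\<And>i. bounded (U i)" "\<And>i. diameter (U i) \<le> \<delta>"
  shows "hausdorff_pre k \<delta> A \<le> (\<Sum>i. hausdorff_weight k (U i))"
  unfolding hausdorff_pre_def by (rule INF_lower) (use assms in auto)

lemma hausdorff_pre_mono: "A \<subseteq> B \<Longrightarrow> hausdorff_pre k \<delta> A \<le> hausdorff_pre k \<delta> B"
  unfolding hausdorff_pre_def by (rule INF_superset_mono) auto

lemma hausdorff_pre_antimono: "\<delta> \<le> \<delta>' \<Longrightarrow> hausdorff_pre k \<delta>' A \<le> hausdorff_pre k \<delta> A"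
  unfolding hausdorff_pre_def by (rule INF_superset_mono) (auto intro: order_trans)

lemma hausdorff_pre_less_iff:
  "hausdorff_pre k \<delta> A < t \<longleftrightarrow> (\<exists>U. A \<subseteq> (\<Union>i. U i) \<and> (\<forall>i. bounded (U i) \<and> diameter (U i) \<le> \<delta>) \<and>
      (\<Sum>i. hausdorff_weight k (U i)) < t)"
  unfolding hausdorff_pre_def INF_less_iff by auto

lemma hausdorff_weight_empty [simp]: "hausdorff_weight k {} = 0"
  by (simp add: hausdorff_weight_def)

lemma hausdorff_outer_mono: "A \<subseteq> B \<Longrightarrow> hausdorff_outer k A \<le> hausdorff_outer k B"
  unfolding hausdorff_outer_pre by (intro SUP_mono) (auto intro: hausdorff_pre_mono)

lemma hausdorff_outer_finite_cover:
  assumes "\<And>\<delta>. \<delta> > 0 \<Longrightarrow> \<exists>\<C>. finite \<C> \<and> A \<subseteq> \<Union>\<C> \<and> (\<forall>U\<in>\<C>. bounded U \<and> diameter U \<le> \<delta>) \<and>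
             (\<Sum>U\<in>\<C>. hausdorff_weight k U) \<le> B"
  shows "hausdorff_outer k A \<le> B"
  unfolding hausdorff_outer_pre
proof (rule SUP_least)
  fix \<delta> :: real assume "\<delta> \<in> {0<..}"
  then obtain \<C> where \<C>: "finite \<C>" "A \<subseteq> \<Union>\<C>" "\<And>U. U \<in> \<C> \<Longrightarrow> bounded U \<and> diameter U \<le> \<delta>"
      "(\<Sum>U\<in>\<C>. hausdorff_weight k U) \<le> B" and "\<delta> > 0"
    using assms[of \<delta>] by auto
  obtain h where h: "bij_betw h {0..<card \<C>} \<C>" using ex_bij_betw_nat_finite[OF \<C>(1)] by blast
  define U where "U i = (if i < card \<C> then h i else {})" for i
  have hU: "h i \<in> \<C>" if "i < card \<C>" for i using h that by (auto simp: bij_betw_def)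
  have "hausdorff_pre k \<delta> A \<le> (\<Sum>i. hausdorff_weight k (U i))"
  proof (rule hausdorff_pre_le)
    show "A \<subseteq> (\<Union>i. U i)"
    proof
      fix x assume "x \<in> A"
      then obtain C where "C \<in> \<C>" "x \<in> C" using \<C>(2) by auto
      moreover then obtain i where "i < card \<C>" "C = h i"
        using bij_betw_imp_surj_on[OF h] by (metis imageE atLeastLessThan_iff)
      ultimately show "x \<in> (\<Union>i. U i)" by (auto simp: U_def intro!: exI[of _ i])
    qed
  qed (use \<C>(3) hU \<open>\<delta> > 0\<close> in \<open>auto simp: U_def\<close>)
  also have "\<dots> = (\<Sum>i<card \<C>. hausdorff_weight k (U i))"
    by (rule suminf_finite) (auto simp: U_def)
  also have "\<dots> = (\<Sum>i\<in>{0..<card \<C>}. hausdorff_weight k (h i))"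
    by (rule sum.cong) (auto simp: U_def)
  also have "\<dots> = (\<Sum>U\<in>\<C>. hausdorff_weight k U)"
    by (rule sum.reindex_bij_betw[OF h])
  finally show "hausdorff_pre k \<delta> A \<le> B" using \<C>(4) by simp
qed

lemma hausdorff_outer_empty [simp]: "hausdorff_outer k {} = 0"
  by (rule antisym[OF hausdorff_outer_finite_cover]) (auto intro!: exI[of _ "{}"])

lemma hausdorff_pre_UN:
  assumes "\<delta> > 0"
  shows "hausdorff_pre k \<delta> (\<Union>i. A i) \<le> (\<Sum>i. hausdorff_pre k \<delta> (A (i::nat)))"
proof (rule ennreal_le_epsilon)
  fix e :: real assume e: "0 < e" and fin: "(\<Sum>i. hausdorff_pre k \<delta> (A i)) < top"
  have "\<exists>U. A i \<subseteq> (\<Union>j. U j) \<and> (\<forall>j. bounded (U j) \<and> diameter (U j) \<le> \<delta>) \<and>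
      (\<Sum>j. hausdorff_weight k (U j)) \<le> hausdorff_pre k \<delta> (A i) + ennreal (e * (1/2)^Suc i)" for i
  proof -
    have "hausdorff_pre k \<delta> (A i) < top"
      using fin ennreal_suminf_lessD by blast
    then have "hausdorff_pre k \<delta> (A i) < hausdorff_pre k \<delta> (A i) + ennreal (e * (1/2)^Suc i)"
      using e ennreal_add_left_cancel_less[of "hausdorff_pre k \<delta> (A i)" 0 "ennreal (e * (1/2)^Suc i)"]
      by (simp add: less_top ennreal_zero_less_mult_iff del: power_Suc)
    then show ?thesis unfolding hausdorff_pre_less_iff by (meson less_imp_le)
  qed
  then obtain U where U: "\<And>i. A i \<subseteq> (\<Union>j. U i j)" "\<And>i j. bounded (U i j)" "\<And>i j. diameter (U i j) \<le> \<delta>"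
      "\<And>i. (\<Sum>j. hausdorff_weight k (U i j)) \<le> hausdorff_pre k \<delta> (A i) + ennreal (e * (1/2)^Suc i)"
    by metis
  have "hausdorff_pre k \<delta> (\<Union>i. A i) \<le> (\<Sum>n. hausdorff_weight k (case_prod U (prod_decode n)))"
  proof (rule hausdorff_pre_le)
    show "(\<Union>i. A i) \<subseteq> (\<Union>n. case_prod U (prod_decode n))"
    proof
      fix x assume "x \<in> (\<Union>i. A i)"
      then obtain i j where "x \<in> U i j" using U(1) by blast
      then show "x \<in> (\<Union>n. case_prod U (prod_decode n))"
        by (auto intro!: exI[of _ "prod_encode (i,j)"])
    qed
  qed (use U in \<open>auto split: prod.split\<close>)
  also have "\<dots> = (\<Sum>i. \<Sum>j. hausdorff_weight k (U i j))"
    using suminf_ennreal_2dimen[of "\<lambda>i. \<Sum>j. hausdorff_weight k (U i j)" "\<lambda>p. hausdorff_weight k (case_prod U p)"]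
    by simp
  also have "\<dots> \<le> (\<Sum>i. hausdorff_pre k \<delta> (A i) + ennreal (e * (1/2)^Suc i))"
    by (intro suminf_le U(4)) auto
  also have "\<dots> = (\<Sum>i. hausdorff_pre k \<delta> (A i)) + (\<Sum>i. ennreal (e * (1/2)^Suc i))"
    by (rule suminf_add[symmetric]) auto
  also have "(\<Sum>i. ennreal (e * (1/2)^Suc i)) = ennreal e"
    using sums_mult[OF power_half_series, of e] e
    by (subst suminf_ennreal_eq[where x=e]) auto
  finally show "hausdorff_pre k \<delta> (\<Union>i. A i) \<le> (\<Sum>i. hausdorff_pre k \<delta> (A i)) + ennreal e" .
qed

lemma hausdorff_outer_UN: "hausdorff_outer k (\<Union>i. A i) \<le> (\<Sum>i. hausdorff_outer k (A (i::nat)))"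
  unfolding hausdorff_outer_pre[of k "\<Union>i. A i"]
proof (rule SUP_least)
  fix \<delta> :: real assume "\<delta> \<in> {0<..}"
  then show "hausdorff_pre k \<delta> (\<Union>i. A i) \<le> (\<Sum>i. hausdorff_outer k (A i))"
    by (intro order_trans[OF hausdorff_pre_UN] suminf_le hausdorff_pre_le_outer) auto
qed

lemma hausdorff_outer_Un: "hausdorff_outer k (A \<union> B) \<le> hausdorff_outer k A + hausdorff_outer k B"
proof -
  define F where "F = (\<lambda>n::nat. if n = 0 then A else if n = 1 then B else {})"
  have "A = F 0" "B = F 1" "F n \<subseteq> A \<union> B" for n by (auto simp: F_def)
  then have "(\<Union>n. F n) = A \<union> B" by blast
  then have "hausdorff_outer k (A \<union> B) \<le> (\<Sum>n. hausdorff_outer k (F n))" using hausdorff_outer_UN[of k F] by simp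
  also have "\<dots> = (\<Sum>n\<in>{0,1}. hausdorff_outer k (F n))"
    by (rule suminf_finite) (auto simp: F_def)
  also have "\<dots> = hausdorff_outer k A + hausdorff_outer k B" by (simp add: F_def)
  finally show ?thesis .
qed

lemma outer_measure_hausdorff: "outer_measure_space UNIV (hausdorff_outer k)"
  unfolding outer_measure_space_def positive_def increasing_def countably_subadditive_def
  by (auto intro: hausdorff_outer_mono hausdorff_outer_UN)

lemma hausdorff_outer_separated:
  assumes r: "r > 0" and sep: "\<And>x y. x \<in> A \<Longrightarrow> y \<in> B \<Longrightarrow> dist x y \<ge> r"
  shows "hausdorff_outer k A + hausdorff_outer k B \<le> hausdorff_outer k (A \<union> B)"
proof -
  have pre: "hausdorff_pre k \<delta> A + hausdorff_pre k \<delta> B \<le> hausdorff_pre k \<delta> (A \<union> B)" if \<delta>: "0 < \<delta>" "\<delta> < r" for \<delta>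
    unfolding hausdorff_pre_def[of k \<delta> "A \<union> B"]
  proof (rule INF_greatest)
    fix U :: "nat \<Rightarrow> 'a set"
    assume "U \<in> {U. A \<union> B \<subseteq> (\<Union>i. U i) \<and> (\<forall>i. bounded (U i) \<and> diameter (U i) \<le> \<delta>)}"
    then have U: "A \<union> B \<subseteq> (\<Union>i. U i)" "\<And>i. bounded (U i)" "\<And>i. diameter (U i) \<le> \<delta>" by auto
    define V where "V i = (if U i \<inter> A \<noteq> {} then U i else {})" for i
    define V' where "V' i = (if U i \<inter> A = {} then U i else {})" for i
    have 1: "hausdorff_pre k \<delta> A \<le> (\<Sum>i. hausdorff_weight k (V i))"
    proof (rule hausdorff_pre_le)
      show "A \<subseteq> (\<Union>i. V i)" using U(1) unfolding V_def by fastforce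
    qed (use U \<delta> in \<open>auto simp: V_def\<close>)
    have 2: "hausdorff_pre k \<delta> B \<le> (\<Sum>i. hausdorff_weight k (V' i))"
    proof (rule hausdorff_pre_le)
      show "B \<subseteq> (\<Union>i. V' i)"
      proof
        fix y assume y: "y \<in> B"
        then obtain i where i: "y \<in> U i" using U(1) by auto
        have "U i \<inter> A = {}"
        proof (rule ccontr)
          assume "U i \<inter> A \<noteq> {}"
          then obtain x where x: "x \<in> U i" "x \<in> A" by auto
          then have "dist x y \<le> \<delta>" using diameter_bounded_bound[OF U(2) x(1) i] U(3)[of i] by simp
          then show False using sep[OF x(2) y] \<delta> by simp
        qed
        then show "y \<in> (\<Union>i. V' i)" using i by (auto simp: V'_def)
      qed
    qed (use U \<delta> in \<open>auto simp: V'_def\<close>)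
    have "hausdorff_pre k \<delta> A + hausdorff_pre k \<delta> B
        \<le> (\<Sum>i. hausdorff_weight k (V i)) + (\<Sum>i. hausdorff_weight k (V' i))" by (rule add_mono[OF 1 2])
    also have "\<dots> = (\<Sum>i. hausdorff_weight k (V i) + hausdorff_weight k (V' i))"
      by (rule suminf_add) auto
    also have "\<dots> = (\<Sum>i. hausdorff_weight k (U i))"
      by (rule arg_cong[where f=suminf]) (auto simp: V_def V'_def)
    finally show "hausdorff_pre k \<delta> A + hausdorff_pre k \<delta> B \<le> (\<Sum>i. hausdorff_weight k (U i))" .
  qed
  have "hausdorff_pre k \<delta> A + hausdorff_pre k \<delta>' B \<le> hausdorff_outer k (A \<union> B)" if "0 < \<delta>" "0 < \<delta>'" for \<delta> \<delta>'
  proof -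
    define \<delta>0 where "\<delta>0 = min (r/2) (min \<delta> \<delta>')"
    have *: "0 < \<delta>0" "\<delta>0 < r" "\<delta>0 \<le> \<delta>" "\<delta>0 \<le> \<delta>'" using r that by (auto simp: \<delta>0_def)
    have "hausdorff_pre k \<delta> A + hausdorff_pre k \<delta>' B \<le> hausdorff_pre k \<delta>0 A + hausdorff_pre k \<delta>0 B"
      by (intro add_mono hausdorff_pre_antimono *)
    also have "\<dots> \<le> hausdorff_outer k (A \<union> B)"
      using pre[OF *(1,2)] hausdorff_pre_le_outer[OF *(1)] by (rule order_trans)
    finally show ?thesis .
  qed
  then have "hausdorff_outer k A + hausdorff_pre k \<delta>' B \<le> hausdorff_outer k (A \<union> B)" if "0 < \<delta>'" for \<delta>'
    unfolding hausdorff_outer_pre[of k A] using that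
    by (subst ennreal_SUP_add_left[symmetric]) (auto intro!: SUP_least)
  then show ?thesis
    unfolding hausdorff_outer_pre[of k B]
    by (subst ennreal_SUP_add_right) (auto intro!: SUP_least)
qed

lemma ennreal_suminf_tail_tendsto:
  fixes f :: "nat \<Rightarrow> ennreal"
  assumes "suminf f \<noteq> \<top>"
  shows "(\<lambda>n. \<Sum>j. f (j + n)) \<longlonglongrightarrow> 0"
proof -
  have f: "f j = ennreal (enn2real (f j))" for j
    using ennreal_suminf_lessD[of f \<top> j] assms by (simp add: less_top)
  have "(\<Sum>j. ennreal (enn2real (f j))) \<noteq> \<top>" using assms by (subst f[symmetric])
  then have s: "summable (\<lambda>j. enn2real (f j))" by (intro summable_suminf_not_top) auto
  have "(\<lambda>n. ennreal (\<Sum>j. enn2real (f (j + n)))) \<longlonglongrightarrow> ennreal 0"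
    by (intro tendsto_ennrealI suminf_exist_split2 s)
  moreover have "(\<Sum>j. f (j + n)) = ennreal (\<Sum>j. enn2real (f (j + n)))" for n
    by (subst f, rule suminf_ennreal2) (use s in \<open>auto simp: summable_iff_shift[of "\<lambda>j. enn2real (f j)"]\<close>)
  ultimately show ?thesis by simp
qed

lemma hausdorff_outer_sum_separated:
  fixes R :: "nat \<Rightarrow> 'a::metric_space set"
  assumes sep: "\<And>m. \<exists>r>0. \<forall>j<m. \<forall>x\<in>R j. \<forall>y\<in>R m. dist x y \<ge> r"
  shows "(\<Sum>j<n. hausdorff_outer k (R j)) \<le> hausdorff_outer k (\<Union>j<n. R j)"
proof (induction n)
  case (Suc n)
  obtain r where r: "r > 0" "\<And>j x y. j < n \<Longrightarrow> x \<in> R j \<Longrightarrow> y \<in> R n \<Longrightarrow> dist x y \<ge> r" using sep[of n] by blast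
  have "(\<Sum>j<Suc n. hausdorff_outer k (R j)) \<le> hausdorff_outer k (\<Union>j<n. R j) + hausdorff_outer k (R n)"
    using Suc by (simp add: add_right_mono)
  also have "\<dots> \<le> hausdorff_outer k ((\<Union>j<n. R j) \<union> R n)"
    using r by (intro hausdorff_outer_separated[of r]) auto
  also have "(\<Union>j<n. R j) \<union> R n = (\<Union>j<Suc n. R j)" by (auto simp: lessThan_Suc)
  finally show ?case .
qed simp

text \<open>Caratheodory's criterion: the shells \<open>R j\<close> of the points at distance about \<open>1/j\<close> from
  \<open>C\<close> are separated along even and along odd indices, so that the tail of the sum over all of
  them is small.\<close>

lemma closed_in_hausdorff_lambda_system:
  fixes C :: "'a::metric_space set"
  assumes "closed C"
  shows "C \<in> lambda_system UNIV UNIV (hausdorff_outer k)"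
proof -
  let ?H = "hausdorff_outer k :: 'a set \<Rightarrow> ennreal"
  have "?H (A \<inter> C) + ?H (A - C) \<le> ?H A" for A
  proof (cases "C = {} \<or> ?H A = \<infinity>")
    case True
    then show ?thesis by auto
  next
    case False
    then have ne: "C \<noteq> {}" and fin: "?H A < \<infinity>" by (auto simp: less_top)
    define R where "R j = {x\<in>A. 1 / (real j + 2) < infdist x C \<and> infdist x C \<le> 1 / (real j + 1)}" for j
    define S where "S n = {x\<in>A. 1 / (real n + 1) < infdist x C}" for n
    have gap: "dist x y \<ge> 1/(real j + 2) - 1/(real l + 1)" if "x \<in> R j" "y \<in> R l" for x y j l
      using that infdist_triangle[of x C y] by (auto simp: R_def)
    have evodd: "(\<Sum>j<n. ?H (R (2*j + i))) \<le> ?H A" for n i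
    proof -
      have "(\<Sum>j<n. ?H (R (2*j+i))) \<le> ?H (\<Union>j<n. R (2*j+i))"
      proof (rule hausdorff_outer_sum_separated)
        fix m
        have "dist x y \<ge> 1/(2*real m + real i) - 1/(2*real m + real i+1)"
          if "j < m" "x \<in> R (2*j+i)" "y \<in> R (2*m+i)" for j x y
        proof -
          have "2*real j + real i + 2 \<le> 2*real m + real i" using that(1) by linarith
          then have "1/(2*real m + real i) \<le> 1/(2*real j + real i + 2)" by (intro divide_left_mono) auto
          then show ?thesis using gap[OF that(2,3)] by (simp add: algebra_simps)
        qed
        moreover have "1/(2*real m + real i) - 1/(2*real m + real i+1) > 0 \<or> m = 0"
          by (cases "m = 0") (auto simp: divide_strict_left_mono)
        ultimately show "\<exists>r>0. \<forall>j<m. \<forall>x\<in>R (2*j+i). \<forall>y\<in>R (2*m+i). dist x y \<ge> r"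
          by (metis less_nat_zero_code zero_less_one)
      qed
      also have "\<dots> \<le> ?H A" by (rule hausdorff_outer_mono) (auto simp: R_def)
      finally show ?thesis .
    qed
    have "(\<Sum>j<2*n. ?H (R j)) = (\<Sum>j<n. ?H (R (2*j+0))) + (\<Sum>j<n. ?H (R (2*j+1)))" for n
      by (induction n) (auto simp: algebra_simps)
    then have b: "(\<Sum>j<2*n. ?H (R j)) \<le> ?H A + ?H A" for n by (metis add_mono evodd)
    have "(\<Sum>j<n. ?H (R j)) \<le> ?H A + ?H A" for n
      using b[of n] sum_mono2[of "{..<2*n}" "{..<n}" "\<lambda>j. ?H (R j)"] by (auto intro: order_trans)
    then have "(\<Sum>j. ?H (R j)) \<le> ?H A + ?H A" by (intro suminf_le_const) auto
    then have sumfin: "(\<Sum>j. ?H (R j)) \<noteq> \<top>" using fin by (auto simp: top_unique less_top[symmetric])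
    have S1: "?H (A \<inter> C) + ?H (S n) \<le> ?H A" for n
    proof -
      have "?H (A \<inter> C) + ?H (S n) \<le> ?H ((A \<inter> C) \<union> S n)"
      proof (rule hausdorff_outer_separated)
        show "1/(real n + 1) > 0" by simp
        fix x y assume "x \<in> A \<inter> C" "y \<in> S n"
        then show "dist x y \<ge> 1/(real n + 1)" using infdist_le[of x C y] by (auto simp: S_def dist_commute)
      qed
      also have "\<dots> \<le> ?H A" by (rule hausdorff_outer_mono) (auto simp: S_def)
      finally show ?thesis .
    qed
    have S2: "?H (A - C) \<le> ?H (S n) + (\<Sum>j. ?H (R (j + n)))" for n
    proof -
      have "A - C \<subseteq> S n \<union> (\<Union>j. R (j + n))"
      proof
        fix x assume x: "x \<in> A - C"
        then have pos: "infdist x C > 0" using assms ne infdist_pos_not_in_closed by blast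
        show "x \<in> S n \<union> (\<Union>j. R (j + n))"
        proof (cases "x \<in> S n")
          case False
          then have le: "infdist x C \<le> 1/(real n + 1)" using x by (auto simp: S_def)
          obtain m where m: "1/(real m + 1) < infdist x C"
            using reals_Archimedean[OF pos] by (metis inverse_eq_divide of_nat_Suc add.commute)
          define m0 where "m0 = (LEAST m. 1/(real m + 1) < infdist x C)"
          have m0: "1/(real m0 + 1) < infdist x C" unfolding m0_def by (rule LeastI[of _ m]) (rule m)
          have "m0 > n" using m0 le by (smt (verit) frac_le not_less of_nat_0_le_iff of_nat_mono)
          then obtain j where j: "m0 = Suc (j + n)" by (metis add.commute less_iff_Suc_add)
          have "\<not> 1/(real (j+n) + 1) < infdist x C" using not_less_Least[of "j+n" "\<lambda>m. 1/(real m + 1) < infdist x C"] j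
            by (simp add: m0_def)
          then have "x \<in> R (j+n)" using m0 x j by (auto simp: R_def add_ac)
          then show ?thesis by auto
        qed auto
      qed
      then have "?H (A - C) \<le> ?H (S n) + ?H (\<Union>j. R (j + n))"
        by (intro order_trans[OF hausdorff_outer_mono hausdorff_outer_Un])
      also have "\<dots> \<le> ?H (S n) + (\<Sum>j. ?H (R (j + n)))" by (intro add_left_mono hausdorff_outer_UN)
      finally show ?thesis .
    qed
    have "?H (A \<inter> C) + ?H (A - C) \<le> ?H A + (\<Sum>j. ?H (R (j + n)))" for n
    proof -
      have "?H (A \<inter> C) + ?H (A - C) \<le> ?H (A \<inter> C) + (?H (S n) + (\<Sum>j. ?H (R (j + n))))"
        by (intro add_left_mono S2)
      also have "\<dots> \<le> ?H A + (\<Sum>j. ?H (R (j + n)))" using add_right_mono[OF S1] by (simp add: add.assoc)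
      finally show ?thesis .
    qed
    moreover have "(\<lambda>n. ?H A + (\<Sum>j. ?H (R (j + n)))) \<longlonglongrightarrow> ?H A + 0"
      by (intro tendsto_add tendsto_const ennreal_suminf_tail_tendsto sumfin)
    ultimately show ?thesis using LIMSEQ_le_const by fastforce
  qed
  moreover have "?H A \<le> ?H (A \<inter> C) + ?H (A - C)" for A
    using hausdorff_outer_Un[of k "A \<inter> C" "A - C"] by (simp add: Un_Diff_Int Int_Diff_Un)
  ultimately have "?H (A \<inter> C) + ?H (A - C) = ?H A" for A by (simp add: antisym)
  then show ?thesis by (auto simp: lambda_system_def Int_commute Diff_eq)
qed

lemma sets_hausdorff_measure [measurable_cong, simp]: "sets (hausdorff_measure k :: 'a::metric_space measure) = sets borel"
  using sets.sigma_sets_eq[of "borel :: 'a measure"] by (simp add: hausdorff_measure_def)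

lemma space_hausdorff_measure [simp]: "space (hausdorff_measure k :: 'a::metric_space measure) = UNIV"
  by (simp add: hausdorff_measure_def)

lemma emeasure_hausdorff_measure:
  fixes A :: "'a::metric_space set"
  assumes "A \<in> sets borel"
  shows "emeasure (hausdorff_measure k) A = hausdorff_outer k A"
  unfolding hausdorff_measure_def
proof (rule emeasure_measure_of_sigma[OF _ _ _ assms])
  let ?L = "lambda_system UNIV UNIV (hausdorff_outer k :: 'a set \<Rightarrow> ennreal)"
  show sb: "sigma_algebra UNIV (sets borel :: 'a set set)"
    using sets.sigma_algebra_axioms[of "borel :: 'a measure"] by simp
  show "positive (sets borel) (hausdorff_outer k :: 'a set \<Rightarrow> ennreal)"
    by (simp add: positive_def)
  have ms: "measure_space UNIV ?L (hausdorff_outer k)"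
    using sigma_algebra.caratheodory_lemma[OF sigma_algebra_Pow, of UNIV "hausdorff_outer k :: 'a set \<Rightarrow> ennreal"]
    by (simp add: outer_measure_hausdorff)
  then interpret L: sigma_algebra UNIV ?L by (simp add: measure_space_def)
  have "sigma_sets UNIV {S :: 'a set. closed S} \<subseteq> ?L"
    by (rule L.sigma_sets_subset) (use closed_in_hausdorff_lambda_system in blast)
  moreover have "sets (borel :: 'a measure) = sigma_sets UNIV {S. closed S}"
    unfolding borel_eq_closed by (rule sets_measure_of) simp
  ultimately have sub: "sets (borel :: 'a measure) \<subseteq> ?L" by metis
  have ca: "countably_additive ?L (hausdorff_outer k)" using ms by (simp add: measure_space_def)
  show "countably_additive (sets borel) (hausdorff_outer k :: 'a set \<Rightarrow> ennreal)"
    unfolding countably_additive_def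
  proof (intro allI impI)
    fix B :: "nat \<Rightarrow> 'a set"
    assume "range B \<subseteq> sets borel" "disjoint_family B" "\<Union>(range B) \<in> sets borel"
    then show "(\<Sum>i. hausdorff_outer k (B i)) = hausdorff_outer k (\<Union>(range B))"
      using ca[unfolded countably_additive_def, rule_format, of B] sub by (meson subset_iff subset_trans)
  qed
qed

lemma diameter_translation:
  fixes U :: "'a::real_normed_vector set"
  shows "diameter ((+) a ` U) = diameter U"
proof (cases "U = {}")
  case False
  have "(\<lambda>(x, y). dist x y) ` ((+) a ` U \<times> (+) a ` U) = (\<lambda>(x, y). dist x y) ` (U \<times> U)"
    by (force simp: image_iff)
  then show ?thesis by (simp add: diameter_def False)
qed simp

lemma hausdorff_weight_translation:
  fixes U :: "'a::real_normed_vector set"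
  shows "hausdorff_weight k ((+) a ` U) = hausdorff_weight k U"
  by (cases "U = {}") (auto simp: hausdorff_weight_def diameter_translation)

lemma hausdorff_pre_translation_le:
  fixes A :: "'a::real_normed_vector set"
  shows "hausdorff_pre k \<delta> ((+) a ` A) \<le> hausdorff_pre k \<delta> A"
  unfolding hausdorff_pre_def[of k \<delta> A]
proof (rule INF_greatest)
  fix U assume "U \<in> {U :: nat \<Rightarrow> 'a set. A \<subseteq> (\<Union>i. U i) \<and> (\<forall>i. bounded (U i) \<and> diameter (U i) \<le> \<delta>)}"
  then have "hausdorff_pre k \<delta> ((+) a ` A) \<le> (\<Sum>i. hausdorff_weight k ((+) a ` U i))"
    by (intro hausdorff_pre_le) (auto simp: diameter_translation bounded_translation simp flip: image_UN)
  then show "hausdorff_pre k \<delta> ((+) a ` A) \<le> (\<Sum>i. hausdorff_weight k (U i))"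
    by (simp add: hausdorff_weight_translation)
qed

lemma hausdorff_outer_translation:
  fixes A :: "'a::real_normed_vector set"
  shows "hausdorff_outer k ((+) a ` A) = hausdorff_outer k A"
proof (rule antisym)
  have le: "hausdorff_outer k ((+) a ` A) \<le> hausdorff_outer k A" for a and A :: "'a set"
    unfolding hausdorff_outer_pre by (intro SUP_mono) (auto intro: hausdorff_pre_translation_le)
  show "hausdorff_outer k ((+) a ` A) \<le> hausdorff_outer k A" by (rule le)
  show "hausdorff_outer k A \<le> hausdorff_outer k ((+) a ` A)"
    using le[of "- a" "(+) a ` A"] by (simp add: image_image)
qed

lemma hausdorff_weight_1: "bounded U \<Longrightarrow> hausdorff_weight 1 U = ennreal (diameter U)"
  by (auto simp: hausdorff_weight_def unit_ball_vol_1)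

lemma hausdorff_outer_lipschitz_image:
  fixes f :: "real \<Rightarrow> 'a::metric_space"
  assumes f: "L-lipschitz_on {0..1} f"
  shows "hausdorff_outer 1 (f ` {0..1}) \<le> ennreal L"
proof (rule hausdorff_outer_finite_cover)
  fix \<delta> :: real assume \<delta>: "\<delta> > 0"
  have L: "L \<ge> 0" using f by (rule lipschitz_on_nonneg)
  obtain n :: nat where n: "n > 0" "L / real n \<le> \<delta>"
  proof -
    obtain n :: nat where n: "L / \<delta> < real n" using reals_Archimedean2 by blast
    then have "0 < real n" using \<delta> L by (meson divide_nonneg_pos le_less_trans)
    moreover from this n have "L / real n \<le> \<delta>" using \<delta> by (simp add: field_simps)
    ultimately have "n > 0" "L / real n \<le> \<delta>" by simp_all
    then show ?thesis using that by blast
  qed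
  define I where "I j = {real j / n .. (real j + 1) / n}" for j
  define U where "U j = f ` I j" for j
  have I: "I j \<subseteq> {0..1}" if "j < n" for j
  proof -
    have "(real j + 1) / n \<le> 1" "0 \<le> real j / n" using that by (auto simp: divide_le_eq_1)
    then show ?thesis unfolding I_def by (auto intro: order_trans)
  qed
  have Ubd: "bounded (U j) \<and> diameter (U j) \<le> L / n" if "j < n" for j
  proof -
    have *: "dist x y \<le> L / n" if xy: "x \<in> U j" "y \<in> U j" for x y
    proof -
      obtain s t where st: "s \<in> I j" "t \<in> I j" "x = f s" "y = f t" using xy by (auto simp: U_def)
      have "dist x y \<le> L * dist s t"
        unfolding st(3,4) by (rule lipschitz_onD[OF f]) (use I[OF \<open>j < n\<close>] st(1,2) in auto)
      also have "dist s t \<le> 1 / n" using st(1,2) n by (auto simp: I_def dist_real_def abs_le_iff add_divide_distrib)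
      finally show ?thesis using L by (simp add: mult_left_mono)
    qed
    have "U j \<noteq> {}" using n by (auto simp: U_def I_def divide_right_mono)
    then have "diameter (U j) \<le> L / n" using * by (auto simp: diameter_def intro!: cSUP_least)
    moreover have "bounded (U j)" unfolding bounded_two_points using * by blast
    ultimately show ?thesis by simp
  qed
  have "f ` {0..1} \<subseteq> \<Union>(U ` {..<n})"
  proof
    fix y assume "y \<in> f ` {0..1}"
    then obtain t where t: "0 \<le> t" "t \<le> 1" "y = f t" by auto
    show "y \<in> \<Union>(U ` {..<n})"
    proof (cases "t = 1")
      case True
      have "t \<in> I (n - 1)" using n True by (auto simp: I_def of_nat_diff field_simps)
      then show ?thesis using t n by (auto simp: U_def intro!: bexI[of _ "n-1"])
    next
      case False
      define j where "j = nat \<lfloor>t * n\<rfloor>"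
      have j: "real j \<le> t * n" "t * n < real j + 1" using t n by (auto simp: j_def)
      have "real j < real n" using j(1) t False n by (smt (verit) mult_less_cancel_right2 of_nat_0_less_iff)
      then show ?thesis using t j n by (auto simp: U_def I_def field_simps intro!: bexI[of _ j] image_eqI[of _ _ t])
    qed
  qed
  moreover have "(\<Sum>V\<in>U ` {..<n}. hausdorff_weight 1 V) \<le> ennreal L"
  proof -
    have "(\<Sum>V\<in>U ` {..<n}. hausdorff_weight 1 V) \<le> (\<Sum>j<n. hausdorff_weight 1 (U j))"
      using sum_image_le[of "{..<n}" "hausdorff_weight 1" U] by (simp add: o_def)
    also have "\<dots> \<le> (\<Sum>j<n. ennreal (L / n))"
      using Ubd by (intro sum_mono) (auto simp: hausdorff_weight_1[unfolded One_nat_def] intro: ennreal_leI)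
    also have "\<dots> = ennreal L" using n L by (simp add: ennreal_of_nat_eq_real_of_nat flip: ennreal_mult)
    finally show ?thesis .
  qed
  ultimately show "\<exists>\<C>. finite \<C> \<and> f ` {0..1} \<subseteq> \<Union>\<C> \<and> (\<forall>V\<in>\<C>. bounded V \<and> diameter V \<le> \<delta>) \<and>
      (\<Sum>V\<in>\<C>. hausdorff_weight 1 V) \<le> ennreal L"
    using Ubd n by (intro exI[of _ "U ` {..<n}"]) force
qed

lemma translation_invariant_unique:
  fixes \<mu> \<nu> :: "'a::euclidean_space measure"
  assumes fin: "sigma_finite_measure \<mu>" "sigma_finite_measure \<nu>"
    and [measurable_cong]: "sets \<mu> = sets borel" "sets \<nu> = sets borel"
    and conc: "AE x in \<mu>. x \<in> H" "AE x in \<nu>. x \<in> H" and H: "\<And>x. x \<in> H \<Longrightarrow> - x \<in> H"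
    and inv: "\<And>h. h \<in> H \<Longrightarrow> distr \<mu> borel ((+) h) = \<mu>" "\<And>h. h \<in> H \<Longrightarrow> distr \<nu> borel ((+) h) = \<nu>"
    and [measurable]: "A \<in> sets borel" "Q \<in> sets borel"
  shows "emeasure \<mu> A * emeasure \<nu> Q = emeasure \<nu> A * emeasure \<mu> (uminus -` Q)"
proof -
  interpret \<mu>: sigma_finite_measure \<mu> by fact
  interpret \<nu>: sigma_finite_measure \<nu> by fact
  interpret P: pair_sigma_finite \<mu> \<nu> ..
  have sh: "(\<integral>\<^sup>+x. f (h + x) \<partial>\<mu>) = (\<integral>\<^sup>+x. f x \<partial>\<mu>)" "(\<integral>\<^sup>+x. f (h + x) \<partial>\<nu>) = (\<integral>\<^sup>+x. f x \<partial>\<nu>)"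
    if "h \<in> H" and [measurable]: "f \<in> borel_measurable borel" for h and f :: "'a \<Rightarrow> ennreal"
    using nn_integral_distr[of "(+) h" \<mu> borel f] nn_integral_distr[of "(+) h" \<nu> borel f] inv[OF that(1)] by simp_all
  let ?i = "\<lambda>S x. indicator S x :: ennreal"
  have "emeasure \<mu> A * emeasure \<nu> Q = (\<integral>\<^sup>+x. ?i A x * emeasure \<nu> Q \<partial>\<mu>)"
    by (simp add: nn_integral_multc)
  also have "\<dots> = (\<integral>\<^sup>+x. (\<integral>\<^sup>+y. ?i A x * ?i Q (y - x) \<partial>\<nu>) \<partial>\<mu>)"
  proof (rule nn_integral_cong_AE, use conc(1) in eventually_elim)
    fix x assume "x \<in> H"
    then have "(\<integral>\<^sup>+y. ?i Q (-x + y) \<partial>\<nu>) = emeasure \<nu> Q"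
      by (subst sh(2)) (auto intro: H)
    then show "?i A x * emeasure \<nu> Q = (\<integral>\<^sup>+y. ?i A x * ?i Q (y - x) \<partial>\<nu>)"
      by (simp add: nn_integral_cmult)
  qed
  also have "\<dots> = (\<integral>\<^sup>+y. (\<integral>\<^sup>+x. ?i A x * ?i Q (y - x) \<partial>\<mu>) \<partial>\<nu>)"
    using P.Fubini[of "\<lambda>(x,y). ?i A x * ?i Q (y - x)"] by simp
  also have "\<dots> = (\<integral>\<^sup>+y. (\<integral>\<^sup>+x. ?i A (y + x) * ?i Q (- x) \<partial>\<mu>) \<partial>\<nu>)"
  proof (rule nn_integral_cong_AE, use conc(2) in eventually_elim)
    fix y assume "y \<in> H"
    then show "(\<integral>\<^sup>+x. ?i A x * ?i Q (y - x) \<partial>\<mu>) = (\<integral>\<^sup>+x. ?i A (y + x) * ?i Q (- x) \<partial>\<mu>)"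
      using sh(1)[of y "\<lambda>x. ?i A x * ?i Q (y - x)"] by simp
  qed
  also have "\<dots> = (\<integral>\<^sup>+x. (\<integral>\<^sup>+y. ?i A (y + x) * ?i Q (- x) \<partial>\<nu>) \<partial>\<mu>)"
    using P.Fubini[of "\<lambda>(x,y). ?i A (y + x) * ?i Q (- x)"] by simp
  also have "\<dots> = (\<integral>\<^sup>+x. emeasure \<nu> A * ?i (uminus -` Q) x \<partial>\<mu>)"
  proof (rule nn_integral_cong_AE, use conc(1) in eventually_elim)
    fix x assume "x \<in> H"
    then have "(\<integral>\<^sup>+y. ?i A (x + y) \<partial>\<nu>) = emeasure \<nu> A"
      by (subst sh(2)) auto
    then show "(\<integral>\<^sup>+y. ?i A (y + x) * ?i Q (- x) \<partial>\<nu>) = emeasure \<nu> A * ?i (uminus -` Q) x"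
      by (simp add: nn_integral_multc add.commute indicator_def)
  qed
  also have "\<dots> = emeasure \<nu> A * emeasure \<mu> (uminus -` Q)"
    using measurable_sets[of uminus borel borel Q] by (subst nn_integral_cmult) auto
  finally show ?thesis .
qed

section \<open>Hausdorff measure on a coordinate hyperplane\<close>

definition proj :: "'n::finite \<Rightarrow> real^'n \<Rightarrow> real^'n" where
  "proj d x = (\<chi> i. if i = d then 0 else x $ i)"

lemma proj_component [simp]: "proj d x $ i = (if i = d then 0 else x $ i)"
  by (simp add: proj_def)

lemma proj_H_in [simp]: "proj d x \<in> H_in d"
  by (simp add: H_in_def)

lemma proj_id: "x \<in> H_in d \<Longrightarrow> proj d x = x"
  by (auto simp: H_in_def vec_eq_iff)

lemma proj_add: "proj d (x + y) = proj d x + proj d y"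
  by (auto simp: vec_eq_iff)

lemma proj_0 [simp]: "proj d 0 = 0"
  by (auto simp: vec_eq_iff)

lemma continuous_on_proj [continuous_intros]: "continuous_on S (proj d)"
proof -
  have "continuous_on S (\<lambda>x. if i = d then 0 else x $ i)" for i
    by (cases "i = d") (auto intro!: continuous_intros)
  then show ?thesis unfolding proj_def[abs_def] by (intro continuous_intros)
qed

lemma measurable_proj [measurable]: "proj d \<in> borel_measurable borel"
  by (intro borel_measurable_continuous_onI continuous_intros)

lemma measurable_vec_nth_borel [measurable]: "(\<lambda>x::real^'n. x $ i) \<in> borel_measurable borel"
  by (intro borel_measurable_continuous_onI continuous_intros)

lemma H_in_borel [measurable]: "H_in d \<in> sets borel"
  unfolding H_in_def by measurable

definition slab_measure :: "'n::finite \<Rightarrow> real \<Rightarrow> (real^'n) measure" where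
  "slab_measure d t = distr (density lborel (indicator {x. \<bar>x $ d\<bar> \<le> t})) borel (proj d)"

lemma sets_slab_measure [simp, measurable_cong]: "sets (slab_measure d t) = sets borel"
  by (simp add: slab_measure_def)

lemma nn_integral_slab_measure:
  assumes [measurable]: "f \<in> borel_measurable borel"
  shows "(\<integral>\<^sup>+x. f x \<partial>slab_measure d t) = (\<integral>\<^sup>+x. indicator {x. \<bar>x $ d\<bar> \<le> t} x * f (proj d x) \<partial>lborel)"
  unfolding slab_measure_def by (subst nn_integral_distr, simp, simp, subst nn_integral_density) simp_all

lemma emeasure_slab_measure:
  assumes [measurable]: "A \<in> sets borel"
  shows "emeasure (slab_measure d t) A = emeasure lborel {x. \<bar>x $ d\<bar> \<le> t \<and> proj d x \<in> A}"
proof -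
  have "emeasure (slab_measure d t) A = (\<integral>\<^sup>+x. indicator A x \<partial>slab_measure d t)" by simp
  also have "\<dots> = (\<integral>\<^sup>+x. indicator {x. \<bar>x $ d\<bar> \<le> t} x * indicator A (proj d x) \<partial>lborel)"
    by (rule nn_integral_slab_measure) simp
  also have "\<dots> = (\<integral>\<^sup>+x. indicator {x. \<bar>x $ d\<bar> \<le> t \<and> proj d x \<in> A} x \<partial>lborel)"
    by (intro nn_integral_cong) (simp add: indicator_def)
  finally show ?thesis by simp
qed

lemma slab_measure_translation:
  assumes h: "h \<in> H_in d"
  shows "distr (slab_measure d t) borel ((+) h) = slab_measure d t"
proof (rule measure_eqI)
  fix A assume "A \<in> sets (distr (slab_measure d t) borel ((+) h))"
  then have [measurable]: "A \<in> sets borel" by simp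
  have [measurable]: "(+) h -` A \<in> sets borel" using measurable_sets[of "(+) h" borel borel A] by simp
  have hd: "h $ d = 0" using h by (simp add: H_in_def)
  have "emeasure (distr (slab_measure d t) borel ((+) h)) A = emeasure (slab_measure d t) ((+) h -` A)"
    by (subst emeasure_distr) (auto simp: slab_measure_def)
  also have "\<dots> = emeasure lborel {x. \<bar>x $ d\<bar> \<le> t \<and> h + proj d x \<in> A}"
    by (subst emeasure_slab_measure) auto
  also have "\<dots> = emeasure lborel ((+) h -` {x. \<bar>x $ d\<bar> \<le> t \<and> proj d x \<in> A} \<inter> space lborel)"
    by (rule arg_cong[where f="emeasure lborel"]) (auto simp: hd proj_add proj_id[OF h])
  also have "\<dots> = emeasure (distr lborel borel ((+) h)) {x. \<bar>x $ d\<bar> \<le> t \<and> proj d x \<in> A}"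
    by (subst emeasure_distr) auto
  also have "\<dots> = emeasure (slab_measure d t) A" by (simp add: lborel_distr_plus emeasure_slab_measure)
  finally show "emeasure (distr (slab_measure d t) borel ((+) h)) A = emeasure (slab_measure d t) A" .
qed simp

lemma AE_slab_measure: "AE x in slab_measure d t. x \<in> H_in d"
proof -
  have "emeasure (slab_measure d t) (- H_in d) = 0" by (subst emeasure_slab_measure) auto
  then show ?thesis by (intro AE_I[where N="- H_in d"]) auto
qed

definition slab_cube :: "'n::finite \<Rightarrow> real \<Rightarrow> (real^'n) set" where
  "slab_cube d r = {x\<in>H_in d. \<forall>i. \<bar>x $ i\<bar> \<le> r}"

lemma slab_cube_borel [measurable]: "slab_cube d r \<in> sets borel"
  unfolding slab_cube_def by measurable

lemma emeasure_slab_box: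
  fixes u :: "real^'n::finite"
  assumes "t \<ge> 0" "D \<ge> 0"
  shows "emeasure (slab_measure d t) {x. \<forall>i. i \<noteq> d \<longrightarrow> \<bar>x $ i - u $ i\<bar> \<le> D} = ennreal (2 * t * (2 * D) ^ (CARD('n) - 1))"
proof -
  define a :: "real^'n" where "a = (\<chi> i. if i = d then - t else u $ i - D)"
  define b :: "real^'n" where "b = (\<chi> i. if i = d then t else u $ i + D)"
  have "emeasure (slab_measure d t) {x. \<forall>i. i \<noteq> d \<longrightarrow> \<bar>x $ i - u $ i\<bar> \<le> D} = emeasure lborel (cbox a b)"
    by (subst emeasure_slab_measure)
       (auto simp: mem_box_cart a_def b_def abs_le_iff intro!: arg_cong[where f="emeasure lborel"]
         split: if_splits, (smt (verit))+)
  also have "\<dots> = ennreal (\<Prod>i\<in>UNIV. b $ i - a $ i)"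
  proof -
    have "cbox a b \<noteq> {}" using assms by (auto simp: interval_ne_empty_cart a_def b_def)
    then have "measure lborel (cbox a b) = (\<Prod>i\<in>UNIV. b $ i - a $ i)" by (rule content_cbox_cart)
    then show ?thesis 
      using emeasure_eq_ennreal_measure[of lborel "cbox a b"] emeasure_lborel_cbox_finite[of a b] by auto
  qed
  also have "(\<Prod>i\<in>UNIV. b $ i - a $ i) = (b $ d - a $ d) * (\<Prod>i\<in>UNIV-{d}. b $ i - a $ i)"
    by (rule prod.remove) auto
  also have "(\<Prod>i\<in>UNIV-{d}. b $ i - a $ i) = (\<Prod>i\<in>UNIV-{d}. 2 * D)"
    by (rule prod.cong) (auto simp: a_def b_def)
  finally show ?thesis by (simp add: a_def b_def)
qed

lemma emeasure_slab_cube: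
  fixes d :: "'n::finite"
  assumes "t \<ge> 0" "r \<ge> 0"
  shows "emeasure (slab_measure d t) (slab_cube d r) = ennreal (2 * t * (2 * r) ^ (CARD('n) - 1))"
proof -
  have "emeasure (slab_measure d t) (slab_cube d r) =
      emeasure (slab_measure d t) {x. \<forall>i. i \<noteq> d \<longrightarrow> \<bar>x $ i - (0::real^'n) $ i\<bar> \<le> r}"
  proof (rule emeasure_eq_AE)
    show "AE x in slab_measure d t. x \<in> slab_cube d r \<longleftrightarrow> x \<in> {x. \<forall>i. i \<noteq> d \<longrightarrow> \<bar>x $ i - (0::real^'n) $ i\<bar> \<le> r}"
      using AE_slab_measure[of d t]
    proof eventually_elim
      case (elim x)
      then have "\<bar>x $ d\<bar> \<le> r" using assms by (simp add: H_in_def)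
      then show ?case using elim by (auto simp: slab_cube_def)
    qed
  qed auto
  then show ?thesis using emeasure_slab_box[of t r d 0] assms by simp
qed

lemma slab_cube_UN: "(\<Union>n. slab_cube d (real n)) = H_in d"
proof -
  have "\<exists>n. \<forall>i. \<bar>x $ i\<bar> \<le> real n" for x :: "real^'n::finite"
  proof -
    obtain n where "norm x \<le> real n" using real_arch_simple by blast
    then show ?thesis by (intro exI[of _ n]) (meson component_le_norm_cart order_trans)
  qed
  then show ?thesis by (auto simp: slab_cube_def)
qed

lemma sigma_finite_on_H_in:
  fixes \<mu> :: "(real^'n::finite) measure"
  assumes [simp]: "sets \<mu> = sets borel" and conc: "emeasure \<mu> (- H_in d) = 0"
    and fin: "\<And>r. emeasure \<mu> (slab_cube d r) < \<infinity>"
  shows "sigma_finite_measure \<mu>"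
proof
  have sp: "space \<mu> = UNIV" using sets_eq_imp_space_eq[OF assms(1)] by simp
  let ?A = "insert (- H_in d) (range (\<lambda>n. slab_cube d (real n)))"
  have "\<Union>?A = - H_in d \<union> H_in d" unfolding slab_cube_UN[symmetric] by simp
  moreover have "emeasure \<mu> (slab_cube d r) \<noteq> \<infinity>" for r using fin[of r] by simp
  ultimately have "countable ?A" "?A \<subseteq> sets \<mu>" "\<Union>?A = space \<mu>" "\<forall>a\<in>?A. emeasure \<mu> a \<noteq> \<infinity>"
    using conc by (simp_all add: sp image_subset_iff)
  then show "\<exists>A. countable A \<and> A \<subseteq> sets \<mu> \<and> \<Union> A = space \<mu> \<and> (\<forall>a\<in>A. emeasure \<mu> a \<noteq> \<infinity>)" by blast
qed

lemma hausdorff_slab_cube_finite: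
  fixes d :: "'n::finite"
  assumes "r > 0"
  shows "hausdorff_outer (CARD('n) - 1) (slab_cube d r) < \<infinity>"
proof -
  define m where "m = CARD('n) - 1"
  define n where "n = real CARD('n)"
  have npos: "n > 0" by (simp add: n_def)
  define B where "B = unit_ball_vol (real m) * (n * r) ^ m"
  have "hausdorff_outer m (slab_cube d r) \<le> ennreal B"
  proof (rule hausdorff_outer_finite_cover)
    fix \<delta> :: real assume \<delta>: "\<delta> > 0"
    obtain k :: nat where k0: "2 * n * r / \<delta> < real k" using reals_Archimedean2 by blast
    then have kpos: "0 < real k" using \<delta> npos \<open>r > 0\<close> by (meson divide_nonneg_pos le_less_trans less_imp_le mult_pos_pos zero_less_numeral)
    have k: "2 * n * r / real k \<le> \<delta>" using k0 kpos \<delta> by (simp add: field_simps)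
    define I where "I = (UNIV - {d}) \<rightarrow>\<^sub>E {..<k}"
    define U where "U f = {x\<in>H_in d. \<forall>i. i \<noteq> d \<longrightarrow> - r + 2 * r * real (f i) / k \<le> x $ i \<and> x $ i \<le> - r + 2 * r * (real (f i) + 1) / k}"
      for f :: "'n \<Rightarrow> nat"
    have finI: "finite I" and cardI: "card I = k ^ m"
      by (auto simp: I_def m_def finite_PiE card_PiE)
    have cover: "slab_cube d r \<subseteq> \<Union>(U ` I)"
    proof
      fix x assume x: "x \<in> slab_cube d r"
      define s where "s i = (x $ i + r) / (2 * r) * k" for i
      define f where "f = restrict (\<lambda>i. min (k - 1) (nat \<lfloor>s i\<rfloor>)) (UNIV - {d})"
      have fk: "f i < k" "real (f i) \<le> s i" "s i \<le> real (f i) + 1" if "i \<noteq> d" for i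
      proof -
        have xi: "- r \<le> x $ i" "x $ i \<le> r" using x by (auto simp: slab_cube_def abs_le_iff minus_le_iff)
        have "0 \<le> (x $ i + r) / (2 * r)" "(x $ i + r) / (2 * r) \<le> 1" using xi \<open>r > 0\<close> by auto
        then have s: "0 \<le> s i" "s i \<le> k" using kpos by (auto simp: s_def simp del: times_divide_eq_left intro: mult_left_le_one_le)
        have fi: "f i = min (k - 1) (nat \<lfloor>s i\<rfloor>)" using that by (simp add: f_def)
        show "f i < k" using kpos by (auto simp: fi)
        show "real (f i) \<le> s i" using s by (auto simp: fi min_def le_nat_iff) linarith
        show "s i \<le> real (f i) + 1" using s kpos by (auto simp: fi min_def of_nat_diff)
      qed
      have "f \<in> I" using fk by (auto simp: I_def f_def)
      moreover have "x \<in> U f"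
      proof -
        have eq: "x $ i = - r + 2 * r * s i / k" for i using \<open>r > 0\<close> kpos by (simp add: s_def)
        have "2 * r * real (f i) / k \<le> 2 * r * s i / k \<and> 2 * r * s i / k \<le> 2 * r * (real (f i) + 1) / k" if "i \<noteq> d" for i
          using fk[OF that] \<open>r > 0\<close> kpos by (auto intro!: divide_right_mono mult_left_mono)
        then show ?thesis using x by (auto simp: U_def slab_cube_def eq)
      qed
      ultimately show "x \<in> \<Union>(U ` I)" by blast
    qed
    have Ud: "norm (x - y) \<le> 2 * n * r / k" if "x \<in> U f" "y \<in> U f" for f x y
    proof -
      have "norm (x - y) \<le> (\<Sum>i\<in>UNIV. \<bar>(x - y) $ i\<bar>)" by (rule norm_le_l1_cart)
      also have "\<dots> \<le> (\<Sum>i\<in>(UNIV::'n set). 2 * r / k)"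
      proof (rule sum_mono)
        fix i
        show "\<bar>(x - y) $ i\<bar> \<le> 2 * r / k"
        proof (cases "i = d")
          case False
          have "2 * r * (real (f i) + 1) / k = 2 * r * real (f i) / k + 2 * r / k" by (simp add: distrib_left add_divide_distrib)
          then show ?thesis using that False by (auto simp: U_def abs_le_iff) (smt (verit))+
        qed (use that \<open>r > 0\<close> kpos in \<open>auto simp: U_def H_in_def\<close>)
      qed
      also have "\<dots> = 2 * n * r / k" by (simp add: n_def)
      finally show ?thesis .
    qed
    have diam: "diameter (U f) \<le> 2 * n * r / k" for f
      using Ud npos \<open>r > 0\<close> kpos by (intro diameter_le) auto
    have bdd: "bounded (U f)" for f
      unfolding bounded_two_points using Ud[of _ f] by (auto simp: dist_norm)
    have w: "hausdorff_weight m (U f) \<le> ennreal (unit_ball_vol (real m) * (n * r / k) ^ m)" for f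
    proof -
      have "diameter (U f) / 2 \<le> n * r / k" using diam[of f] by (simp add: mult_ac)
      then show ?thesis using diameter_ge_0[OF bdd, of f]
        by (auto simp: hausdorff_weight_def intro!: ennreal_leI mult_left_mono power_mono)
    qed
    have "(\<Sum>V\<in>U ` I. hausdorff_weight m V) \<le> (\<Sum>f\<in>I. hausdorff_weight m (U f))"
      using sum_image_le[OF finI, of "hausdorff_weight m" U] by (simp add: o_def)
    also have "\<dots> \<le> (\<Sum>f\<in>I. ennreal (unit_ball_vol (real m) * (n * r / k) ^ m))" by (intro sum_mono w)
    also have "\<dots> = ennreal (real k ^ m * (unit_ball_vol (real m) * (n * r / k) ^ m))"
      using npos \<open>r > 0\<close> kpos
      by (simp add: cardI ennreal_of_nat_eq_real_of_nat ennreal_power flip: ennreal_mult)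
    also have "real k ^ m * (unit_ball_vol (real m) * (n * r / k) ^ m) = B"
      using kpos by (simp add: B_def power_divide)
    finally have "(\<Sum>V\<in>U ` I. hausdorff_weight m V) \<le> ennreal B" .
    then show "\<exists>\<C>. finite \<C> \<and> slab_cube d r \<subseteq> \<Union>\<C> \<and> (\<forall>V\<in>\<C>. bounded V \<and> diameter V \<le> \<delta>) \<and>
        (\<Sum>V\<in>\<C>. hausdorff_weight m V) \<le> ennreal B"
      using finI cover bdd order_trans[OF diam k] by (intro exI[of _ "U ` I"]) auto
  qed
  then show ?thesis unfolding m_def[symmetric] by (rule le_less_trans) simp
qed

lemma hausdorff_slab_cube_pos:
  fixes d :: "'n::finite"
  assumes "r > 0"
  shows "hausdorff_outer (CARD('n) - 1) (slab_cube d r) > 0"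
proof -
  define m where "m = CARD('n) - 1"
  define C where "C = 2 * 4 ^ m / unit_ball_vol (real m)"
  have Cpos: "C > 0" by (simp add: C_def)
  have "ennreal (2 * (2 * r) ^ m / C) \<le> hausdorff_pre m 1 (slab_cube d r)"
    unfolding hausdorff_pre_def
  proof (rule INF_greatest)
    fix U :: "nat \<Rightarrow> (real^'n) set"
    assume "U \<in> {U. slab_cube d r \<subseteq> (\<Union>i. U i) \<and> (\<forall>i. bounded (U i) \<and> diameter (U i) \<le> 1)}"
    then have U: "slab_cube d r \<subseteq> (\<Union>i. U i)" "\<And>i. bounded (U i)" by auto
    define u where "u i = (SOME x. x \<in> U i)" for i
    define V where "V i = (if U i = {} then {} else {x. \<forall>l. l \<noteq> d \<longrightarrow> \<bar>x $ l - u i $ l\<bar> \<le> diameter (U i)})" for i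
    have [measurable]: "V i \<in> sets borel" for i
    proof (cases "U i = {}")
      case False
      have "{x. \<forall>l. l \<noteq> d \<longrightarrow> \<bar>x $ l - u i $ l\<bar> \<le> diameter (U i)} \<in> sets borel" by measurable
      then show ?thesis using False by (simp add: V_def)
    qed (simp add: V_def)
    have UV: "U i \<subseteq> V i" for i
    proof
      fix x assume x: "x \<in> U i"
      then have "u i \<in> U i" unfolding u_def by (rule someI)
      then have "norm (x - u i) \<le> diameter (U i)"
        using diameter_bounded_bound[OF U(2) x] by (simp add: dist_norm)
      then have "\<bar>x $ l - u i $ l\<bar> \<le> diameter (U i)" for l
        using component_le_norm_cart[of "x - u i" l] by simp
      then show "x \<in> V i" using x by (auto simp: V_def)
    qed
    have V: "emeasure (slab_measure d 1) (V i) = ennreal C * hausdorff_weight m (U i)" for i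
    proof (cases "U i = {}")
      case False
      define D where "D = diameter (U i)"
      have D: "D \<ge> 0" using diameter_ge_0[OF U(2)] by (simp add: D_def)
      have "(2 * D) ^ m = (4 * (D / 2)) ^ m" by simp
      then have "(2 * D) ^ m = 4 ^ m * (D / 2) ^ m" unfolding power_mult_distrib .
      moreover have "unit_ball_vol (real m) \<noteq> 0" using unit_ball_vol_pos[of "real m"] by linarith
      ultimately have eq: "2 * (2 * D) ^ m = C * (unit_ball_vol (real m) * (D / 2) ^ m)"
        by (simp add: C_def)
      have "emeasure (slab_measure d 1) (V i) = ennreal (2 * (2 * D) ^ m)"
        using emeasure_slab_box[of 1 D d "u i"] D False by (simp add: V_def m_def flip: D_def)
      also have "\<dots> = ennreal C * ennreal (unit_ball_vol (real m) * (D / 2) ^ m)"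
        unfolding eq using Cpos by (rule ennreal_mult'[OF less_imp_le])
      finally show ?thesis using False by (simp add: hausdorff_weight_def D_def)
    qed (simp add: V_def)
    have "ennreal (2 * (2 * r) ^ m) = emeasure (slab_measure d 1) (slab_cube d r)"
      using emeasure_slab_cube[of 1 r d] assms by (simp add: m_def)
    also have "\<dots> \<le> emeasure (slab_measure d 1) (\<Union>i. V i)"
    proof (rule emeasure_mono)
      show "slab_cube d r \<subseteq> (\<Union>i. V i)" using U(1) UV by (meson SUP_mono subset_trans UNIV_I)
    qed auto
    also have "\<dots> \<le> (\<Sum>i. emeasure (slab_measure d 1) (V i))"
      by (intro emeasure_subadditive_countably) auto
    also have "\<dots> = ennreal C * (\<Sum>i. hausdorff_weight m (U i))" by (simp add: V)
    finally have "ennreal (1 / C) * ennreal (2 * (2 * r) ^ m) \<le> ennreal (1 / C) * (ennreal C * (\<Sum>i. hausdorff_weight m (U i)))"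
      by (rule mult_left_mono) simp
    then show "ennreal (2 * (2 * r) ^ m / C) \<le> (\<Sum>i. hausdorff_weight m (U i))"
      using Cpos assms by (simp flip: ennreal_mult mult.assoc)
  qed
  also have "\<dots> \<le> hausdorff_outer m (slab_cube d r)"
    by (intro hausdorff_pre_le_outer) auto
  finally have "ennreal (2 * (2 * r) ^ m / C) \<le> hausdorff_outer m (slab_cube d r)" .
  moreover have "0 < ennreal (2 * (2 * r) ^ m / C)" using assms Cpos by simp
  ultimately show ?thesis unfolding m_def by (rule less_le_trans[rotated])
qed

lemma hausdorff_measure_H_in_eq_slab:
  fixes d :: "'n::finite"
  assumes t: "t > 0"
  obtains c :: real where "c > 0"
    "density (hausdorff_measure (CARD('n) - 1)) (indicator (H_in d)) = scale_measure (ennreal c) (slab_measure d t)"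
proof -
  define m where "m = CARD('n) - 1"
  define \<mu> where "\<mu> = density (hausdorff_measure m) (indicator (H_in d))"
  have s[simp, measurable_cong]: "sets \<mu> = sets borel" by (simp add: \<mu>_def)
  have e\<mu>: "emeasure \<mu> A = hausdorff_outer m (H_in d \<inter> A)" if "A \<in> sets borel" for A
  proof -
    have [measurable]: "A \<in> sets borel" by fact
    have "emeasure \<mu> A = (\<integral>\<^sup>+x. indicator (H_in d) x * indicator A x \<partial>hausdorff_measure m)"
      unfolding \<mu>_def by (rule emeasure_density) simp_all
    also have "\<dots> = emeasure (hausdorff_measure m) (H_in d \<inter> A)"
      by (simp flip: indicator_inter_arith)
    finally show ?thesis by (simp add: emeasure_hausdorff_measure)
  qed
  have e\<mu>': "emeasure \<mu> (slab_cube d r) = hausdorff_outer m (slab_cube d r)" for r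
    by (subst e\<mu>) (auto simp: slab_cube_def intro!: arg_cong[where f="hausdorff_outer m"])
  have c\<mu>: "emeasure \<mu> (- H_in d) = 0" by (subst e\<mu>) auto
  have fin\<mu>: "emeasure \<mu> (slab_cube d r) < \<infinity>" for r
  proof -
    have "slab_cube d r \<subseteq> slab_cube d (max r 1)" by (auto simp: slab_cube_def le_max_iff_disj)
    then show ?thesis using hausdorff_slab_cube_finite[of "max r 1" d] hausdorff_outer_mono[of "slab_cube d r" "slab_cube d (max r 1)" m]
      unfolding e\<mu>' m_def by (auto intro: le_less_trans)
  qed
  have fin\<nu>: "emeasure (slab_measure d t) (slab_cube d r) < \<infinity>" for r
  proof -
    have "slab_cube d r \<subseteq> slab_cube d (max r 1)" by (auto simp: slab_cube_def le_max_iff_disj)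
    then have "emeasure (slab_measure d t) (slab_cube d r) \<le> emeasure (slab_measure d t) (slab_cube d (max r 1))"
      by (intro emeasure_mono) auto
    also have "\<dots> < \<infinity>" using t by (subst emeasure_slab_cube) auto
    finally show ?thesis .
  qed
  have inv\<mu>: "distr \<mu> borel ((+) h) = \<mu>" if h: "h \<in> H_in d" for h
  proof (rule measure_eqI)
    fix A assume "A \<in> sets (distr \<mu> borel ((+) h))"
    then have [measurable]: "A \<in> sets borel" by simp
    have [measurable]: "(+) h -` A \<in> sets borel" using measurable_sets[of "(+) h" borel borel A] by simp
    have "H_in d \<inter> A = (+) h ` (H_in d \<inter> ((+) h -` A))"
    proof (intro set_eqI iffI)
      fix x assume x: "x \<in> H_in d \<inter> A"
      then have "x - h \<in> H_in d \<inter> ((+) h -` A)" using h by (simp add: H_in_def)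
      then show "x \<in> (+) h ` (H_in d \<inter> ((+) h -` A))" by (intro image_eqI[of _ _ "x - h"]) auto
    qed (use h in \<open>auto simp: H_in_def\<close>)
    then have "hausdorff_outer m (H_in d \<inter> A) = hausdorff_outer m (H_in d \<inter> ((+) h -` A))"
      by (simp only: hausdorff_outer_translation)
    then show "emeasure (distr \<mu> borel ((+) h)) A = emeasure \<mu> A"
      using sets_eq_imp_space_eq[OF s] by (subst emeasure_distr) (auto simp: e\<mu>)
  qed simp
  have AE\<mu>: "AE x in \<mu>. x \<in> H_in d" using c\<mu> by (intro AE_I[where N="- H_in d"]) auto
  have c\<nu>: "emeasure (slab_measure d t) (- H_in d) = 0" by (subst emeasure_slab_measure) auto
  have sf: "sigma_finite_measure \<mu>" "sigma_finite_measure (slab_measure d t)"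
    by (rule sigma_finite_on_H_in; fact s sets_slab_measure c\<mu> c\<nu> fin\<mu> fin\<nu>)+
  define q where "q = enn2real (hausdorff_outer m (slab_cube d 1))"
  have q: "hausdorff_outer m (slab_cube d 1) = ennreal q" "q > 0"
    using hausdorff_slab_cube_pos[of 1 d] hausdorff_slab_cube_finite[of 1 d]
    by (auto simp: q_def m_def less_top enn2real_positive_iff)
  define p where "p = 2 * t * (2 * 1) ^ m"
  have p: "p > 0" using t by (simp add: p_def)
  have neg: "uminus -` slab_cube d 1 = slab_cube d 1" by (auto simp: slab_cube_def H_in_def)
  have "\<mu> = scale_measure (ennreal (q / p)) (slab_measure d t)"
  proof (rule measure_eqI)
    fix A assume "A \<in> sets \<mu>"
    then have [measurable]: "A \<in> sets borel" by simp
    have "emeasure \<mu> A * emeasure (slab_measure d t) (slab_cube d 1) =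
        emeasure (slab_measure d t) A * emeasure \<mu> (uminus -` slab_cube d 1)"
      by (rule translation_invariant_unique[where H="H_in d"])
         (use sf AE\<mu> AE_slab_measure inv\<mu> slab_measure_translation in \<open>auto simp: H_in_def\<close>)
    then have *: "emeasure \<mu> A * ennreal p = emeasure (slab_measure d t) A * ennreal q"
      using emeasure_slab_cube[of t 1 d] t by (simp add: neg e\<mu>' q(1) p_def flip: m_def One_nat_def)
    have "emeasure \<mu> A = emeasure \<mu> A * ennreal p * ennreal (1 / p)"
      using p by (simp add: mult.assoc flip: ennreal_mult)
    also have "\<dots> = ennreal q * ennreal (1 / p) * emeasure (slab_measure d t) A"
      unfolding * by (simp add: mult_ac)
    also have "ennreal q * ennreal (1 / p) = ennreal (q / p)" using p q(2) by (simp flip: ennreal_mult)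
    finally show "emeasure \<mu> A = emeasure (scale_measure (ennreal (q / p)) (slab_measure d t)) A" by simp
  qed simp
  then show ?thesis using that[of "q / p"] p q by (simp add: \<mu>_def m_def)
qed

section \<open>Geodesic length and polygons\<close>

fun polygon_in :: "'a::real_vector set \<Rightarrow> 'a \<Rightarrow> 'a list \<Rightarrow> bool" where
  "polygon_in S x [] \<longleftrightarrow> True"
| "polygon_in S x (p # ps) \<longleftrightarrow> closed_segment x p \<subseteq> S \<and> polygon_in S p ps"

fun polygon_length :: "'a::metric_space \<Rightarrow> 'a list \<Rightarrow> real" where
  "polygon_length x [] = 0"
| "polygon_length x (p # ps) = dist x p + polygon_length p ps"

lemma polygon_length_nonneg: "polygon_length x ps \<ge> 0"
  by (induction ps arbitrary: x) auto

lemma lipschitz_on_joinpaths: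
  fixes f g :: "real \<Rightarrow> 'a::real_normed_vector"
  assumes f: "L-lipschitz_on {0..1} f" and g: "M-lipschitz_on {0..1} g" and fg: "f 1 = g 0"
  shows "(max (2 * L) (2 * M))-lipschitz_on {0..1} (f +++ g)"
proof -
  have 1: "(2 * L)-lipschitz_on {0..1/2} (\<lambda>t. f (2 * t))"
  proof (rule lipschitz_onI)
    fix s t :: real assume "s \<in> {0..1/2}" "t \<in> {0..1/2}"
    then have "dist (f (2 * s)) (f (2 * t)) \<le> L * dist (2 * s) (2 * t)" by (intro lipschitz_onD[OF f]) auto
    also have "dist (2 * s) (2 * t) = 2 * dist s t" by (auto simp: dist_real_def abs_if)
    finally show "dist (f (2 * s)) (f (2 * t)) \<le> 2 * L * dist s t" by simp
  qed (use lipschitz_on_nonneg[OF f] in auto)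
  have 2: "(2 * M)-lipschitz_on {1/2..1} (\<lambda>t. g (2 * t - 1))"
  proof (rule lipschitz_onI)
    fix s t :: real assume "s \<in> {1/2..1}" "t \<in> {1/2..1}"
    then have "dist (g (2 * s - 1)) (g (2 * t - 1)) \<le> M * dist (2 * s - 1) (2 * t - 1)" by (intro lipschitz_onD[OF g]) auto
    also have "dist (2 * s - 1) (2 * t - 1) = 2 * dist s t" by (auto simp: dist_real_def abs_if)
    finally show "dist (g (2 * s - 1)) (g (2 * t - 1)) \<le> 2 * M * dist s t" by simp
  qed (use lipschitz_on_nonneg[OF g] in auto)
  show ?thesis unfolding joinpaths_def
    by (rule lipschitz_on_concat_max[OF 1 2]) (simp add: fg)
qed

lemma lipschitz_on_linepath: "(dist x p)-lipschitz_on {0..1} (linepath x p)"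
proof (rule lipschitz_onI)
  fix s t :: real
  have "linepath x p s - linepath x p t = (s - t) *\<^sub>R (p - x)" by (simp add: linepath_def algebra_simps)
  then show "dist (linepath x p s) (linepath x p t) \<le> dist x p * dist s t"
    by (simp add: dist_norm norm_minus_commute mult.commute)
qed auto

lemma polygon_lipschitz_path:
  fixes x :: "'a::real_normed_vector"
  assumes "polygon_in S x ps" "ps \<noteq> []"
  shows "\<exists>(f :: real \<Rightarrow> 'a) L. L-lipschitz_on {0..1} f \<and> f ` {0..1} \<subseteq> S \<and> f 0 = x \<and> f 1 = last ps \<and>
           hausdorff_outer 1 (f ` {0..1}) \<le> ennreal (polygon_length x ps)"
  using assms
proof (induction ps arbitrary: x)
  case (Cons p ps)
  have l: "(dist x p)-lipschitz_on {0..1} (linepath x p)" by (rule lipschitz_on_linepath)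
  have seg: "linepath x p ` {0..1} = closed_segment x p"
    using path_image_linepath[of x p] by (simp add: path_image_def)
  have h: "hausdorff_outer 1 (closed_segment x p) \<le> ennreal (dist x p)"
    using hausdorff_outer_lipschitz_image[OF l] by (simp only: seg)
  show ?case
  proof (cases "ps = []")
    case True
    then have *: "linepath x p ` {0..1} \<subseteq> S" "linepath x p 0 = x" "linepath x p 1 = last (p # ps)"
        "hausdorff_outer 1 (linepath x p ` {0..1}) \<le> ennreal (polygon_length x (p # ps))"
      using h seg Cons.prems by (simp_all add: linepath_0' linepath_1')
    show ?thesis by (intro exI conjI) (rule l *)+
  next
    case False
    have "polygon_in S p ps" using Cons.prems by simp
    from Cons.IH[OF this False]
    obtain f :: "real \<Rightarrow> 'a" and L where f: "L-lipschitz_on {0..1} f" "f ` {0..1} \<subseteq> S" "f 0 = p" "f 1 = last ps"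
        "hausdorff_outer 1 (f ` {0..1}) \<le> ennreal (polygon_length p ps)"
      by (elim exE conjE)
    have im: "(linepath x p +++ f) ` {0..1} = closed_segment x p \<union> f ` {0..1}"
      using path_image_join[of "linepath x p" f] seg f(3) by (simp add: path_image_def pathstart_def)
    have "hausdorff_outer 1 ((linepath x p +++ f) ` {0..1}) \<le> ennreal (dist x p) + ennreal (polygon_length p ps)"
      unfolding im by (rule order_trans[OF hausdorff_outer_Un add_mono[OF h f(5)]])
    then have 1: "hausdorff_outer 1 ((linepath x p +++ f) ` {0..1}) \<le> ennreal (polygon_length x (p # ps))"
      by (simp add: polygon_length_nonneg)
    have 2: "(max (2 * dist x p) (2 * L))-lipschitz_on {0..1} (linepath x p +++ f)"
      by (rule lipschitz_on_joinpaths[OF l f(1)]) (simp add: f(3) linepath_1')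
    have 3: "(linepath x p +++ f) ` {0..1} \<subseteq> S" using im f Cons.prems by simp
    have 4: "(linepath x p +++ f) 0 = x" "(linepath x p +++ f) 1 = last (p # ps)"
      using False f by (simp_all add: joinpaths_def linepath_0')
    show ?thesis by (intro exI conjI) (rule 2 3 4 1)+
  qed
qed simp

lemma rtrancl_path_polygon:
  assumes "rtrancl_path r i is j" and "i \<in> I" and "x \<in> V i" and y: "y \<in> V j" "y \<in> closure E"
    and r: "\<And>i k. r i k \<Longrightarrow> k \<in> I \<and> (\<exists>z. z \<in> V i \<inter> V k \<inter> closure D)"
    and V: "\<And>i. open (V i)" "\<And>i a b. i \<in> I \<Longrightarrow> a \<in> V i \<Longrightarrow> b \<in> V i \<Longrightarrow> dist a b \<le> w i"
    and seg: "\<And>i a b. i \<in> I \<Longrightarrow> a \<in> V i \<inter> W \<Longrightarrow> b \<in> V i \<inter> W \<Longrightarrow> closed_segment a b \<subseteq> S"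
    and "D \<subseteq> W" "E \<subseteq> W" and "x \<in> W"
  shows "\<exists>qs q. set qs \<subseteq> D \<and> q \<in> E \<and> polygon_in S x (qs @ [q]) \<and>
           polygon_length x (qs @ [q]) \<le> sum_list (map w (i # is))"
  using assms(1,2,3,4) \<open>x \<in> W\<close>
proof (induction arbitrary: x)
  case (base i)
  obtain q where "q \<in> E" "q \<in> V i"
    using base.prems(3) V(1)[of i] y(2) by (metis closure_iff_nhds_not_empty disjoint_iff subset_refl)
  then show ?case using base.prems seg[of i x q] V(2)[of i x q] \<open>E \<subseteq> W\<close>
    by (intro exI[of _ "[]"] exI[of _ q]) auto
next
  case (step i k ks j)
  obtain z where z: "k \<in> I" "z \<in> V i \<inter> V k" "z \<in> closure D" using r[OF step.hyps(1)] by auto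
  have "open (V i \<inter> V k)" using V(1) by blast
  then obtain p where p: "p \<in> D" "p \<in> V i" "p \<in> V k"
    using z(2,3) by (metis IntE closure_iff_nhds_not_empty disjoint_iff subset_refl)
  then obtain qs q where q: "set qs \<subseteq> D" "q \<in> E" "polygon_in S p (qs @ [q])"
      "polygon_length p (qs @ [q]) \<le> sum_list (map w (k # ks))"
    using step.IH[of p] z(1) step.prems(3) \<open>D \<subseteq> W\<close> by blast
  have "closed_segment x p \<subseteq> S" "dist x p \<le> w i"
    using seg[of i x p] V(2)[of i x p] step.prems p \<open>D \<subseteq> W\<close> by auto
  then show ?case using q p by (intro exI[of _ "p # qs"] exI[of _ q]) auto
qed

text \<open>A compact connected set of small \<open>\<H>\<^sub>1\<close>-measure is covered by finitely many small sets of small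
  total diameter.  By connectedness any two of its points are joined by a chain of pairwise different
  covering sets; a polygon with one vertex in each link has length at most the total diameter.\<close>

lemma lipschitz_path_polygon:
  fixes f :: "real \<Rightarrow> 'a::euclidean_space"
  assumes f: "L-lipschitz_on {0..1} f" and fS: "f ` {0..1} \<subseteq> W \<inter> O'" and W: "convex W" and O': "open O'"
    and D: "D \<subseteq> W" "W \<subseteq> closure D" and E: "E \<subseteq> W" "f 1 \<in> closure E"
    and less: "hausdorff_outer 1 (f ` {0..1}) < t"
  shows "\<exists>qs q. set qs \<subseteq> D \<and> q \<in> E \<and> polygon_in (W \<inter> O') (f 0) (qs @ [q]) \<and>
           ennreal (polygon_length (f 0) (qs @ [q])) < t"
proof -
  let ?K = "f ` {0..1}"
  have cont: "continuous_on {0..1} f" using f by (rule lipschitz_on_continuous_on)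
  have K: "compact ?K" "connected ?K"
    using cont by (auto intro: compact_continuous_image connected_continuous_image)
  have x: "f 0 \<in> ?K" and y: "f 1 \<in> ?K" by auto
  obtain \<rho> where \<rho>: "\<rho> > 0" "(\<Union>z\<in>?K. ball z \<rho>) \<subseteq> O'"
    using compact_subset_open_imp_ball_epsilon_subset[OF K(1) O'] fS by blast
  have "hausdorff_pre 1 (\<rho> / 4) ?K < t"
    using hausdorff_pre_le_outer[of "\<rho>/4" 1 ?K] less \<rho> by (auto intro: le_less_trans)
  then obtain U where U: "?K \<subseteq> (\<Union>i. U i)" "\<And>i. bounded (U i)" "\<And>i. diameter (U i) \<le> \<rho> / 4"
      "(\<Sum>i. hausdorff_weight 1 (U i)) < t"
    unfolding hausdorff_pre_less_iff by auto
  define \<sigma> where "\<sigma> = (\<Sum>i. hausdorff_weight 1 (U i))"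
  have \<sigma>: "\<sigma> = (\<Sum>i. ennreal (diameter (U i)))"
    unfolding \<sigma>_def by (simp only: hausdorff_weight_1[OF U(2)])
  obtain e where e: "e > 0" "e \<le> \<rho> / 4" "\<sigma> + ennreal e < t"
  proof -
    obtain s where s: "\<sigma> < s" "s < t" using U(4) dense unfolding \<sigma>_def by blast
    then have "\<sigma> < \<top>" "s \<noteq> \<top>" by (auto simp: less_top[symmetric] dest: order.strict_trans less_le_trans[OF _ top_greatest])
    then obtain a b where ab: "\<sigma> = ennreal a" "a \<ge> 0" "s = ennreal b" "b \<ge> 0"
      by (metis ennreal_cases less_top)
    then have "a < b" using s(1) by (simp add: ennreal_less_iff)
    define e where "e = min (b - a) (\<rho> / 4)"
    have "e > 0" using \<open>a < b\<close> \<rho> by (simp add: e_def)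
    have "\<sigma> + ennreal e = ennreal (a + e)" using ab \<open>e > 0\<close> by simp
    also have "\<dots> \<le> ennreal b" by (rule ennreal_leI) (simp add: e_def)
    finally have "\<sigma> + ennreal e < t" using s(2) ab by simp
    moreover have "e \<le> \<rho> / 4" unfolding e_def by (rule min.cobounded2)
    ultimately show ?thesis using that[of e] \<open>e > 0\<close> by blast
  qed
  define \<eta> where "\<eta> i = e * (1/2) ^ Suc i / 2" for i :: nat
  have \<eta>: "\<eta> i > 0" "2 * \<eta> i \<le> \<rho> / 4" for i
  proof -
    show "\<eta> i > 0" using e by (simp add: \<eta>_def)
    have "e * (1/2) ^ Suc i \<le> e * 1" using e by (intro mult_left_mono power_le_one) auto
    then show "2 * \<eta> i \<le> \<rho> / 4" using e(2) by (simp add: \<eta>_def)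
  qed
  define V where "V i = (\<Union>u\<in>U i. ball u (\<eta> i))" for i
  define w where "w i = diameter (U i) + 2 * \<eta> i" for i
  have Vopen: "open (V i)" for i by (auto simp: V_def)
  have Vd: "dist a b \<le> w i" if "a \<in> V i" "b \<in> V i" for i a b
  proof -
    obtain u v where uv: "u \<in> U i" "v \<in> U i" "dist u a < \<eta> i" "dist v b < \<eta> i" using \<open>a \<in> V i\<close> \<open>b \<in> V i\<close> by (auto simp: V_def)
    have "dist u v \<le> diameter (U i)" by (rule diameter_bounded_bound[OF U(2) uv(1,2)])
    moreover have "dist a b \<le> dist a u + dist u b" "dist u b \<le> dist u v + dist v b" by (rule dist_triangle)+
    ultimately show ?thesis using uv(3,4) dist_commute[of a u] by (simp add: w_def)
  qed
  have w: "0 \<le> w i" "w i \<le> \<rho> / 2" for i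
    using U(3)[of i] \<eta>[of i] diameter_ge_0[OF U(2), of i] by (auto simp: w_def)
  have sumw: "(\<Sum>i. ennreal (w i)) < t"
  proof -
    have "(\<Sum>i. ennreal (w i)) = (\<Sum>i. ennreal (diameter (U i)) + ennreal (e * (1/2) ^ Suc i))"
      using \<eta>(1) diameter_ge_0[OF U(2)] by (simp add: w_def \<eta>_def ennreal_plus[symmetric] less_imp_le del: ennreal_plus power_Suc)
    also have "\<dots> = \<sigma> + (\<Sum>i. ennreal (e * (1/2) ^ Suc i))" unfolding \<sigma> by (rule suminf_add[symmetric]) auto
    also have "(\<Sum>i. ennreal (e * (1/2) ^ Suc i)) = ennreal e"
      using sums_mult[OF power_half_series, of e] e by (subst suminf_ennreal_eq[where x=e]) auto
    finally show ?thesis using e(3) by simp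
  qed
  have "U i \<subseteq> V i" for i using \<eta>(1)[of i] by (auto simp: V_def)
  then have KV: "?K \<subseteq> (\<Union>i. V i)" using U(1) by (meson SUP_mono subset_trans UNIV_I)
  obtain I0 where I0: "finite I0" "?K \<subseteq> (\<Union>i\<in>I0. V i)"
    by (rule compactE_image[OF K(1) _ KV]) (rule Vopen)
  define I where "I = {i\<in>I0. V i \<inter> ?K \<noteq> {}}"
  have KI: "?K \<subseteq> (\<Union>i\<in>I. V i)" using I0(2) by (fastforce simp: I_def)
  define r where "r i k \<longleftrightarrow> i \<in> I \<and> k \<in> I \<and> V i \<inter> V k \<inter> ?K \<noteq> {}" for i k
  obtain i0 where i0: "i0 \<in> I" "f 0 \<in> V i0" using KI x by blast
  define A where "A = (\<Union>i\<in>{i\<in>I. r\<^sup>*\<^sup>* i0 i}. V i)"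
  define B where "B = (\<Union>i\<in>{i\<in>I. \<not> r\<^sup>*\<^sup>* i0 i}. V i)"
  have "A \<inter> B \<inter> ?K = {}"
  proof (rule ccontr)
    assume "A \<inter> B \<inter> ?K \<noteq> {}"
    then obtain z i k where z: "z \<in> ?K" "z \<in> V i" "z \<in> V k" "i \<in> I" "k \<in> I" "r\<^sup>*\<^sup>* i0 i" "\<not> r\<^sup>*\<^sup>* i0 k"
      unfolding A_def B_def by blast
    then have "r i k" by (auto simp: r_def)
    then show False using z by (meson rtranclp.rtrancl_into_rtrancl)
  qed
  moreover have "A \<union> B = (\<Union>i\<in>I. V i)" unfolding A_def B_def by blast
  then have "?K \<subseteq> A \<union> B" using KI by simp
  moreover have "open A" "open B" using Vopen by (auto simp: A_def B_def)
  ultimately have "A \<inter> ?K = {} \<or> B \<inter> ?K = {}" using connectedD[OF K(2)] by blast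
  moreover have "f 0 \<in> A" using i0 by (auto simp: A_def)
  ultimately have "f 1 \<in> A" using x y \<open>?K \<subseteq> A \<union> B\<close> by blast
  then obtain j where j: "j \<in> I" "r\<^sup>*\<^sup>* i0 j" "f 1 \<in> V j" by (auto simp: A_def)
  obtain js where js: "rtrancl_path r i0 js j" "distinct (i0 # js)"
    using j(2) rtrancl_path_distinct unfolding rtranclp_eq_rtrancl_path by metis
  have "\<exists>qs q. set qs \<subseteq> D \<and> q \<in> E \<and> polygon_in (W \<inter> O') (f 0) (qs @ [q]) \<and>
           polygon_length (f 0) (qs @ [q]) \<le> sum_list (map w (i0 # js))"
  proof (rule rtrancl_path_polygon[where r=r and I=I and V=V and w=w and D=D and E=E and W=W, OF js(1) i0 j(3) E(2)])
    fix i a b assume i: "i \<in> I" and ab: "a \<in> V i \<inter> W" "b \<in> V i \<inter> W"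
    obtain z where z: "z \<in> V i" "z \<in> ?K" using i by (auto simp: I_def)
    have "a \<in> ball z \<rho>" "b \<in> ball z \<rho>"
      using Vd[of z i a] Vd[of z i b] z(1) ab w(2)[of i] \<rho>(1) by auto
    then have "closed_segment a b \<subseteq> ball z \<rho>" by (intro closed_segment_subset) auto
    moreover have "closed_segment a b \<subseteq> W" using W ab by (intro closed_segment_subset) auto
    ultimately show "closed_segment a b \<subseteq> W \<inter> O'" using \<rho>(2) z(2) by blast
  next
    fix i k assume "r i k"
    then obtain z where "k \<in> I" "z \<in> V i" "z \<in> V k" "z \<in> ?K" by (auto simp: r_def)
    moreover then have "z \<in> closure D" using fS D(2) by blast
    ultimately show "k \<in> I \<and> (\<exists>z. z \<in> V i \<inter> V k \<inter> closure D)" by blast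
  next
    show "f 0 \<in> W" using fS x by blast
  qed (use Vopen Vd D(1) E(1) in auto)
  then obtain qs q where q: "set qs \<subseteq> D" "q \<in> E" "polygon_in (W \<inter> O') (f 0) (qs @ [q])"
      "polygon_length (f 0) (qs @ [q]) \<le> sum_list (map w (i0 # js))" by blast
  have "ennreal (polygon_length (f 0) (qs @ [q])) \<le> ennreal (sum_list (map w (i0 # js)))"
    by (rule ennreal_leI) (rule q)
  also have "sum_list (map w (i0 # js)) = sum w (set (i0 # js))"
    by (rule sum_list_distinct_conv_sum_set[OF js(2)])
  also have "ennreal \<dots> = (\<Sum>i\<in>set (i0 # js). ennreal (w i))"
    using w(1) by (rule sum_ennreal[symmetric])
  also have "\<dots> \<le> (\<Sum>i. ennreal (w i))" by (rule sum_le_suminf) auto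
  also have "\<dots> < t" by (rule sumw)
  finally show ?thesis using q by blast
qed

lemma geodesic_length_less_iff_dense:
  fixes W :: "'a::euclidean_space set"
  assumes W: "convex W" and D: "D \<subseteq> W" "W \<subseteq> closure D" and E: "E \<subseteq> W \<inter> T" "W \<inter> T \<subseteq> closure E"
  shows "geodesic_length (top_of_set W) (F \<inter> W) x T < t \<longleftrightarrow>
    (\<exists>qs q. set qs \<subseteq> D \<and> q \<in> E \<and> polygon_in (top_of_set W interior_of (F \<inter> W)) x (qs @ [q]) \<and>
      ennreal (polygon_length x (qs @ [q])) < t)"
proof
  let ?S = "top_of_set W interior_of (F \<inter> W)"
  obtain O' where O': "open O'" "?S = W \<inter> O'"
    using openin_interior_of[of "top_of_set W" "F \<inter> W"] unfolding openin_open by blast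
  assume "geodesic_length (top_of_set W) (F \<inter> W) x T < t"
  then obtain f where f0: "f \<in> lipschitz_paths (top_of_set W) (F \<inter> W) x T" "hausdorff_outer 1 (f ` {0..1}) < t"
    unfolding geodesic_length_def INF_less_iff by blast
  then obtain L where f: "L-lipschitz_on {0..1} f" "f ` {0..1} \<subseteq> ?S" "f 0 = x" "f 1 \<in> T"
    unfolding lipschitz_paths_def by blast
  have "f 1 \<in> closure E" using f(2,4) E(2) O'(2) by fastforce
  then show "\<exists>qs q. set qs \<subseteq> D \<and> q \<in> E \<and> polygon_in ?S x (qs @ [q]) \<and> ennreal (polygon_length x (qs @ [q])) < t"
    using lipschitz_path_polygon[OF f(1) f(2)[unfolded O'(2)] W O'(1) D _ _ f0(2), of E] E(1) f(3) O'(2) by auto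
next
  let ?S = "top_of_set W interior_of (F \<inter> W)"
  assume "\<exists>qs q. set qs \<subseteq> D \<and> q \<in> E \<and> polygon_in ?S x (qs @ [q]) \<and> ennreal (polygon_length x (qs @ [q])) < t"
  then obtain qs q where q: "q \<in> E" "polygon_in ?S x (qs @ [q])" "ennreal (polygon_length x (qs @ [q])) < t" by blast
  obtain f :: "real \<Rightarrow> 'a" and L where f: "L-lipschitz_on {0..1} f" "f ` {0..1} \<subseteq> ?S" "f 0 = x" "f 1 = last (qs @ [q])"
     "hausdorff_outer 1 (f ` {0..1}) \<le> ennreal (polygon_length x (qs @ [q]))"
    using polygon_lipschitz_path[OF q(2)] by (elim meta_impE exE conjE) simp_all
  then have "f \<in> lipschitz_paths (top_of_set W) (F \<inter> W) x T" using q(1) E(1) by (auto simp: lipschitz_paths_def)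
  then show "geodesic_length (top_of_set W) (F \<inter> W) x T < t"
    unfolding geodesic_length_def INF_less_iff using f(5) q(3) by (intro bexI[of _ f]) auto
qed

lemma polygon_in_vertices: "polygon_in S x ps \<Longrightarrow> set ps \<subseteq> S"
  by (induction ps arbitrary: x) auto

lemma geodesic_length_less_iff:
  fixes W :: "'a::euclidean_space set"
  assumes W: "convex W"
  shows "geodesic_length (top_of_set W) (F \<inter> W) x T < t \<longleftrightarrow>
    (\<exists>ps. ps \<noteq> [] \<and> last ps \<in> T \<and> polygon_in (top_of_set W interior_of (F \<inter> W)) x ps \<and>
      ennreal (polygon_length x ps) < t)"
  (is "?G < t \<longleftrightarrow> ?R")
proof
  assume "?G < t"
  then obtain qs q where "q \<in> W \<inter> T" "polygon_in (top_of_set W interior_of (F \<inter> W)) x (qs @ [q])"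
      "ennreal (polygon_length x (qs @ [q])) < t"
    using geodesic_length_less_iff_dense[OF W, of W "W \<inter> T" T F x t] closure_subset[of W] closure_subset[of "W \<inter> T"] by auto
  then show ?R by (intro exI[of _ "qs @ [q]"]) auto
next
  assume ?R
  then obtain ps where ps: "ps \<noteq> []" "last ps \<in> T" "polygon_in (top_of_set W interior_of (F \<inter> W)) x ps"
      "ennreal (polygon_length x ps) < t" by blast
  have eq: "ps = butlast ps @ [last ps]" using ps(1) by simp
  have "set ps \<subseteq> W" using polygon_in_vertices[OF ps(3)] interior_of_subset[of "top_of_set W" "F \<inter> W"] by auto
  moreover have "last ps \<in> set ps" using ps(1) by simp
  ultimately have "set (butlast ps) \<subseteq> W" "last ps \<in> W \<inter> T" using ps(2) by (auto dest: in_set_butlastD)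
  then have "\<exists>qs q. set qs \<subseteq> W \<and> q \<in> W \<inter> T \<and> polygon_in (top_of_set W interior_of (F \<inter> W)) x (qs @ [q]) \<and>
      ennreal (polygon_length x (qs @ [q])) < t"
    using ps(3,4) eq by (metis (no_types))
  then show "?G < t"
    using geodesic_length_less_iff_dense[OF W, of W "W \<inter> T" T F x t] closure_subset[of W] closure_subset[of "W \<inter> T"] by auto
qed

lemma geodesic_length_le_polygon:
  fixes W :: "'a::euclidean_space set"
  assumes "convex W" "ps \<noteq> []" "last ps \<in> T" "polygon_in (top_of_set W interior_of (F \<inter> W)) x ps"
  shows "geodesic_length (top_of_set W) (F \<inter> W) x T \<le> ennreal (polygon_length x ps)"
  by (rule dense_ge) (use assms in \<open>auto intro!: less_imp_le simp: geodesic_length_less_iff\<close>)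

lemma connected_points_iff: "x \<in> connected_points X S T \<longleftrightarrow> geodesic_length X S x T < \<infinity>"
proof
  assume "x \<in> connected_points X S T"
  then obtain f where f: "f \<in> lipschitz_paths X S x T" by (auto simp: connected_points_def)
  then obtain L where "L-lipschitz_on {0..1} f" by (auto simp: lipschitz_paths_def)
  then have "hausdorff_outer 1 (f ` {0..1}) < \<infinity>"
    using hausdorff_outer_lipschitz_image by (metis ennreal_less_top infinity_ennreal_def le_less_trans)
  then show "geodesic_length X S x T < \<infinity>" using f unfolding geodesic_length_def INF_less_iff by blast
next
  assume "geodesic_length X S x T < \<infinity>"
  then show "x \<in> connected_points X S T"
    unfolding geodesic_length_def INF_less_iff connected_points_def by blast
qed

lemma geodesic_length_triangle:
  fixes W :: "'a::euclidean_space set"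
  assumes W: "convex W" and seg: "closed_segment x y \<subseteq> top_of_set W interior_of (F \<inter> W)"
  shows "geodesic_length (top_of_set W) (F \<inter> W) x T \<le> geodesic_length (top_of_set W) (F \<inter> W) y T + ennreal (dist x y)"
    (is "?G x \<le> ?G y + _")
proof (rule ennreal_le_epsilon)
  fix e :: real assume e: "0 < e" and "?G y + ennreal (dist x y) < top"
  then have "?G y < ?G y + ennreal e"
    using ennreal_add_left_cancel_less[of "?G y" 0 "ennreal e"] by (auto simp: less_top)
  then obtain ps where ps: "ps \<noteq> []" "last ps \<in> T" "polygon_in (top_of_set W interior_of (F \<inter> W)) y ps"
      "ennreal (polygon_length y ps) < ?G y + ennreal e" unfolding geodesic_length_less_iff[OF W] by blast
  have "?G x \<le> ennreal (polygon_length x (y # ps))"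
    using ps seg by (intro geodesic_length_le_polygon[OF W]) auto
  also have "\<dots> = ennreal (polygon_length y ps) + ennreal (dist x y)"
    using polygon_length_nonneg[of y ps] by (simp add: add.commute)
  also have "\<dots> \<le> ?G y + ennreal e + ennreal (dist x y)"
    using ps(4) by (intro add_right_mono less_imp_le)
  finally show "?G x \<le> ?G y + ennreal (dist x y) + ennreal e" by (simp add: add_ac)
qed

lemma interior_shift: "interior (shift h F) = shift h (interior F)"
  for F :: "'a::real_normed_vector set"
  using interior_translation[of "- h" F] by (simp add: shift_def)

lemma polygon_in_shift:
  "polygon_in S (y + h) ps \<Longrightarrow> polygon_in (shift h S) y (map (\<lambda>z. z - h) ps)"
proof (induction ps arbitrary: y)
  case (Cons p ps)
  have "closed_segment y (p - h) = (\<lambda>z. z - h) ` closed_segment (y + h) p"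
    using closed_segment_translation[of "- h" "y + h" p] by (simp add: add.commute)
  then show ?case using Cons.prems Cons.IH[of "p - h"] by (auto simp: shift_def)
qed simp

lemma polygon_length_shift:
  fixes y :: "'a::real_normed_vector"
  shows "polygon_length y (map (\<lambda>z. z - h) ps) = polygon_length (y + h) ps"
proof (induction ps arbitrary: y)
  case (Cons p ps)
  have "dist y (p - h) = dist (y + h) p" by (simp add: dist_norm algebra_simps)
  then show ?case using Cons[of "p - h"] by simp
qed simp

lemma geodesic_length_shift:
  fixes F :: "'a::euclidean_space set"
  assumes T: "\<And>z. z - h \<in> T \<longleftrightarrow> z \<in> T"
  shows "geodesic_length euclidean (shift h F) y T = geodesic_length euclidean F (y + h) T"
proof (rule antisym)
  have le: "geodesic_length euclidean (shift h F) y T \<le> geodesic_length euclidean F (y + h) T"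
    if T: "\<And>z. z \<in> T \<Longrightarrow> z - h \<in> T" for h y and F :: "'a set"
  proof (rule dense_ge)
    fix t assume "geodesic_length euclidean F (y + h) T < t"
    then obtain ps where "ps \<noteq> []" "last ps \<in> T" "polygon_in (interior F) (y + h) ps"
       "ennreal (polygon_length (y + h) ps) < t"
      using geodesic_length_less_iff[of UNIV F "y + h" T t] by auto
    then have "map (\<lambda>z. z - h) ps \<noteq> [] \<and> last (map (\<lambda>z. z - h) ps) \<in> T \<and>
        polygon_in (interior (shift h F)) y (map (\<lambda>z. z - h) ps) \<and> ennreal (polygon_length y (map (\<lambda>z. z - h) ps)) < t"
      using T polygon_in_shift[of "interior F" y h ps] by (simp add: last_map polygon_length_shift interior_shift)
    then show "geodesic_length euclidean (shift h F) y T \<le> t"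
      using geodesic_length_less_iff[of UNIV "shift h F" y T t] by (auto intro: less_imp_le)
  qed
  show "geodesic_length euclidean (shift h F) y T \<le> geodesic_length euclidean F (y + h) T"
    using T by (intro le) auto
  have "shift (- h) (shift h F) = F" by (auto simp: shift_def image_image)
  moreover have "z + h \<in> T" if "z \<in> T" for z using T[of "z + h"] that by simp
  ultimately show "geodesic_length euclidean F (y + h) T \<le> geodesic_length euclidean (shift h F) y T"
    using le[of "- h" "shift h F" "y + h"] by simp
qed

lemma openin_fell_closed: "openin fell_topology U \<Longrightarrow> F \<in> U \<Longrightarrow> closed F"
  using openin_subset[of fell_topology U] unfolding fell_topology_def topology_generated_by_topspace by fastforce

lemma sets_fell_borel_open: "openin fell_topology U \<Longrightarrow> U \<in> sets fell_borel"
  unfolding fell_borel_def by (subst sets_measure_of) (auto dest: openin_fell_closed)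

lemma space_fell_borel [simp]: "space fell_borel = {F. closed F}"
  unfolding fell_borel_def by (rule space_measure_of) (auto dest: openin_fell_closed)

lemma pred_mem_fell_borel [measurable]:
  fixes r :: "'a::t1_space"
  shows "Measurable.pred fell_borel (\<lambda>F. r \<in> F)"
proof -
  have "openin fell_topology {F. closed F \<and> F \<inter> {r} = {}}"
    unfolding fell_topology_def
  proof (rule topology_generated_by_Basis, rule UnI1, rule CollectI, intro exI conjI)
    show "{F. closed F \<and> F \<inter> {r} = {}} = {F. closed F \<and> F \<inter> {r} = {}}" ..
  qed simp
  then have "{F. closed F} - {F. closed F \<and> F \<inter> {r} = {}} \<in> sets fell_borel"
    by (metis sets.compl_sets sets_fell_borel_open space_fell_borel)
  moreover have "{F. closed F} - {F. closed F \<and> F \<inter> {r} = {}} = {F. closed F \<and> r \<in> F}" by blast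
  ultimately show ?thesis unfolding pred_def by simp
qed

lemma segment_in_interior_iff:
  fixes W :: "'a::euclidean_space set"
  assumes F: "closed F" and D: "D \<subseteq> W" "W \<subseteq> closure D"
  shows "closed_segment a b \<subseteq> top_of_set W interior_of (F \<inter> W) \<longleftrightarrow>
    closed_segment a b \<subseteq> W \<and> (\<exists>n::nat. \<forall>r\<in>D. (\<exists>z\<in>closed_segment a b. dist z r < 1 / (real n + 1)) \<longrightarrow> r \<in> F)"
    (is "?L \<longleftrightarrow> ?R")
proof
  let ?S = "top_of_set W interior_of (F \<inter> W)"
  assume L: ?L
  obtain O' where O': "open O'" "?S = W \<inter> O'"
    using openin_interior_of[of "top_of_set W" "F \<inter> W"] unfolding openin_open by blast
  have SF: "?S \<subseteq> F" using interior_of_subset[of "top_of_set W" "F \<inter> W"] by blast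
  obtain e where e: "e > 0" "(\<Union>z\<in>closed_segment a b. ball z e) \<subseteq> O'"
    using compact_subset_open_imp_ball_epsilon_subset[OF compact_segment O'(1), of a b] L O'(2) by blast
  obtain n where n: "1 / (real n + 1) < e"
    using reals_Archimedean[OF e(1)] by (metis inverse_eq_divide of_nat_Suc add.commute)
  have "r \<in> F" if "r \<in> D" "z \<in> closed_segment a b" "dist z r < 1 / (real n + 1)" for r z
  proof -
    have "r \<in> ball z e" using that(3) n by simp
    then have "r \<in> O'" using e(2) that(2) by blast
    then show ?thesis using that(1) D(1) O'(2) SF by blast
  qed
  then show ?R using L O'(2) by blast
next
  let ?S = "top_of_set W interior_of (F \<inter> W)"
  assume ?R
  then obtain n where n: "closed_segment a b \<subseteq> W"
      "\<And>r z. r \<in> D \<Longrightarrow> z \<in> closed_segment a b \<Longrightarrow> dist z r < 1 / (real n + 1) \<Longrightarrow> r \<in> F" by blast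
  define U where "U = (\<Union>z\<in>closed_segment a b. ball z (1 / (real n + 1)))"
  have U: "open U" by (auto simp: U_def)
  have "U \<inter> D \<subseteq> F" using n(2) by (auto simp: U_def)
  then have "closure (U \<inter> D) \<subseteq> F" using F by (simp add: closure_minimal)
  then have "W \<inter> U \<subseteq> F \<inter> W" using open_Int_closure_subset[OF U, of D] D(2) by blast
  then have "W \<inter> U \<subseteq> ?S" using U by (intro interior_of_maximal) (auto simp: openin_open)
  moreover have "closed_segment a b \<subseteq> W \<inter> U" using n(1) by (auto simp: U_def intro!: bexI)
  ultimately show ?L by blast
qed

lemma pred_countable_ball:
  assumes D: "countable D" and P: "\<And>r. r \<in> D \<Longrightarrow> Measurable.pred M (\<lambda>x. P x r)"
  shows "Measurable.pred M (\<lambda>x. \<forall>r\<in>D. P x r)"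
proof -
  have "(\<Union>r\<in>D. {x\<in>space M. \<not> P x r}) \<in> sets M"
    using pred_intros_logic(2)[OF P] by (intro sets.countable_UN''[OF D]) (simp add: pred_def)
  then have "space M - (\<Union>r\<in>D. {x\<in>space M. \<not> P x r}) \<in> sets M" by (rule sets.compl_sets)
  moreover have "space M - (\<Union>r\<in>D. {x\<in>space M. \<not> P x r}) = {x\<in>space M. \<forall>r\<in>D. P x r}" by blast
  ultimately show ?thesis by (simp add: pred_def)
qed

lemma measurable_geodesic_length:
  fixes W T :: "'a::euclidean_space set"
  assumes W: "convex W" "closed W"
  shows "(\<lambda>(x, F). geodesic_length (top_of_set W) (F \<inter> W) x T) \<in> borel_measurable (borel \<Otimes>\<^sub>M fell_borel)"
proof -
  obtain D where D: "countable D" "D \<subseteq> W" "W \<subseteq> closure D" using separable by blast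
  obtain E where E: "countable E" "E \<subseteq> W \<inter> T" "W \<inter> T \<subseteq> closure E" using separable by blast
  let ?S = "\<lambda>F. top_of_set W interior_of (F \<inter> W)"
  have near: "Measurable.pred borel (\<lambda>x. \<exists>z\<in>closed_segment x p. dist z r < e)" for p r :: 'a and e
  proof -
    have "{x. \<exists>z\<in>closed_segment x p. dist z r < e} =
        (\<Union>u\<in>{0..1}. {x. dist ((1 - u) *\<^sub>R x + u *\<^sub>R p) r < e})"
      by (auto simp: closed_segment_def) blast
    moreover have "open (\<Union>u\<in>{0..1}. {x. dist ((1 - u) *\<^sub>R x + u *\<^sub>R p) r < e})"
      by (intro open_UN ballI open_Collect_less continuous_intros)
    ultimately show ?thesis by (simp add: pred_def)
  qed
  have seg: "Measurable.pred (borel \<Otimes>\<^sub>M fell_borel) (\<lambda>(x, F). closed_segment x p \<subseteq> ?S F)" for p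
  proof -
    have [measurable]: "W \<in> sets borel" using W(2) by simp
    note near[measurable]
    have "Measurable.pred (borel \<Otimes>\<^sub>M fell_borel) (\<lambda>xF. fst xF \<in> W \<and> p \<in> W \<and>
        (\<exists>n::nat. \<forall>r\<in>D. (\<exists>z\<in>closed_segment (fst xF) p. dist z r < 1 / (real n + 1)) \<longrightarrow> r \<in> snd xF))"
    proof -
      have q: "Measurable.pred (borel \<Otimes>\<^sub>M fell_borel) (\<lambda>xF. (\<exists>z\<in>closed_segment (fst xF) p. dist z r < 1 / (real n + 1)) \<longrightarrow> r \<in> snd xF)"
        for n :: nat and r :: 'a
      proof (rule pred_intros_logic(4))
        show "Measurable.pred (borel \<Otimes>\<^sub>M fell_borel) (\<lambda>xF. \<exists>z\<in>closed_segment (fst xF) p. dist z r < 1 / (real n + 1))"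
          using measurable_compose[OF measurable_fst near[of p r "1 / (real n + 1)"]] by simp
        show "Measurable.pred (borel \<Otimes>\<^sub>M fell_borel) (\<lambda>xF. r \<in> snd xF)"
          using measurable_compose[OF measurable_snd pred_mem_fell_borel[of r]] by simp
      qed
      have [measurable]: "Measurable.pred (borel \<Otimes>\<^sub>M fell_borel) (\<lambda>xF. \<forall>r\<in>D.
          (\<exists>z\<in>closed_segment (fst xF) p. dist z r < 1 / (real n + 1)) \<longrightarrow> r \<in> snd xF)" for n :: nat
        by (rule pred_countable_ball[OF D(1) q])
      show ?thesis by measurable
    qed
    moreover have "(case xF of (x, F) \<Rightarrow> closed_segment x p \<subseteq> ?S F) \<longleftrightarrow> fst xF \<in> W \<and> p \<in> W \<and>
        (\<exists>n::nat. \<forall>r\<in>D. (\<exists>z\<in>closed_segment (fst xF) p. dist z r < 1 / (real n + 1)) \<longrightarrow> r \<in> snd xF)"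
      if "xF \<in> space (borel \<Otimes>\<^sub>M fell_borel)" for xF
    proof -
      obtain x F where xF: "xF = (x, F)" by (cases xF)
      then have F: "closed F" using that by (simp add: space_pair_measure)
      have "closed_segment x p \<subseteq> W \<longleftrightarrow> x \<in> W \<and> p \<in> W"
        using W(1) by (meson closed_segment_subset ends_in_segment subset_iff)
      then show ?thesis using segment_in_interior_iff[OF F D(2,3), of x p] by (simp add: xF)
    qed
    ultimately show ?thesis by (subst measurable_cong) auto
  qed
  have poly: "Measurable.pred (borel \<Otimes>\<^sub>M fell_borel) (\<lambda>(x, F). polygon_in (?S F) x ps)" for ps
  proof (induction ps)
    case (Cons p ps)
    have "Measurable.pred (borel \<Otimes>\<^sub>M fell_borel) (\<lambda>xF. polygon_in (?S (snd xF)) p ps)"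
      using measurable_compose[OF _ Cons, of "\<lambda>xF. (p, snd xF)" "borel \<Otimes>\<^sub>M fell_borel"] by simp
    from pred_intros_logic(3)[OF seg[of p] this] show ?case by (simp add: split_beta')
  qed simp
  show ?thesis
  proof (rule borel_measurableI_less)
    fix t
    let ?PL = "{qs. set qs \<subseteq> D} \<times> E"
    have cPL: "countable ?PL" using D(1) E(1) by (intro countable_SIGMA countable_lists) (auto simp flip: lists_eq_set intro: countable_lists)
    have "{xF \<in> space (borel \<Otimes>\<^sub>M fell_borel). (case xF of (x, F) \<Rightarrow> geodesic_length (top_of_set W) (F \<inter> W) x T) < t} =
      (\<Union>(qs, q)\<in>?PL. {xF \<in> space (borel \<Otimes>\<^sub>M fell_borel).
         (case xF of (x, F) \<Rightarrow> polygon_in (?S F) x (qs @ [q])) \<and> ennreal (polygon_length (fst xF) (qs @ [q])) < t})"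
      by (auto simp: geodesic_length_less_iff_dense[OF W(1) D(2,3) E(2,3)]) blast+
    also have "\<dots> \<in> sets (borel \<Otimes>\<^sub>M fell_borel)"
    proof (rule sets.countable_UN''[OF cPL], clarify)
      fix qs q
      have len: "(\<lambda>xF. polygon_length (fst xF) ps) \<in> borel_measurable (borel \<Otimes>\<^sub>M fell_borel)" for ps :: "'a list"
        by (cases ps) auto
      show "{xF \<in> space (borel \<Otimes>\<^sub>M fell_borel).
         (case xF of (x, F) \<Rightarrow> polygon_in (?S F) x (qs @ [q])) \<and> ennreal (polygon_length (fst xF) (qs @ [q])) < t}
         \<in> sets (borel \<Otimes>\<^sub>M fell_borel)"
        using poly[of "qs @ [q]"] len[of "qs @ [q]"] by measurable
    qed
    finally show "{xF \<in> space (borel \<Otimes>\<^sub>M fell_borel). (case xF of (x, F) \<Rightarrow> geodesic_length (top_of_set W) (F \<inter> W) x T) < t} \<in> sets (borel \<Otimes>\<^sub>M fell_borel)" .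
  qed
qed

section \<open>A multiparameter ergodic theorem\<close>

definition cube :: "real \<Rightarrow> 'a::euclidean_space set" where
  "cube r = {x. \<forall>b\<in>Basis. \<bar>x \<bullet> b\<bar> \<le> r / 2}"

lemma cube_eq_cbox: "cube r = cbox (- (r / 2) *\<^sub>R One) ((r / 2) *\<^sub>R One :: 'a::euclidean_space)"
proof -
  have "\<bar>t\<bar> \<le> r / 2 \<longleftrightarrow> - (r / 2) \<le> t \<and> t \<le> r / 2" for t by linarith
  then show ?thesis unfolding cube_def by (intro set_eqI) (simp add: mem_box)
qed

lemma cube_borel [measurable]: "cube r \<in> sets borel"
  by (simp add: cube_eq_cbox)

lemma emeasure_cube:
  "r \<ge> 0 \<Longrightarrow> emeasure lborel (cube r :: 'a::euclidean_space set) = ennreal (r ^ DIM('a))"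
proof -
  assume r: "r \<ge> 0"
  let ?c = "(r / 2) *\<^sub>R One :: 'a"
  have "emeasure lborel (cube r :: 'a set) = ennreal (\<Prod>b\<in>Basis. (?c - - (r / 2) *\<^sub>R One) \<bullet> b)"
    unfolding cube_eq_cbox using r by (intro emeasure_lborel_cbox) simp
  also have "(\<Prod>b\<in>Basis. (?c - - (r / 2) *\<^sub>R One) \<bullet> b) = (\<Prod>b\<in>(Basis::'a set). r)"
    by (intro prod.cong) (auto simp: inner_add_left)
  finally show ?thesis by simp
qed

lemma measure_cube:
  "r \<ge> 0 \<Longrightarrow> measure lborel (cube r :: 'a::euclidean_space set) = r ^ DIM('a)"
  by (simp add: measure_def emeasure_cube)

lemma cube_subset_cball:
  assumes "r \<ge> 0"
  shows "cube r \<subseteq> cball (0::'a::euclidean_space) (real DIM('a) * r)"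
proof
  fix x :: 'a assume x: "x \<in> cube r"
  have "norm x \<le> (\<Sum>b\<in>Basis. \<bar>x \<bullet> b\<bar>)" by (rule norm_le_l1)
  also have "\<dots> \<le> (\<Sum>b\<in>(Basis::'a set). r)" using x assms by (intro sum_mono) (force simp: cube_def)
  finally show "x \<in> cball 0 (real DIM('a) * r)" by simp
qed

lemma nn_integral_lborel_translation:
  fixes f :: "'a::euclidean_space \<Rightarrow> ennreal"
  assumes [measurable]: "f \<in> borel_measurable borel"
  shows "(\<integral>\<^sup>+x. f (x + y) \<partial>lborel) = (\<integral>\<^sup>+x. f x \<partial>lborel)"
  using nn_integral_distr[of "(+) y" lborel borel f] lborel_distr_plus[of y] by (simp add: add.commute)

lemma integral_lborel_translation:
  fixes f :: "'a::euclidean_space \<Rightarrow> real"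
  assumes [measurable]: "f \<in> borel_measurable borel"
  shows "(\<integral>x. f (x + y) \<partial>lborel) = (\<integral>x. f x \<partial>lborel)"
  using integral_distr[of "(+) y" lborel borel f] lborel_distr_plus[of y] by (simp add: add.commute)

lemma measurable_nn_integral_lborel:
  fixes g :: "'a::euclidean_space \<times> 'w \<Rightarrow> ennreal"
  assumes "g \<in> borel_measurable (borel \<Otimes>\<^sub>M M)"
  shows "(\<lambda>\<omega>. \<integral>\<^sup>+x. g (x, \<omega>) \<partial>lborel) \<in> borel_measurable M"
proof -
  have "(\<lambda>p. (snd p, fst p)) \<in> measurable (M \<Otimes>\<^sub>M lborel) ((borel :: 'a measure) \<Otimes>\<^sub>M M)" by measurable
  from measurable_compose[OF this assms]
  have "(\<lambda>(\<omega>, x). g (x, \<omega>)) \<in> borel_measurable (M \<Otimes>\<^sub>M lborel)" by (simp add: split_beta')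
  then show ?thesis by (rule lborel.borel_measurable_nn_integral)
qed

locale euclidean_action = prob_space M for M :: "'w measure" +
  fixes S :: "'a::euclidean_space \<Rightarrow> 'w \<Rightarrow> 'w"
  assumes S_meas: "S x \<in> measurable M M"
    and S_pres: "distr M M (S x) = M"
    and S_0: "\<omega> \<in> space M \<Longrightarrow> S 0 \<omega> = \<omega>"
    and S_add: "\<omega> \<in> space M \<Longrightarrow> S (x + y) \<omega> = S x (S y \<omega>)"
begin

lemma S_space: "\<omega> \<in> space M \<Longrightarrow> S x \<omega> \<in> space M"
  using S_meas by (rule measurable_space)

definition orbit_measurable :: "('w \<Rightarrow> 'b::topological_space) \<Rightarrow> bool" where
  "orbit_measurable f \<longleftrightarrow> (\<lambda>(x, \<omega>). f (S x \<omega>)) \<in> borel_measurable (borel \<Otimes>\<^sub>M M)"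

lemma orbit_measurable_path:
  assumes "orbit_measurable f" "\<omega> \<in> space M"
  shows "(\<lambda>x. f (S x \<omega>)) \<in> borel_measurable borel"
  using measurable_compose[OF measurable_Pair2'[OF assms(2), of borel] assms(1)[unfolded orbit_measurable_def]] by simp

lemma orbit_measurable_at:
  assumes "orbit_measurable f"
  shows "(\<lambda>\<omega>. f (S x \<omega>)) \<in> borel_measurable M"
  using measurable_compose[OF measurable_Pair1'[of x borel M] assms[unfolded orbit_measurable_def]] by simp

lemma orbit_measurable_borel:
  assumes "orbit_measurable f"
  shows "f \<in> borel_measurable M"
  using orbit_measurable_at[OF assms, of 0] by (subst measurable_cong[where g="\<lambda>\<omega>. f (S 0 \<omega>)"]) (auto simp: S_0)

lemma orbit_measurable_comp2:
  assumes "orbit_measurable f" and [measurable]: "u \<in> borel_measurable N" "v \<in> measurable N M"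
  shows "(\<lambda>p. f (S (u p) (v p))) \<in> borel_measurable N"
proof -
  have "(\<lambda>p. (u p, v p)) \<in> measurable N (borel \<Otimes>\<^sub>M M)" by measurable
  from measurable_compose[OF this assms(1)[unfolded orbit_measurable_def]] show ?thesis by simp
qed

lemma orbit_measurable_compose:
  assumes "orbit_measurable f" "g \<in> borel_measurable borel"
  shows "orbit_measurable (\<lambda>\<omega>. g (f \<omega>))"
  using measurable_compose[OF assms(1)[unfolded orbit_measurable_def] assms(2)]
  by (simp add: orbit_measurable_def split_beta')

definition eavg :: "real \<Rightarrow> ('w \<Rightarrow> ennreal) \<Rightarrow> 'w \<Rightarrow> ennreal" where
  "eavg r f \<omega> = (\<integral>\<^sup>+x. f (S x \<omega>) * indicator (cube r) x \<partial>lborel) / ennreal (r ^ DIM('a))"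

lemma orbit_measurable_eavg:
  assumes "orbit_measurable f"
  shows "orbit_measurable (eavg r f)"
proof -
  note [measurable (raw)] = orbit_measurable_comp2[OF assms]
  have "(\<lambda>(x, \<omega>). (\<integral>\<^sup>+y. f (S (y + x) \<omega>) * indicator (cube r) y \<partial>lborel) / ennreal (r ^ DIM('a)))
      \<in> borel_measurable (borel \<Otimes>\<^sub>M M)"
    by measurable
  then show ?thesis unfolding orbit_measurable_def
    by (subst measurable_cong[where g="\<lambda>(x, \<omega>). (\<integral>\<^sup>+y. f (S (y + x) \<omega>) * indicator (cube r) y \<partial>lborel) / ennreal (r ^ DIM('a))"])
       (auto simp: eavg_def space_pair_measure S_add)
qed

lemma nn_integral_S:
  assumes "f \<in> borel_measurable M"
  shows "(\<integral>\<^sup>+\<omega>. f (S x \<omega>) \<partial>M) = (\<integral>\<^sup>+\<omega>. f \<omega> \<partial>M)"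
  using nn_integral_distr[OF S_meas, of f x] assms S_pres[of x] by simp

definition maximal_const :: real where
  "maximal_const = unit_ball_vol (real DIM('a)) * (5 * real DIM('a)) ^ DIM('a) * (1 + 2 * real DIM('a)) ^ DIM('a)"

text \<open>The pointwise covering estimate behind Wiener's maximal inequality: Vitali's lemma selects disjoint
  balls on which the averages are large.\<close>

lemma maximal_covering:
  assumes f: "orbit_measurable f" and \<omega>: "\<omega> \<in> space M" and k: "k > 0"
    and Z: "Z \<subseteq> cube (real k)" "Z \<in> sets borel"
    and large: "\<And>x. x \<in> Z \<Longrightarrow> \<exists>r\<in>{1..k}. l < eavg (real r) f (S x \<omega>)"
  shows "l * emeasure lborel Z \<le>
    ennreal (unit_ball_vol (real DIM('a)) * (5 * real DIM('a)) ^ DIM('a)) *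
    (\<integral>\<^sup>+x. f (S x \<omega>) * indicator (cube (real k + 2 * real DIM('a) * real k)) x \<partial>lborel)"
proof -
  let ?n = "real DIM('a)"
  define \<nu> where "\<nu> = density lborel (\<lambda>x. f (S x \<omega>))"
  note [measurable] = orbit_measurable_path[OF f \<omega>]
  have s\<nu>[simp]: "sets \<nu> = sets borel" by (simp add: \<nu>_def)
  have \<nu>: "emeasure \<nu> A = (\<integral>\<^sup>+x. f (S x \<omega>) * indicator A x \<partial>lborel)" if "A \<in> sets borel" for A
    unfolding \<nu>_def using that by (subst emeasure_density) auto
  obtain r where r: "\<And>x. x \<in> Z \<Longrightarrow> r x \<in> {1..k}" "\<And>x. x \<in> Z \<Longrightarrow> l < eavg (real (r x)) f (S x \<omega>)"
    using large by metis
  have ball: "l * ennreal (real (r x) ^ DIM('a)) \<le> emeasure \<nu> (cball x (?n * real (r x)))" if x: "x \<in> Z" for x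
  proof -
    have rx: "real (r x) > 0" using r(1)[OF x] by simp
    have "(\<integral>\<^sup>+y. f (S y (S x \<omega>)) * indicator (cube (real (r x))) y \<partial>lborel)
        = (\<integral>\<^sup>+y. f (S (y + x) \<omega>) * indicator (cube (real (r x))) (y + x - x) \<partial>lborel)"
      by (simp add: S_add[OF \<omega>])
    also have "\<dots> = (\<integral>\<^sup>+y. f (S y \<omega>) * indicator (cube (real (r x))) (y - x) \<partial>lborel)"
      by (rule nn_integral_lborel_translation[where f="\<lambda>y. f (S y \<omega>) * indicator (cube (real (r x))) (y - x)"]) measurable
    also have "\<dots> \<le> (\<integral>\<^sup>+y. f (S y \<omega>) * indicator (cball x (?n * real (r x))) y \<partial>lborel)"
    proof (intro nn_integral_mono mult_left_mono)
      fix y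
      show "indicator (cube (real (r x))) (y - x) \<le> (indicator (cball x (?n * real (r x))) y :: ennreal)"
        using cube_subset_cball[of "real (r x)", where 'a='a] rx
        by (auto simp: indicator_def subset_iff dist_norm norm_minus_commute)
    qed simp
    also have "\<dots> = emeasure \<nu> (cball x (?n * real (r x)))" by (simp add: \<nu>)
    finally have le: "(\<integral>\<^sup>+y. f (S y (S x \<omega>)) * indicator (cube (real (r x))) y \<partial>lborel) \<le> emeasure \<nu> (cball x (?n * real (r x)))" .
    have c: "ennreal (real (r x) ^ DIM('a)) \<noteq> 0" "ennreal (real (r x) ^ DIM('a)) \<noteq> \<top>" using rx by auto
    have "l * ennreal (real (r x) ^ DIM('a)) \<le> eavg (real (r x)) f (S x \<omega>) * ennreal (real (r x) ^ DIM('a))"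
      by (rule mult_right_mono[OF less_imp_le[OF r(2)[OF x]]]) simp
    also have "\<dots> = (\<integral>\<^sup>+y. f (S y (S x \<omega>)) * indicator (cube (real (r x))) y \<partial>lborel)"
      unfolding eavg_def using c by (simp add: ennreal_divide_times mult_divide_eq_ennreal)
    also note le
    finally show ?thesis .
  qed
  have rB: "0 < ?n * real (r x) \<and> ?n * real (r x) \<le> ?n * real k" if "x \<in> Z" for x
    using r(1)[OF that] by (auto intro!: mult_left_mono)
  obtain C where C: "countable C" "C \<subseteq> Z"
     "pairwise (\<lambda>i j. disjnt (cball i (?n * real (r i))) (cball j (?n * real (r j)))) C"
     "\<And>i. i \<in> Z \<Longrightarrow> \<exists>j. j \<in> C \<and>
                        \<not> disjnt (cball i (?n * real (r i))) (cball j (?n * real (r j))) \<and>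
                        cball i (?n * real (r i)) \<subseteq> ball j (5 * (?n * real (r j)))"
    by (rule Vitali_covering_lemma_cballs_balls[of Z "\<lambda>x. ?n * real (r x)" "?n * real k" "\<lambda>x. x", OF rB])
       (assumption, rule that, assumption+)
  define g where "g = from_nat_into C"
  define I where "I = to_nat_on C ` C"
  have gI: "g i \<in> C" "to_nat_on C (g i) = i" if "i \<in> I" for i
    using that C(1) by (auto simp: g_def I_def)
  have gC: "\<exists>i\<in>I. g i = c" if "c \<in> C" for c
    using that C(1) by (auto simp: g_def I_def)
  define A where "A i = (if i \<in> I then cball (g i) (?n * real (r (g i))) else {})" for i
  define B where "B i = (if i \<in> I then ball (g i) (5 * (?n * real (r (g i)))) else {})" for i
  have [measurable]: "A i \<in> sets borel" "B i \<in> sets borel" for i by (auto simp: A_def B_def)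
  let ?K = "unit_ball_vol ?n * (5 * ?n) ^ DIM('a)"
  have AB: "l * emeasure lborel (B i) \<le> ennreal ?K * emeasure \<nu> (A i)" for i
  proof (cases "i \<in> I")
    case True
    have "emeasure lborel (B i) = ennreal (unit_ball_vol ?n * (5 * (?n * real (r (g i)))) ^ DIM('a))"
      using True by (simp add: B_def emeasure_ball)
    also have "unit_ball_vol ?n * (5 * (?n * real (r (g i)))) ^ DIM('a) = ?K * real (r (g i)) ^ DIM('a)"
      by (simp add: power_mult_distrib)
    also have "ennreal \<dots> = ennreal ?K * ennreal (real (r (g i)) ^ DIM('a))"
      by (rule ennreal_mult) auto
    finally have "l * emeasure lborel (B i) = ennreal ?K * (l * ennreal (real (r (g i)) ^ DIM('a)))"
      by (simp only: mult_ac)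
    also have "\<dots> \<le> ennreal ?K * emeasure \<nu> (cball (g i) (?n * real (r (g i))))"
      using gI(1)[OF True] C(2) by (intro mult_left_mono ball) auto
    finally show ?thesis using True by (simp add: A_def)
  qed (simp add: B_def)
  have disj: "disjoint_family A"
    unfolding disjoint_family_on_def
  proof (intro ballI impI)
    fix i j :: nat assume "i \<noteq> j"
    show "A i \<inter> A j = {}"
    proof (cases "i \<in> I \<and> j \<in> I")
      case True
      then have "g i \<noteq> g j" using gI(2) \<open>i \<noteq> j\<close> by metis
      then show ?thesis using C(3) gI(1) True by (auto simp: A_def pairwise_def disjnt_def)
    qed (auto simp: A_def)
  qed
  have "Z \<subseteq> (\<Union>i. B i)"
  proof
    fix x assume x: "x \<in> Z"
    then obtain j where j: "j \<in> C" "cball x (?n * real (r x)) \<subseteq> ball j (5 * (?n * real (r j)))" using C(4) by blast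
    obtain i where i: "i \<in> I" "g i = j" using gC[OF j(1)] by blast
    have "x \<in> cball x (?n * real (r x))" by simp
    then have "x \<in> ball j (5 * (?n * real (r j)))" using j(2) by (rule rev_subsetD)
    then have "x \<in> B i" using i by (simp add: B_def)
    then show "x \<in> (\<Union>i. B i)" by blast
  qed
  then have "l * emeasure lborel Z \<le> l * emeasure lborel (\<Union>i. B i)"
    by (intro mult_left_mono emeasure_mono) auto
  also have "\<dots> \<le> l * (\<Sum>i. emeasure lborel (B i))"
    by (intro mult_left_mono emeasure_subadditive_countably) auto
  also have "\<dots> = (\<Sum>i. l * emeasure lborel (B i))" by simp
  also have "\<dots> \<le> (\<Sum>i. ennreal ?K * emeasure \<nu> (A i))" by (intro suminf_le AB) auto
  also have "\<dots> = ennreal ?K * (\<Sum>i. emeasure \<nu> (A i))" by simp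
  also have "(\<Sum>i. emeasure \<nu> (A i)) = emeasure \<nu> (\<Union>i. A i)"
    using disj by (intro suminf_emeasure) auto
  also have "\<dots> \<le> emeasure \<nu> (cube (real k + 2 * ?n * real k))"
  proof (rule emeasure_mono)
    show "(\<Union>i. A i) \<subseteq> cube (real k + 2 * ?n * real k)"
    proof
      fix y assume "y \<in> (\<Union>i. A i)"
      then obtain i where i: "i \<in> I" "dist (g i) y \<le> ?n * real (r (g i))" by (auto simp: A_def split: if_splits)
      have gZ: "g i \<in> Z" using gI(1)[OF i(1)] C(2) by blast
      have "r (g i) \<le> k" using r(1)[OF gZ] by simp
      then have d: "norm (y - g i) \<le> ?n * real k"
        using i(2) by (intro order_trans[OF _ mult_left_mono[of "real (r (g i))" "real k" ?n]]) (auto simp: dist_norm norm_minus_commute)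
      have "\<bar>y \<bullet> b\<bar> \<le> (real k + 2 * ?n * real k) / 2" if b: "b \<in> Basis" for b
      proof -
        have "\<bar>g i \<bullet> b\<bar> \<le> real k / 2" using gZ Z(1) b by (auto simp: cube_def)
        moreover have "\<bar>(y - g i) \<bullet> b\<bar> \<le> ?n * real k" using Basis_le_norm[OF b, of "y - g i"] d by linarith
        ultimately show ?thesis by (simp add: inner_diff_left add_divide_distrib)
      qed
      then show "y \<in> cube (real k + 2 * ?n * real k)" by (auto simp: cube_def)
    qed
  qed simp
  finally show ?thesis by (simp add: \<nu> mult_left_mono)
qed

lemma maximal_inequality_finite:
  assumes f: "orbit_measurable f" and k: "k > 0"
  shows "l * emeasure M {\<omega>\<in>space M. \<exists>r\<in>{1..k}. l < eavg (real r) f \<omega>} \<le> ennreal maximal_const * (\<integral>\<^sup>+\<omega>. f \<omega> \<partial>M)"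
proof -
  interpret P: pair_sigma_finite lborel M ..
  let ?n = "real DIM('a)"
  let ?E = "{\<omega>\<in>space M. \<exists>r\<in>{1..k}. l < eavg (real r) f \<omega>}"
  let ?K = "unit_ball_vol ?n * (5 * ?n) ^ DIM('a)"
  let ?L = "real k + 2 * ?n * real k"
  have om: "(\<lambda>(x, \<omega>). eavg (real r) f (S x \<omega>)) \<in> borel_measurable (borel \<Otimes>\<^sub>M M)" for r
    using orbit_measurable_eavg[OF f] by (simp add: orbit_measurable_def)
  have mE: "Measurable.pred (borel \<Otimes>\<^sub>M M) (\<lambda>(x, \<omega>). S x \<omega> \<in> ?E)"
  proof -
    have "Measurable.pred (borel \<Otimes>\<^sub>M M) (\<lambda>p. \<exists>r\<in>{1..k}. l < (case p of (x, \<omega>) \<Rightarrow> eavg (real r) f (S x \<omega>)))"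
      using om by measurable
    then show ?thesis
      by (subst measurable_cong[where g="\<lambda>p. \<exists>r\<in>{1..k}. l < (case p of (x, \<omega>) \<Rightarrow> eavg (real r) f (S x \<omega>))"])
         (auto simp: space_pair_measure S_space)
  qed
  have E: "?E \<in> sets M"
    using orbit_measurable_borel[OF orbit_measurable_eavg[OF f]] by measurable
  have ind: "(\<lambda>(x, \<omega>). indicator ?E (S x \<omega>) * indicator (cube (real k)) x :: ennreal) \<in> borel_measurable (borel \<Otimes>\<^sub>M M)"
  proof -
    have "(\<lambda>p. indicator {p. (case p of (x, \<omega>) \<Rightarrow> S x \<omega> \<in> ?E)} p * indicator (cube (real k)) (fst p) :: ennreal) \<in> borel_measurable (borel \<Otimes>\<^sub>M M)"
      using mE by measurable
    moreover have "(\<lambda>p. indicator {p. (case p of (x, \<omega>) \<Rightarrow> S x \<omega> \<in> ?E)} p * indicator (cube (real k)) (fst p) :: ennreal)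
       = (\<lambda>(x, \<omega>). indicator ?E (S x \<omega>) * indicator (cube (real k)) x)"
      by (auto simp: fun_eq_iff indicator_def)
    ultimately show ?thesis by simp
  qed
  have fm: "(\<lambda>(x, \<omega>). f (S x \<omega>) * indicator (cube ?L) x) \<in> borel_measurable (borel \<Otimes>\<^sub>M M)"
    using f unfolding orbit_measurable_def by (simp add: split_beta') 
  have "l * (ennreal (real k ^ DIM('a)) * emeasure M ?E) = l * (\<integral>\<^sup>+x. emeasure M ?E * indicator (cube (real k)) x \<partial>(lborel :: 'a measure))"
    by (subst nn_integral_cmult_indicator) (simp_all add: emeasure_cube mult.commute)
  also have "(\<integral>\<^sup>+x. emeasure M ?E * indicator (cube (real k)) x \<partial>(lborel :: 'a measure))
      = (\<integral>\<^sup>+x. (\<integral>\<^sup>+\<omega>. indicator ?E (S x \<omega>) * indicator (cube (real k)) x \<partial>M) \<partial>lborel)"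
  proof (intro nn_integral_cong)
    fix x :: 'a
    have "(\<integral>\<^sup>+\<omega>. indicator ?E (S x \<omega>) \<partial>M) = emeasure M ?E"
      using E by (subst nn_integral_S) auto
    moreover have "(\<lambda>\<omega>. indicator ?E (S x \<omega>) :: ennreal) \<in> borel_measurable M"
      using E S_meas[of x] by measurable
    ultimately show "emeasure M ?E * indicator (cube (real k)) x = (\<integral>\<^sup>+\<omega>. indicator ?E (S x \<omega>) * indicator (cube (real k)) x \<partial>M)"
      by (simp add: nn_integral_multc)
  qed
  also have "\<dots> = (\<integral>\<^sup>+\<omega>. (\<integral>\<^sup>+x. indicator ?E (S x \<omega>) * indicator (cube (real k)) x \<partial>lborel) \<partial>M)"
    using P.Fubini[of "\<lambda>(x, \<omega>). indicator ?E (S x \<omega>) * indicator (cube (real k)) x"] ind by (simp add: split_beta' cong: measurable_cong_sets)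
  also have "l * \<dots> = (\<integral>\<^sup>+\<omega>. l * (\<integral>\<^sup>+x. indicator ?E (S x \<omega>) * indicator (cube (real k)) x \<partial>lborel) \<partial>M)"
    using measurable_nn_integral_lborel[OF ind] by (subst nn_integral_cmult) simp_all
  also have "\<dots> \<le> (\<integral>\<^sup>+\<omega>. ennreal ?K * (\<integral>\<^sup>+x. f (S x \<omega>) * indicator (cube ?L) x \<partial>lborel) \<partial>M)"
  proof (intro nn_integral_mono)
    fix \<omega> assume \<omega>: "\<omega> \<in> space M"
    define Z where "Z = {x\<in>cube (real k). S x \<omega> \<in> ?E}"
    have [measurable]: "Measurable.pred borel (\<lambda>x. S x \<omega> \<in> ?E)"
      using measurable_compose[OF measurable_Pair2'[OF \<omega>, of borel] mE] by simp
    have Z: "Z \<in> sets borel" unfolding Z_def by measurable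
    have "(\<integral>\<^sup>+x. indicator ?E (S x \<omega>) * indicator (cube (real k)) x \<partial>lborel) = (\<integral>\<^sup>+x. indicator Z x \<partial>lborel)"
      by (intro nn_integral_cong) (auto simp: Z_def indicator_def)
    also have "\<dots> = emeasure lborel Z" using Z by simp
    finally show "l * (\<integral>\<^sup>+x. indicator ?E (S x \<omega>) * indicator (cube (real k)) x \<partial>lborel)
       \<le> ennreal ?K * (\<integral>\<^sup>+x. f (S x \<omega>) * indicator (cube ?L) x \<partial>lborel)"
      using maximal_covering[OF f \<omega> k _ Z, of l] by (auto simp: Z_def)
  qed
  also have "\<dots> = ennreal ?K * (\<integral>\<^sup>+\<omega>. (\<integral>\<^sup>+x. f (S x \<omega>) * indicator (cube ?L) x \<partial>lborel) \<partial>M)"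
    using measurable_nn_integral_lborel[OF fm] by (subst nn_integral_cmult) simp_all
  also have "(\<integral>\<^sup>+\<omega>. (\<integral>\<^sup>+x. f (S x \<omega>) * indicator (cube ?L) x \<partial>lborel) \<partial>M) = (\<integral>\<^sup>+x. (\<integral>\<^sup>+\<omega>. f (S x \<omega>) * indicator (cube ?L) x \<partial>M) \<partial>lborel)"
    using P.Fubini[of "\<lambda>(x, \<omega>). f (S x \<omega>) * indicator (cube ?L) x"] fm by (simp add: split_beta' cong: measurable_cong_sets)
  also have "\<dots> = (\<integral>\<^sup>+x. (\<integral>\<^sup>+\<omega>. f \<omega> \<partial>M) * indicator (cube ?L) x \<partial>(lborel :: 'a measure))"
    using orbit_measurable_at[OF f] nn_integral_S[OF orbit_measurable_borel[OF f]]
    by (intro nn_integral_cong) (simp add: nn_integral_multc)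
  also have "\<dots> = (\<integral>\<^sup>+\<omega>. f \<omega> \<partial>M) * ennreal (?L ^ DIM('a))"
    by (simp add: nn_integral_cmult emeasure_cube)
  also have "?L ^ DIM('a) = (1 + 2 * ?n) ^ DIM('a) * real k ^ DIM('a)"
    by (simp add: algebra_simps flip: power_mult_distrib)
  also have "ennreal ?K * ((\<integral>\<^sup>+\<omega>. f \<omega> \<partial>M) * ennreal ((1 + 2 * ?n) ^ DIM('a) * real k ^ DIM('a)))
      = ennreal (real k ^ DIM('a)) * (ennreal maximal_const * (\<integral>\<^sup>+\<omega>. f \<omega> \<partial>M))"
  proof -
    have "ennreal ((1 + 2 * ?n) ^ DIM('a) * real k ^ DIM('a)) = ennreal ((1 + 2 * ?n) ^ DIM('a)) * ennreal (real k ^ DIM('a))"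
      by (rule ennreal_mult) auto
    moreover have "ennreal maximal_const = ennreal ?K * ennreal ((1 + 2 * ?n) ^ DIM('a))"
      unfolding maximal_const_def by (rule ennreal_mult) auto
    ultimately show ?thesis by (simp only: mult_ac)
  qed
  finally have "ennreal (real k ^ DIM('a)) * (l * emeasure M ?E)
      \<le> ennreal (real k ^ DIM('a)) * (ennreal maximal_const * (\<integral>\<^sup>+\<omega>. f \<omega> \<partial>M))" by (simp only: mult_ac)
  moreover have "ennreal (real k ^ DIM('a)) \<noteq> 0" "ennreal (real k ^ DIM('a)) \<noteq> \<top>" using k by auto
  ultimately show ?thesis by (simp add: ennreal_mult_le_mult_iff)
qed

theorem maximal_inequality:
  assumes f: "orbit_measurable f"
  shows "l * emeasure M {\<omega>\<in>space M. \<exists>r\<ge>1. l < eavg (real (r::nat)) f \<omega>} \<le> ennreal maximal_const * (\<integral>\<^sup>+\<omega>. f \<omega> \<partial>M)"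
proof -
  let ?E = "\<lambda>k. {\<omega>\<in>space M. \<exists>r\<in>{1..Suc k}. l < eavg (real r) f \<omega>}"
  have E: "?E k \<in> sets M" for k
    using orbit_measurable_borel[OF orbit_measurable_eavg[OF f]] by measurable
  have inc: "incseq ?E" by (rule incseq_SucI) auto
  have "{\<omega>\<in>space M. \<exists>r\<ge>1. l < eavg (real (r::nat)) f \<omega>} = (\<Union>k. ?E k)"
  proof (intro set_eqI iffI)
    fix \<omega> assume "\<omega> \<in> {\<omega>\<in>space M. \<exists>r\<ge>1. l < eavg (real (r::nat)) f \<omega>}"
    then obtain r where "\<omega> \<in> space M" "r \<ge> 1" "l < eavg (real (r::nat)) f \<omega>" by auto
    then have "\<omega> \<in> ?E r" by auto
    then show "\<omega> \<in> (\<Union>k. ?E k)" by blast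
  qed auto
  then have "emeasure M {\<omega>\<in>space M. \<exists>r\<ge>1. l < eavg (real (r::nat)) f \<omega>} = (SUP k. emeasure M (?E k))"
    using SUP_emeasure_incseq[of ?E M] inc E by (simp add: image_subset_iff)
  then have "l * emeasure M {\<omega>\<in>space M. \<exists>r\<ge>1. l < eavg (real (r::nat)) f \<omega>} = (SUP k. l * emeasure M (?E k))"
    by (simp add: SUP_mult_left_ennreal)
  also have "\<dots> \<le> ennreal maximal_const * (\<integral>\<^sup>+\<omega>. f \<omega> \<partial>M)"
    by (intro SUP_least maximal_inequality_finite[OF f]) simp
  finally show ?thesis .
qed

end

definition boundary_ratio :: "'a::euclidean_space itself \<Rightarrow> real \<Rightarrow> real \<Rightarrow> real" where
  "boundary_ratio _ r \<rho> = 2 * ((1 + 2 * \<rho> / r) ^ DIM('a) - 1)"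

lemma boundary_ratio_tendsto: "(\<lambda>N. boundary_ratio TYPE('a::euclidean_space) (real N) \<rho>) \<longlonglongrightarrow> 0"
proof -
  have "(\<lambda>N. 2 * ((1 + (2 * \<rho>) / real N) ^ DIM('a) - 1)) \<longlonglongrightarrow> 2 * ((1 + 0) ^ DIM('a) - 1)"
    by (intro tendsto_intros lim_const_over_n)
  then show ?thesis by (simp add: boundary_ratio_def)
qed

context euclidean_action
begin

definition avg :: "real \<Rightarrow> ('w \<Rightarrow> real) \<Rightarrow> 'w \<Rightarrow> real" where
  "avg r f \<omega> = (\<integral>x. f (S x \<omega>) * indicator (cube r) x \<partial>lborel) / r ^ DIM('a)"

definition bounded_observable :: "real \<Rightarrow> ('w \<Rightarrow> real) \<Rightarrow> bool" where
  "bounded_observable b f \<longleftrightarrow> orbit_measurable f \<and> (\<forall>\<omega>\<in>space M. \<bar>f \<omega>\<bar> \<le> b)"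

lemma bounded_observableD:
  assumes "bounded_observable b f"
  shows "orbit_measurable f" "\<omega> \<in> space M \<Longrightarrow> \<bar>f \<omega>\<bar> \<le> b" "\<omega> \<in> space M \<Longrightarrow> \<bar>f (S x \<omega>)\<bar> \<le> b"
    "f \<in> borel_measurable M" "0 \<le> b"
proof -
  show 1: "orbit_measurable f" "\<omega> \<in> space M \<Longrightarrow> \<bar>f \<omega>\<bar> \<le> b" for \<omega>
    using assms by (auto simp: bounded_observable_def)
  show "\<omega> \<in> space M \<Longrightarrow> \<bar>f (S x \<omega>)\<bar> \<le> b" by (rule 1(2)[OF S_space])
  show "f \<in> borel_measurable M" by (rule orbit_measurable_borel[OF 1(1)])
  obtain \<omega> where "\<omega> \<in> space M" using not_empty by blast
  then show "0 \<le> b" using 1(2)[of \<omega>] by linarith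
qed

lemma bounded_observable_integrable: "bounded_observable b f \<Longrightarrow> integrable M f"
  using bounded_observableD by (intro integrable_const_bound[of _ b]) auto

lemma integrable_lborel_bounded:
  fixes g :: "'a \<Rightarrow> real"
  assumes [measurable]: "g \<in> borel_measurable borel" "A \<in> sets borel" and fin: "emeasure lborel A < \<infinity>"
    and b: "\<And>x. \<bar>g x\<bar> \<le> b"
  shows "integrable lborel (\<lambda>x. g x * indicator A x)"
proof (rule Bochner_Integration.integrable_bound)
  show "integrable lborel (\<lambda>x. b * indicator A x)" using fin by (intro integrable_mult_right integrable_real_indicator) auto
  show "AE x in lborel. norm (g x * indicator A x) \<le> norm (b * indicator A x)"
    using b by (auto simp: indicator_def intro: order_trans[OF _ abs_ge_self])
qed measurable

lemma abs_integral_lborel_bounded: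
  fixes g :: "'a \<Rightarrow> real"
  assumes [measurable]: "g \<in> borel_measurable borel" "A \<in> sets borel" and fin: "emeasure lborel A < \<infinity>"
    and b: "\<And>x. \<bar>g x\<bar> \<le> b"
  shows "\<bar>\<integral>x. g x * indicator A x \<partial>lborel\<bar> \<le> b * measure lborel A"
proof -
  have "\<bar>\<integral>x. g x * indicator A x \<partial>lborel\<bar> \<le> (\<integral>x. \<bar>g x * indicator A x\<bar> \<partial>lborel)" by (rule integral_abs_bound)
  also have "\<dots> \<le> (\<integral>x. b * indicator A x \<partial>lborel)"
  proof (rule integral_mono)
    show "integrable lborel (\<lambda>x. \<bar>g x * indicator A x\<bar>)"
      using integrable_lborel_bounded[OF assms] by simp
    show "integrable lborel (\<lambda>x. b * indicator A x)" using fin by (intro integrable_mult_right integrable_real_indicator) auto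
  qed (use b in \<open>auto simp: indicator_def\<close>)
  also have "\<dots> = b * measure lborel A" by simp
  finally show ?thesis .
qed

lemma abs_integral_diff_bounded:
  fixes g :: "'a \<Rightarrow> real"
  assumes [measurable]: "g \<in> borel_measurable borel" "A \<in> sets borel" "P \<in> sets borel"
    and AP: "A \<subseteq> P" and fin: "emeasure lborel P < \<infinity>" and b: "\<And>x. \<bar>g x\<bar> \<le> b"
  shows "\<bar>(\<integral>x. g x * indicator P x \<partial>lborel) - (\<integral>x. g x * indicator A x \<partial>lborel)\<bar> \<le> b * (measure lborel P - measure lborel A)"
proof -
  have finA: "emeasure lborel A < \<infinity>" and finD: "emeasure lborel (P - A) < \<infinity>"
    using fin emeasure_mono[OF AP, of lborel] emeasure_mono[of "P - A" P lborel] by (auto intro: le_less_trans)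
  have "(\<integral>x. g x * indicator P x \<partial>lborel) - (\<integral>x. g x * indicator A x \<partial>lborel)
      = (\<integral>x. g x * indicator P x - g x * indicator A x \<partial>lborel)"
    by (rule Bochner_Integration.integral_diff[symmetric]; rule integrable_lborel_bounded; fact)
  also have "\<dots> = (\<integral>x. g x * indicator (P - A) x \<partial>lborel)"
    using AP by (intro Bochner_Integration.integral_cong) (auto simp: indicator_def)
  finally have "\<bar>(\<integral>x. g x * indicator P x \<partial>lborel) - (\<integral>x. g x * indicator A x \<partial>lborel)\<bar> \<le> b * measure lborel (P - A)"
    using abs_integral_lborel_bounded[of g "P - A" b] finD b by simp
  also have "measure lborel (P - A) = measure lborel P - measure lborel A"
    using fin AP by (intro measure_Diff) (auto simp: less_top)
  finally show ?thesis .
qed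

lemma orbit_measurable_avg:
  assumes "orbit_measurable f"
  shows "orbit_measurable (avg r f)"
proof -
  note [measurable (raw)] = orbit_measurable_comp2[OF assms]
  have "(\<lambda>(x, \<omega>). (\<integral>y. f (S (y + x) \<omega>) * indicator (cube r) y \<partial>lborel) / r ^ DIM('a))
      \<in> borel_measurable (borel \<Otimes>\<^sub>M M)"
    by measurable
  then show ?thesis unfolding orbit_measurable_def
    by (subst measurable_cong[where g="\<lambda>(x, \<omega>). (\<integral>y. f (S (y + x) \<omega>) * indicator (cube r) y \<partial>lborel) / r ^ DIM('a)"])
       (auto simp: avg_def space_pair_measure S_add)
qed

lemma emeasure_cube_finite: "emeasure lborel (cube r :: 'a set) < \<infinity>"
  unfolding cube_eq_cbox by (rule emeasure_lborel_cbox_finite)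

lemma bounded_observable_path:
  assumes f: "bounded_observable b f" and \<omega>: "\<omega> \<in> space M"
  shows "(\<lambda>x. f (S x \<omega>)) \<in> borel_measurable borel" "\<And>x. \<bar>f (S x \<omega>)\<bar> \<le> b"
  using bounded_observableD[OF f] \<omega> by (auto intro: orbit_measurable_path)

lemma bounded_observable_path_integrable:
  assumes "bounded_observable b f" "\<omega> \<in> space M"
  shows "integrable lborel (\<lambda>x. f (S x \<omega>) * indicator (cube r) x)"
  using bounded_observable_path[OF assms] by (intro integrable_lborel_bounded emeasure_cube_finite) auto

lemma bounded_observable_avg:
  assumes f: "bounded_observable b f" and r: "r > 0"
  shows "bounded_observable b (avg r f)"
proof -
  have "\<bar>avg r f \<omega>\<bar> \<le> b" if \<omega>: "\<omega> \<in> space M" for \<omega>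
  proof -
    have "\<bar>\<integral>x. f (S x \<omega>) * indicator (cube r) x \<partial>lborel\<bar> \<le> b * measure lborel (cube r :: 'a set)"
      using bounded_observable_path[OF f \<omega>] by (intro abs_integral_lborel_bounded emeasure_cube_finite) auto
    then show ?thesis using r by (simp add: avg_def measure_cube abs_divide divide_le_eq)
  qed
  then show ?thesis using orbit_measurable_avg bounded_observableD(1)[OF f] by (simp add: bounded_observable_def)
qed

lemma avg_diff:
  assumes "bounded_observable b f" "bounded_observable c g" "\<omega> \<in> space M"
  shows "avg r (\<lambda>\<omega>. f \<omega> - g \<omega>) \<omega> = avg r f \<omega> - avg r g \<omega>"
  using Bochner_Integration.integral_diff[OF bounded_observable_path_integrable[OF assms(1,3), of r] bounded_observable_path_integrable[OF assms(2,3), of r]]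
  by (simp add: avg_def left_diff_distrib diff_divide_distrib)

lemma avg_mono_abs:
  assumes f: "bounded_observable b f" and \<omega>: "\<omega> \<in> space M" and r: "r > 0"
  shows "\<bar>avg r f \<omega>\<bar> \<le> avg r (\<lambda>\<omega>. \<bar>f \<omega>\<bar>) \<omega>"
proof -
  have "\<bar>\<integral>x. f (S x \<omega>) * indicator (cube r) x \<partial>lborel\<bar> \<le> (\<integral>x. \<bar>f (S x \<omega>) * indicator (cube r) x\<bar> \<partial>lborel)"
    by (rule integral_abs_bound)
  also have "\<dots> = (\<integral>x. \<bar>f (S x \<omega>)\<bar> * indicator (cube r) x \<partial>lborel)"
    by (intro Bochner_Integration.integral_cong) (auto simp: abs_mult)
  finally show ?thesis using r by (simp add: avg_def abs_divide divide_right_mono)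
qed

lemma avg_const: "r > 0 \<Longrightarrow> avg r (\<lambda>_. c) \<omega> = c"
  by (simp add: avg_def measure_cube)

lemma avg_shift_diff:
  assumes f: "bounded_observable b f" and \<omega>: "\<omega> \<in> space M" and r: "r > 0" and \<rho>: "\<rho> \<ge> 0"
    and y: "\<And>e. e \<in> Basis \<Longrightarrow> \<bar>y \<bullet> e\<bar> \<le> \<rho>"
  shows "\<bar>avg r f (S y \<omega>) - avg r f \<omega>\<bar> \<le> b * boundary_ratio TYPE('a) r \<rho>"
proof -
  note [measurable] = bounded_observable_path(1)[OF f \<omega>]
  note bd = bounded_observable_path(2)[OF f \<omega>]
  define P :: "'a set" where "P = cube (r + 2 * \<rho>)"
  define A where "A = {x. x - y \<in> cube r}"
  have [measurable]: "P \<in> sets borel" "A \<in> sets borel" by (auto simp: P_def A_def)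
  have eq: "(\<integral>x. f (S x (S y \<omega>)) * indicator (cube r) x \<partial>lborel) = (\<integral>x. f (S x \<omega>) * indicator A x \<partial>lborel)"
    using integral_lborel_translation[of "\<lambda>x. f (S x \<omega>) * indicator A x" y]
    by (simp add: A_def S_add[OF \<omega>] indicator_def)
  have mA: "measure lborel A = r ^ DIM('a)"
  proof -
    have "(\<integral>x. indicator A (x + y) \<partial>lborel) = measure lborel A"
      using integral_lborel_translation[of "indicator A" y] by simp
    moreover have "indicator A (x + y) = (indicator (cube r) x :: real)" for x by (simp add: A_def indicator_def)
    ultimately show ?thesis using r by (simp add: measure_cube)
  qed
  have sub: "A \<subseteq> P" "cube r \<subseteq> P"
  proof -
    show "cube r \<subseteq> P" using \<rho> by (force simp: P_def cube_def)
    show "A \<subseteq> P"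
    proof
      fix x assume "x \<in> A"
      then have xy: "\<bar>x \<bullet> e - y \<bullet> e\<bar> \<le> r / 2" if "e \<in> Basis" for e using that by (simp add: A_def cube_def inner_diff_left)
      have "\<bar>x \<bullet> e\<bar> \<le> (r + 2 * \<rho>) / 2" if "e \<in> Basis" for e
        using y[OF that] xy[OF that] unfolding add_divide_distrib by linarith
      then show "x \<in> P" by (simp add: P_def cube_def)
    qed
  qed
  have mP: "measure lborel P = (r + 2 * \<rho>) ^ DIM('a)" using r \<rho> by (simp add: P_def measure_cube)
  have finP: "emeasure lborel P < \<infinity>" unfolding P_def by (rule emeasure_cube_finite)
  have d1: "\<bar>(\<integral>x. f (S x \<omega>) * indicator P x \<partial>lborel) - (\<integral>x. f (S x \<omega>) * indicator A x \<partial>lborel)\<bar>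
      \<le> b * ((r + 2 * \<rho>) ^ DIM('a) - r ^ DIM('a))"
    using abs_integral_diff_bounded[of "\<lambda>x. f (S x \<omega>)" A P b] sub finP bd mA mP by simp
  have d2: "\<bar>(\<integral>x. f (S x \<omega>) * indicator P x \<partial>lborel) - (\<integral>x. f (S x \<omega>) * indicator (cube r) x \<partial>lborel)\<bar>
      \<le> b * ((r + 2 * \<rho>) ^ DIM('a) - r ^ DIM('a))"
    using abs_integral_diff_bounded[of "\<lambda>x. f (S x \<omega>)" "cube r" P b] sub finP bd mP r by (simp add: measure_cube)
  have "\<bar>avg r f (S y \<omega>) - avg r f \<omega>\<bar> = \<bar>(\<integral>x. f (S x \<omega>) * indicator A x \<partial>lborel) - (\<integral>x. f (S x \<omega>) * indicator (cube r) x \<partial>lborel)\<bar> / r ^ DIM('a)"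
    using r by (simp add: avg_def eq flip: diff_divide_distrib)
  also have "\<dots> \<le> 2 * (b * ((r + 2 * \<rho>) ^ DIM('a) - r ^ DIM('a))) / r ^ DIM('a)"
    using d1 d2 r by (intro divide_right_mono) (linarith, simp)
  also have "\<dots> = b * (2 * ((r + 2 * \<rho>) ^ DIM('a) / r ^ DIM('a) - 1))"
    using r by (simp add: field_simps)
  also have "(r + 2 * \<rho>) ^ DIM('a) / r ^ DIM('a) = (1 + 2 * \<rho> / r) ^ DIM('a)"
    using r by (simp add: add_divide_distrib flip: power_divide)
  finally show ?thesis by (simp add: boundary_ratio_def)
qed

lemma integrable_pair_bounded:
  fixes g :: "'b \<times> 'c \<Rightarrow> real"
  assumes "sigma_finite_measure N" and [measurable]: "g \<in> borel_measurable (L \<Otimes>\<^sub>M N)" "A \<in> sets L" "B \<in> sets N"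
    and fin: "emeasure L A < \<infinity>" "emeasure N B < \<infinity>"
    and b: "\<And>p. p \<in> space (L \<Otimes>\<^sub>M N) \<Longrightarrow> \<bar>g p\<bar> \<le> b * indicator (A \<times> B) p"
  shows "integrable (L \<Otimes>\<^sub>M N) g"
proof (rule Bochner_Integration.integrable_bound)
  interpret N: sigma_finite_measure N by fact
  have "emeasure (L \<Otimes>\<^sub>M N) (A \<times> B) = emeasure L A * emeasure N B" by (rule N.emeasure_pair_measure_Times) fact+
  then have "emeasure (L \<Otimes>\<^sub>M N) (A \<times> B) < \<infinity>" using fin by (simp add: ennreal_mult_less_top)
  then show "integrable (L \<Otimes>\<^sub>M N) (\<lambda>p. b * indicator (A \<times> B) p)"
    by (intro integrable_mult_right integrable_real_indicator) auto
  show "AE p in L \<Otimes>\<^sub>M N. norm (g p) \<le> norm (b * indicator (A \<times> B) p)"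
    using b by (intro AE_I2) (metis abs_ge_self order_trans real_norm_def)
qed measurable

lemma avg_commute:
  assumes f: "bounded_observable b f" and \<omega>: "\<omega> \<in> space M"
  shows "avg r (avg s f) \<omega> = avg s (avg r f) \<omega>"
proof -
  note om = bounded_observableD(1)[OF f]
  have *: "avg r (avg s f) \<omega> = (\<integral>x. \<integral>y. f (S (x + y) \<omega>) * indicator (cube s) y * indicator (cube r) x \<partial>lborel \<partial>lborel) / s ^ DIM('a) / r ^ DIM('a)" for r s
  proof -
    have "avg s f (S x \<omega>) = (\<integral>y. f (S (x + y) \<omega>) * indicator (cube s) y \<partial>lborel) / s ^ DIM('a)" for x
      unfolding avg_def by (simp add: S_add[OF \<omega>] add.commute[of x])
    then show ?thesis unfolding avg_def[of r] by simp
  qed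
  have int: "integrable (lborel \<Otimes>\<^sub>M lborel) (\<lambda>(x, y). f (S (x + y) \<omega>) * indicator (cube s) y * indicator (cube r) x)"
  proof (rule integrable_pair_bounded)
    show "(\<lambda>(x, y). f (S (x + y) \<omega>) * indicator (cube s) y * indicator (cube r) x) \<in> borel_measurable (lborel \<Otimes>\<^sub>M lborel)"
    proof -
      have [measurable]: "(\<lambda>p. f (S (fst p + snd p) \<omega>)) \<in> borel_measurable (lborel \<Otimes>\<^sub>M lborel)"
        using \<omega> by (intro orbit_measurable_comp2[OF om]) measurable
      show ?thesis unfolding split_beta' by measurable
    qed
    show "emeasure lborel (cube r :: 'a set) < \<infinity>" "emeasure lborel (cube s :: 'a set) < \<infinity>" by (rule emeasure_cube_finite)+
    fix p :: "'a \<times> 'a"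
    show "\<bar>case p of (x, y) \<Rightarrow> f (S (x + y) \<omega>) * indicator (cube s) y * indicator (cube r) x\<bar> \<le> b * indicator (cube r \<times> cube s) p"
      using bounded_observableD(3)[OF f \<omega>] by (auto simp: indicator_def split: prod.split)
  qed (auto intro: lborel.sigma_finite_measure_axioms)
  show ?thesis unfolding *
    using lborel_pair.Fubini_integral[OF int] by (simp add: add.commute mult_ac)
qed

lemma avg_avg_diff:
  assumes f: "bounded_observable b f" and \<omega>: "\<omega> \<in> space M" and r: "r > 0" and s: "s > 0"
  shows "\<bar>avg r (avg s f) \<omega> - avg r f \<omega>\<bar> \<le> b * boundary_ratio TYPE('a) r (s / 2)"
proof -
  let ?\<delta> = "b * boundary_ratio TYPE('a) r (s / 2)"
  note ar = bounded_observable_avg[OF f r]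
  have "\<bar>avg r f (S y \<omega>) - avg r f \<omega>\<bar> \<le> ?\<delta>" if "y \<in> cube s" for y
    using that s by (intro avg_shift_diff[OF f \<omega> r]) (auto simp: cube_def)
  then have le: "\<bar>(avg r f (S y \<omega>) - avg r f \<omega>) * indicator (cube s) y\<bar> \<le> ?\<delta> * indicator (cube s) y" for y
    by (simp add: indicator_def)
  have int: "integrable lborel (\<lambda>y. (avg r f (S y \<omega>) - avg r f \<omega>) * indicator (cube s) y)"
    using bounded_observable_path_integrable[OF ar \<omega>, of s] emeasure_cube_finite[of s]
    by (simp add: left_diff_distrib)
  have "avg r (avg s f) \<omega> - avg r f \<omega> = avg s (avg r f) \<omega> - avg s (\<lambda>_. avg r f \<omega>) \<omega>"
    by (simp add: avg_commute[OF f \<omega>, of r s] avg_const[OF s])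
  also have "\<dots> = (\<integral>y. (avg r f (S y \<omega>) - avg r f \<omega>) * indicator (cube s) y \<partial>lborel) / s ^ DIM('a)"
    using Bochner_Integration.integral_diff[OF bounded_observable_path_integrable[OF ar \<omega>, of s], of "\<lambda>y. avg r f \<omega> * indicator (cube s) y"]
      emeasure_cube_finite[of s]
    by (simp add: avg_def[of s] left_diff_distrib diff_divide_distrib)
  finally have eq: "avg r (avg s f) \<omega> - avg r f \<omega> = (\<integral>y. (avg r f (S y \<omega>) - avg r f \<omega>) * indicator (cube s) y \<partial>lborel) / s ^ DIM('a)" .
  have "\<bar>\<integral>y. (avg r f (S y \<omega>) - avg r f \<omega>) * indicator (cube s) y \<partial>lborel\<bar>
      \<le> (\<integral>y. \<bar>(avg r f (S y \<omega>) - avg r f \<omega>) * indicator (cube s) y\<bar> \<partial>lborel)" by (rule integral_abs_bound)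
  also have "\<dots> \<le> (\<integral>y. ?\<delta> * indicator (cube s) y \<partial>(lborel :: 'a measure))"
    using int le emeasure_cube_finite[of s] by (intro integral_mono) auto
  also have "\<dots> = ?\<delta> * s ^ DIM('a)" using s by (simp add: measure_cube)
  finally show ?thesis using s by (simp add: eq abs_divide divide_le_eq)
qed

lemma expectation_S:
  assumes [measurable]: "f \<in> borel_measurable M"
  shows "expectation (\<lambda>\<omega>. f (S x \<omega>)) = (expectation f :: real)"
  using integral_distr[OF S_meas, of f x] S_pres[of x] by simp

lemma expectation_avg:
  assumes f: "bounded_observable b f" and r: "r > 0"
  shows "expectation (avg r f) = expectation f"
proof -
  interpret P: pair_sigma_finite "lborel :: 'a measure" M ..
  note om = bounded_observableD(1)[OF f]
  have int: "integrable (lborel \<Otimes>\<^sub>M M) (\<lambda>(x, \<omega>). f (S x \<omega>) * indicator (cube r) x)"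
  proof (rule integrable_pair_bounded)
    show "(\<lambda>(x, \<omega>). f (S x \<omega>) * indicator (cube r) x) \<in> borel_measurable (lborel \<Otimes>\<^sub>M M)"
    proof -
      have [measurable]: "(\<lambda>p. f (S (fst p) (snd p))) \<in> borel_measurable (lborel \<Otimes>\<^sub>M M)"
        by (intro orbit_measurable_comp2[OF om]) measurable
      show ?thesis unfolding split_beta' by measurable
    qed
    show "emeasure lborel (cube r :: 'a set) < \<infinity>" by (rule emeasure_cube_finite)
    fix p :: "'a \<times> 'w" assume "p \<in> space (lborel \<Otimes>\<^sub>M M)"
    then show "\<bar>case p of (x, \<omega>) \<Rightarrow> f (S x \<omega>) * indicator (cube r) x\<bar> \<le> b * indicator (cube r \<times> space M) p"
      using bounded_observableD(3)[OF f] by (auto simp: indicator_def space_pair_measure split: prod.split)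
  qed (auto intro: sigma_finite_measure_axioms simp: emeasure_space_1)
  have "expectation (avg r f) = (\<integral>\<omega>. \<integral>x. f (S x \<omega>) * indicator (cube r) x \<partial>lborel \<partial>M) / r ^ DIM('a)"
    by (simp add: avg_def[abs_def])
  also have "(\<integral>\<omega>. \<integral>x. f (S x \<omega>) * indicator (cube r) x \<partial>lborel \<partial>M) = (\<integral>x. \<integral>\<omega>. f (S x \<omega>) * indicator (cube r) x \<partial>M \<partial>lborel)"
    by (rule P.Fubini_integral[OF int])
  also have "\<dots> = (\<integral>x. expectation f * indicator (cube r) x \<partial>(lborel :: 'a measure))"
    using expectation_S[OF bounded_observableD(4)[OF f]] by simp
  also have "\<dots> = expectation f * r ^ DIM('a)" using r by (simp add: measure_cube)
  finally show ?thesis using r by simp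
qed

lemma bounded_observable_square:
  assumes "bounded_observable b f"
  shows "bounded_observable (b\<^sup>2) (\<lambda>\<omega>. (f \<omega>)\<^sup>2)"
  unfolding bounded_observable_def
proof (intro conjI ballI)
  show "orbit_measurable (\<lambda>\<omega>. (f \<omega>)\<^sup>2)"
    by (rule orbit_measurable_compose[OF bounded_observableD(1)[OF assms]]) simp
  fix \<omega>' assume "\<omega>' \<in> space M"
  then show "\<bar>(f \<omega>')\<^sup>2\<bar> \<le> b\<^sup>2"
    using power_mono[OF bounded_observableD(2)[OF assms] abs_ge_zero, of \<omega>' 2] by simp
qed

lemma avg_square_le:
  assumes f: "bounded_observable b f" and r: "r > 0" and \<omega>: "\<omega> \<in> space M"
  shows "(avg r f \<omega>)\<^sup>2 \<le> avg r (\<lambda>\<omega>. (f \<omega>)\<^sup>2) \<omega>"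
proof -
  let ?a = "avg r f \<omega>" and ?i = "\<lambda>x. indicator (cube r :: 'a set) x :: real"
  note f2 = bounded_observable_square[OF f]
  note i1 = bounded_observable_path_integrable[OF f \<omega>, of r]
  note i2 = bounded_observable_path_integrable[OF f2 \<omega>, of r]
  have i3: "integrable lborel (\<lambda>x. ?a\<^sup>2 * ?i x)" using emeasure_cube_finite[of r] by simp
  have "0 \<le> (\<integral>x. (f (S x \<omega>) - ?a)\<^sup>2 * ?i x \<partial>lborel)" by (intro integral_nonneg_AE) auto
  also have "\<dots> = (\<integral>x. (f (S x \<omega>))\<^sup>2 * ?i x - 2 * ?a * (f (S x \<omega>) * ?i x) + ?a\<^sup>2 * ?i x \<partial>lborel)"
    by (intro Bochner_Integration.integral_cong) (auto simp: power2_eq_square algebra_simps)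
  also have "\<dots> = (\<integral>x. (f (S x \<omega>))\<^sup>2 * ?i x \<partial>lborel) - 2 * ?a * (\<integral>x. f (S x \<omega>) * ?i x \<partial>lborel) + ?a\<^sup>2 * r ^ DIM('a)"
    using i1 i2 i3 r by (simp add: measure_cube)
  also have "(\<integral>x. (f (S x \<omega>))\<^sup>2 * ?i x \<partial>lborel) = avg r (\<lambda>\<omega>. (f \<omega>)\<^sup>2) \<omega> * r ^ DIM('a)"
    using r by (simp add: avg_def)
  also have "(\<integral>x. f (S x \<omega>) * ?i x \<partial>lborel) = ?a * r ^ DIM('a)" using r by (simp add: avg_def)
  finally have "0 \<le> (avg r (\<lambda>\<omega>. (f \<omega>)\<^sup>2) \<omega> - ?a\<^sup>2) * r ^ DIM('a)" by (simp add: power2_eq_square algebra_simps)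
  then show ?thesis using zero_less_power[OF r, of "DIM('a)"] by (auto simp: zero_le_mult_iff)
qed

lemma orbit_measurable_linear:
  assumes "orbit_measurable f" "orbit_measurable g"
  shows "orbit_measurable (\<lambda>\<omega>. c * f \<omega> + d * g \<omega> :: real)"
proof -
  have [measurable]: "(\<lambda>p. f (S (fst p) (snd p))) \<in> borel_measurable (borel \<Otimes>\<^sub>M M)"
      "(\<lambda>p. g (S (fst p) (snd p))) \<in> borel_measurable (borel \<Otimes>\<^sub>M M)"
    using assms by (simp_all add: orbit_measurable_def split_beta')
  show ?thesis unfolding orbit_measurable_def split_beta' by measurable
qed

lemma bounded_observable_linear:
  assumes "bounded_observable b f" "bounded_observable b' g"
  shows "bounded_observable (\<bar>c\<bar> * b + \<bar>d\<bar> * b') (\<lambda>\<omega>. c * f \<omega> + d * g \<omega>)"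
  unfolding bounded_observable_def
proof (intro conjI ballI)
  show "orbit_measurable (\<lambda>\<omega>. c * f \<omega> + d * g \<omega>)"
    by (intro orbit_measurable_linear bounded_observableD(1)[OF assms(1)] bounded_observableD(1)[OF assms(2)])
  fix \<omega> assume "\<omega> \<in> space M"
  then have "\<bar>c\<bar> * \<bar>f \<omega>\<bar> \<le> \<bar>c\<bar> * b" "\<bar>d\<bar> * \<bar>g \<omega>\<bar> \<le> \<bar>d\<bar> * b'"
    using bounded_observableD(2)[OF assms(1)] bounded_observableD(2)[OF assms(2)] by (auto intro: mult_left_mono)
  then show "\<bar>c * f \<omega> + d * g \<omega>\<bar> \<le> \<bar>c\<bar> * b + \<bar>d\<bar> * b'"
    using abs_triangle_ineq[of "c * f \<omega>" "d * g \<omega>"] by (simp add: abs_mult)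
qed

lemma avg_linear:
  assumes "bounded_observable b f" "bounded_observable b' g" "\<omega> \<in> space M"
  shows "avg r (\<lambda>\<omega>. c * f \<omega> + d * g \<omega>) \<omega> = c * avg r f \<omega> + d * avg r g \<omega>"
proof -
  note i = bounded_observable_path_integrable[OF assms(1,3), of r] bounded_observable_path_integrable[OF assms(2,3), of r]
  have "(\<integral>x. (c * f (S x \<omega>) + d * g (S x \<omega>)) * indicator (cube r) x \<partial>lborel)
     = (\<integral>x. c * (f (S x \<omega>) * indicator (cube r) x) + d * (g (S x \<omega>) * indicator (cube r) x) \<partial>lborel)"
    by (intro Bochner_Integration.integral_cong) (auto simp: algebra_simps)
  also have "\<dots> = c * (\<integral>x. f (S x \<omega>) * indicator (cube r) x \<partial>lborel) + d * (\<integral>x. g (S x \<omega>) * indicator (cube r) x \<partial>lborel)"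
    using i by simp
  finally show ?thesis by (simp add: avg_def add_divide_distrib)
qed

lemma expectation_square_avg_le:
  assumes f: "bounded_observable b f" and r: "r > 0"
  shows "expectation (\<lambda>\<omega>. (avg r f \<omega>)\<^sup>2) \<le> expectation (\<lambda>\<omega>. (f \<omega>)\<^sup>2)"
proof -
  note f2 = bounded_observable_square[OF f]
  have "expectation (\<lambda>\<omega>. (avg r f \<omega>)\<^sup>2) \<le> expectation (avg r (\<lambda>\<omega>. (f \<omega>)\<^sup>2))"
    using avg_square_le[OF f r] 
    by (intro integral_mono_AE bounded_observable_integrable[OF bounded_observable_square[OF bounded_observable_avg[OF f r]]]
       bounded_observable_integrable[OF bounded_observable_avg[OF f2 r]]) auto
  then show ?thesis by (simp add: expectation_avg[OF f2 r])
qed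

definition energy :: "('w \<Rightarrow> real) \<Rightarrow> nat \<Rightarrow> real" where
  "energy f N = expectation (\<lambda>\<omega>. (avg (real N) f \<omega>)\<^sup>2)"

definition min_energy :: "('w \<Rightarrow> real) \<Rightarrow> real" where
  "min_energy f = (INF N\<in>{1..}. energy f N)"

lemma bdd_below_energy: "bdd_below (energy f ` {1..})"
  by (auto simp: energy_def intro!: bdd_belowI[of _ 0] integral_nonneg_AE)

lemma min_energy_le: "N \<ge> 1 \<Longrightarrow> min_energy f \<le> energy f N"
  unfolding min_energy_def
  by (rule cINF_lower[OF bdd_below_energy]) simp

text \<open>Averaging over a much larger cube forgets the previous averaging, so averages of averages have
  asymptotically the same energy as plain averages.\<close>

lemma energy_le_combination:
  assumes f: "bounded_observable b f" and K: "K \<ge> 1" and L: "L \<ge> 1" and N: "N \<ge> 1"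
  shows "energy f N - 2 * b * (b * (boundary_ratio TYPE('a) (real N) (real K / 2) + boundary_ratio TYPE('a) (real N) (real L / 2)) / 2)
    \<le> expectation (\<lambda>\<omega>. (1/2 * avg (real K) f \<omega> + 1/2 * avg (real L) f \<omega>)\<^sup>2)"
proof -
  let ?u = "\<lambda>\<omega>. 1/2 * avg (real K) f \<omega> + 1/2 * avg (real L) f \<omega>"
  let ?e = "b * (boundary_ratio TYPE('a) (real N) (real K / 2) + boundary_ratio TYPE('a) (real N) (real L / 2)) / 2"
  have pos: "real K > 0" "real L > 0" "real N > 0" using K L N by auto
  note aK = bounded_observable_avg[OF f pos(1)] and aL = bounded_observable_avg[OF f pos(2)] and aN = bounded_observable_avg[OF f pos(3)]
  have u: "bounded_observable b ?u" using bounded_observable_linear[OF aK aL, of "1/2" "1/2"] by simp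
  note au = bounded_observable_avg[OF u pos(3)]
  have "(avg (real N) f \<omega>)\<^sup>2 - 2 * b * ?e \<le> (avg (real N) ?u \<omega>)\<^sup>2" if \<omega>: "\<omega> \<in> space M" for \<omega>
  proof -
    let ?x = "avg (real N) f \<omega>" and ?y = "avg (real N) ?u \<omega>"
    have "?y = 1/2 * avg (real N) (avg (real K) f) \<omega> + 1/2 * avg (real N) (avg (real L) f) \<omega>"
      by (rule avg_linear[OF aK aL \<omega>])
    moreover have "?e = b * boundary_ratio TYPE('a) (real N) (real K / 2) / 2 + b * boundary_ratio TYPE('a) (real N) (real L / 2) / 2"
      by (simp add: distrib_left add_divide_distrib)
    ultimately have xy: "\<bar>?y - ?x\<bar> \<le> ?e"
      using avg_avg_diff[OF f \<omega> pos(3,1)] avg_avg_diff[OF f \<omega> pos(3,2)] by linarith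
    have "?x\<^sup>2 - ?y\<^sup>2 = (?x + ?y) * (?x - ?y)" by (simp add: power2_eq_square algebra_simps)
    also have "\<dots> \<le> \<bar>?x + ?y\<bar> * \<bar>?x - ?y\<bar>" unfolding abs_mult[symmetric] by (rule abs_ge_self)
    also have "\<dots> \<le> (2 * b) * ?e"
      using xy bounded_observableD(2)[OF aN \<omega>] bounded_observableD(2)[OF au \<omega>]
      by (intro mult_mono) (auto simp: abs_minus_commute)
    finally show ?thesis by linarith
  qed
  then have "expectation (\<lambda>\<omega>. (avg (real N) f \<omega>)\<^sup>2 - 2 * b * ?e) \<le> expectation (\<lambda>\<omega>. (avg (real N) ?u \<omega>)\<^sup>2)"
    using bounded_observable_integrable[OF bounded_observable_square[OF aN]] bounded_observable_integrable[OF bounded_observable_square[OF au]]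
    by (intro integral_mono_AE) auto
  also have "\<dots> \<le> expectation (\<lambda>\<omega>. (?u \<omega>)\<^sup>2)" by (rule expectation_square_avg_le[OF u pos(3)])
  also have "expectation (\<lambda>\<omega>. (avg (real N) f \<omega>)\<^sup>2 - 2 * b * ?e) = energy f N - 2 * b * ?e"
    using bounded_observable_integrable[OF bounded_observable_square[OF aN]] by (simp add: energy_def prob_space)
  finally show ?thesis .
qed

lemma boundary_error_tendsto:
  "(\<lambda>N. 2 * b * (b * (boundary_ratio TYPE('a) (real N) k + boundary_ratio TYPE('a) (real N) l) / 2)) \<longlonglongrightarrow> 0"
proof -
  have "(\<lambda>N. 2 * b * (b * (boundary_ratio TYPE('a) (real N) k + boundary_ratio TYPE('a) (real N) l) / 2)) \<longlonglongrightarrow> 2 * b * (b * (0 + 0) / 2)"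
    by (intro tendsto_intros boundary_ratio_tendsto) simp
  then show ?thesis by simp
qed

lemma min_energy_le_combination:
  assumes f: "bounded_observable b f" and K: "K \<ge> 1" and L: "L \<ge> 1"
  shows "min_energy f \<le> expectation (\<lambda>\<omega>. (1/2 * avg (real K) f \<omega> + 1/2 * avg (real L) f \<omega>)\<^sup>2)"
proof -
  let ?err = "\<lambda>N. 2 * b * (b * (boundary_ratio TYPE('a) (real N) (real K / 2) + boundary_ratio TYPE('a) (real N) (real L / 2)) / 2)"
  have "(\<lambda>N. min_energy f - ?err N) \<longlonglongrightarrow> min_energy f - 0"
    by (intro tendsto_diff tendsto_const boundary_error_tendsto)
  moreover have "eventually (\<lambda>N. min_energy f - ?err N \<le> expectation (\<lambda>\<omega>. (1/2 * avg (real K) f \<omega> + 1/2 * avg (real L) f \<omega>)\<^sup>2)) sequentially"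
    using eventually_ge_at_top[of 1]
  proof eventually_elim
    case (elim N)
    then show ?case using energy_le_combination[OF f K L elim] min_energy_le[OF elim, of f] by linarith
  qed
  ultimately show ?thesis by (intro tendsto_upperbound[where F=sequentially]) auto
qed

lemma energy_near_min:
  assumes f: "bounded_observable b f" and e: "e > 0"
  shows "\<exists>N0. \<forall>N\<ge>N0. energy f N < min_energy f + e"
proof -
  have "\<exists>K\<in>{1..}. energy f K < min_energy f + e / 2"
    using cINF_less_iff[OF _ bdd_below_energy, of f "min_energy f + e/2"] e
    unfolding min_energy_def by simp
  then obtain K where K: "K \<ge> 1" "energy f K < min_energy f + e / 2" by auto
  let ?err = "\<lambda>N. 2 * b * (b * (boundary_ratio TYPE('a) (real N) (real K / 2) + boundary_ratio TYPE('a) (real N) (real K / 2)) / 2)"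
  have "eventually (\<lambda>N. ?err N < e / 2) sequentially"
    by (rule order_tendstoD(2)[OF boundary_error_tendsto]) (use e in simp)
  then have "eventually (\<lambda>N. energy f N < min_energy f + e) sequentially"
    using eventually_ge_at_top[of 1]
  proof eventually_elim
    case (elim N)
    have "expectation (\<lambda>\<omega>. (1/2 * avg (real K) f \<omega> + 1/2 * avg (real K) f \<omega>)\<^sup>2) = energy f K"
      unfolding energy_def by (rule arg_cong[where f=expectation]) (auto simp: fun_eq_iff)
    then show ?case using energy_le_combination[OF f K(1) K(1) elim(2)] elim(1) K(2) by linarith
  qed
  then show ?thesis by (simp add: eventually_sequentially)
qed

lemma expectation_abs_diff_le:
  assumes f: "bounded_observable b f" and K: "K \<ge> 1" and L: "L \<ge> 1" and c: "c > 0"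
    and eK: "energy f K < min_energy f + c\<^sup>2 / 4" and eL: "energy f L < min_energy f + c\<^sup>2 / 4"
  shows "expectation (\<lambda>\<omega>. \<bar>avg (real K) f \<omega> - avg (real L) f \<omega>\<bar>) \<le> c"
proof -
  let ?x = "avg (real K) f" and ?y = "avg (real L) f"
  have pos: "real K > 0" "real L > 0" using K L by auto
  note aK = bounded_observable_avg[OF f pos(1)] and aL = bounded_observable_avg[OF f pos(2)]
  note iK = bounded_observable_integrable[OF bounded_observable_square[OF aK]]
  note iL = bounded_observable_integrable[OF bounded_observable_square[OF aL]]
  have u: "bounded_observable b (\<lambda>\<omega>. 1/2 * ?x \<omega> + 1/2 * ?y \<omega>)" using bounded_observable_linear[OF aK aL, of "1/2" "1/2"] by simp
  note iu = bounded_observable_integrable[OF bounded_observable_square[OF u]]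
  have v: "bounded_observable (2 * b) (\<lambda>\<omega>. ?x \<omega> - ?y \<omega>)" using bounded_observable_linear[OF aK aL, of 1 "-1"] by simp
  note iv = bounded_observable_integrable[OF bounded_observable_square[OF v]]
  have "expectation (\<lambda>\<omega>. (?x \<omega> - ?y \<omega>)\<^sup>2) = expectation (\<lambda>\<omega>. 2 * (?x \<omega>)\<^sup>2 + 2 * (?y \<omega>)\<^sup>2 - 4 * (1/2 * ?x \<omega> + 1/2 * ?y \<omega>)\<^sup>2)"
    by (intro Bochner_Integration.integral_cong) (auto simp: power2_eq_square algebra_simps)
  also have "\<dots> = 2 * energy f K + 2 * energy f L - 4 * expectation (\<lambda>\<omega>. (1/2 * ?x \<omega> + 1/2 * ?y \<omega>)\<^sup>2)"
    using iK iL iu unfolding energy_def by (subst Bochner_Integration.integral_diff) simp_all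
  also have "\<dots> \<le> c\<^sup>2" using eK eL min_energy_le_combination[OF f K L] by linarith
  finally have sq: "expectation (\<lambda>\<omega>. (?x \<omega> - ?y \<omega>)\<^sup>2) \<le> c\<^sup>2" .
  have "expectation (\<lambda>\<omega>. \<bar>?x \<omega> - ?y \<omega>\<bar>) \<le> expectation (\<lambda>\<omega>. (?x \<omega> - ?y \<omega>)\<^sup>2 / (2 * c) + c / 2)"
  proof (rule integral_mono)
    show "integrable M (\<lambda>\<omega>. \<bar>?x \<omega> - ?y \<omega>\<bar>)" using bounded_observable_integrable[OF v] by simp
    show "integrable M (\<lambda>\<omega>. (?x \<omega> - ?y \<omega>)\<^sup>2 / (2 * c) + c / 2)" using iv by simp
    fix \<omega>
    have "0 \<le> (\<bar>?x \<omega> - ?y \<omega>\<bar> - c)\<^sup>2" by simp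
    also have "\<dots> = (?x \<omega> - ?y \<omega>)\<^sup>2 - 2 * c * \<bar>?x \<omega> - ?y \<omega>\<bar> + c\<^sup>2" by (simp add: power2_diff)
    finally have "2 * c * \<bar>?x \<omega> - ?y \<omega>\<bar> \<le> (?x \<omega> - ?y \<omega>)\<^sup>2 + c * c" by (simp add: power2_eq_square)
    then have "\<bar>?x \<omega> - ?y \<omega>\<bar> \<le> ((?x \<omega> - ?y \<omega>)\<^sup>2 + c * c) / (2 * c)" using c by (simp add: pos_le_divide_eq mult.commute)
    then show "\<bar>?x \<omega> - ?y \<omega>\<bar> \<le> (?x \<omega> - ?y \<omega>)\<^sup>2 / (2 * c) + c / 2" using c by (simp add: add_divide_distrib)
  qed
  also have "\<dots> = expectation (\<lambda>\<omega>. (?x \<omega> - ?y \<omega>)\<^sup>2) / (2 * c) + c / 2" using iv by (simp add: prob_space)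
  also have "\<dots> \<le> c\<^sup>2 / (2 * c) + c / 2" using sq c by (intro add_right_mono divide_right_mono) auto
  also have "\<dots> = c" using c by (simp add: power2_eq_square)
  finally show ?thesis .
qed

lemma fast_subsequence:
  assumes f: "bounded_observable b f"
  obtains K :: "nat \<Rightarrow> nat" where "\<And>j. K j \<ge> Suc j"
    "\<And>j. expectation (\<lambda>\<omega>. \<bar>avg (real (K (Suc j))) f \<omega> - avg (real (K j)) f \<omega>\<bar>) \<le> (1/2) ^ j"
proof -
  have "\<exists>N0. \<forall>N\<ge>N0. energy f N < min_energy f + ((1/2) ^ j)\<^sup>2 / 4" for j :: nat
    by (rule energy_near_min[OF f]) simp
  then obtain N0 where N0: "\<And>j N. N \<ge> N0 j \<Longrightarrow> energy f N < min_energy f + ((1/2) ^ j)\<^sup>2 / 4" by metis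
  define K where "K j = max (Suc j) (max (N0 j) (N0 (j - 1)))" for j
  have "expectation (\<lambda>\<omega>. \<bar>avg (real (K (Suc j))) f \<omega> - avg (real (K j)) f \<omega>\<bar>) \<le> (1/2) ^ j" for j
    by (rule expectation_abs_diff_le[OF f]; (rule N0)?) (auto simp: K_def)
  then show ?thesis using that[of K] by (simp add: K_def)
qed

lemma AE_convergent_summable:
  fixes X :: "nat \<Rightarrow> 'w \<Rightarrow> real"
  assumes int: "\<And>j. integrable M (X j)" and le: "\<And>j. expectation (\<lambda>\<omega>. \<bar>X (Suc j) \<omega> - X j \<omega>\<bar>) \<le> (1/2) ^ j"
  shows "AE \<omega> in M. convergent (\<lambda>j. X j \<omega>)"
proof -
  have [measurable]: "X j \<in> borel_measurable M" for j using int[of j] by simp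
  have "(\<integral>\<^sup>+\<omega>. (\<Sum>j. ennreal \<bar>X (Suc j) \<omega> - X j \<omega>\<bar>) \<partial>M) = (\<Sum>j. \<integral>\<^sup>+\<omega>. ennreal \<bar>X (Suc j) \<omega> - X j \<omega>\<bar> \<partial>M)"
    by (rule nn_integral_suminf) measurable
  also have "\<dots> \<le> (\<Sum>j. ennreal ((1/2) ^ j))"
  proof (intro suminf_le)
    fix j
    have "(\<integral>\<^sup>+\<omega>. ennreal \<bar>X (Suc j) \<omega> - X j \<omega>\<bar> \<partial>M) = ennreal (expectation (\<lambda>\<omega>. \<bar>X (Suc j) \<omega> - X j \<omega>\<bar>))"
      using int by (intro nn_integral_eq_integral) auto
    also have "\<dots> \<le> ennreal ((1/2) ^ j)" by (rule ennreal_leI[OF le])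
    finally show "(\<integral>\<^sup>+\<omega>. ennreal \<bar>X (Suc j) \<omega> - X j \<omega>\<bar> \<partial>M) \<le> ennreal ((1/2) ^ j)" .
  qed auto
  also have "\<dots> < \<top>"
    unfolding less_top[symmetric] by (intro ennreal_suminf_neq_top summable_geometric) simp_all
  finally have "(\<integral>\<^sup>+\<omega>. (\<Sum>j. ennreal \<bar>X (Suc j) \<omega> - X j \<omega>\<bar>) \<partial>M) \<noteq> \<infinity>" by simp
  then have "AE \<omega> in M. (\<Sum>j. ennreal \<bar>X (Suc j) \<omega> - X j \<omega>\<bar>) \<noteq> \<infinity>"
    by (intro nn_integral_noteq_infinite) measurable
  then show ?thesis
  proof eventually_elim
    case (elim \<omega>)
    then have "summable (\<lambda>j. \<bar>X (Suc j) \<omega> - X j \<omega>\<bar>)" by (intro summable_suminf_not_top) auto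
    then have "summable (\<lambda>j. X (Suc j) \<omega> - X j \<omega>)" by (rule summable_rabs_cancel)
    then have "convergent (\<lambda>n. \<Sum>j<n. X (Suc j) \<omega> - X j \<omega>)" by (simp add: summable_iff_convergent)
    then have "convergent (\<lambda>n. X n \<omega> - X 0 \<omega>)" unfolding sum_lessThan_telescope[of "\<lambda>n. X n \<omega>"] .
    then show ?case using convergent_diff_const_right_iff[of "\<lambda>n. X n \<omega>" "X 0 \<omega>"] by simp
  qed
qed

lemma limsup_avg_shift:
  assumes f: "bounded_observable b f" and \<omega>: "\<omega> \<in> space M" and K: "\<And>j. K j \<ge> Suc j"
  shows "limsup (\<lambda>j. ereal (avg (real (K j)) f (S y \<omega>))) = limsup (\<lambda>j. ereal (avg (real (K j)) f \<omega>))"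
proof -
  have filt: "filterlim K at_top sequentially"
    unfolding filterlim_at_top eventually_sequentially using K by (meson Suc_le_D le_trans order_trans Suc_leD)
  have "(\<lambda>j. b * boundary_ratio TYPE('a) (real (K j)) (norm y)) \<longlonglongrightarrow> b * 0"
    by (intro tendsto_intros filterlim_compose[OF boundary_ratio_tendsto filt])
  then have lim0: "(\<lambda>j. b * boundary_ratio TYPE('a) (real (K j)) (norm y)) \<longlonglongrightarrow> 0" by simp
  have "(\<lambda>j. avg (real (K j)) f (S y \<omega>) - avg (real (K j)) f \<omega>) \<longlonglongrightarrow> 0"
  proof (rule Lim_null_comparison[OF _ lim0])
    show "eventually (\<lambda>j. norm (avg (real (K j)) f (S y \<omega>) - avg (real (K j)) f \<omega>)
        \<le> b * boundary_ratio TYPE('a) (real (K j)) (norm y)) sequentially"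
    proof (intro always_eventually allI)
      fix j
      have "real (K j) > 0" using K[of j] by simp
      then show "norm (avg (real (K j)) f (S y \<omega>) - avg (real (K j)) f \<omega>) \<le> b * boundary_ratio TYPE('a) (real (K j)) (norm y)"
        using avg_shift_diff[OF f \<omega>, of "real (K j)" "norm y" y] by (simp add: Basis_le_norm)
    qed
  qed
  then have "(\<lambda>j. ereal (avg (real (K j)) f (S y \<omega>) - avg (real (K j)) f \<omega>)) \<longlonglongrightarrow> ereal 0"
    by (simp only: lim_ereal)
  then have "limsup (\<lambda>j. ereal (avg (real (K j)) f (S y \<omega>) - avg (real (K j)) f \<omega>) + ereal (avg (real (K j)) f \<omega>))
      = ereal 0 + limsup (\<lambda>j. ereal (avg (real (K j)) f \<omega>))"
    by (rule ereal_limsup_lim_add) simp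
  then show ?thesis by simp
qed

end

locale ergodic_euclidean_action = euclidean_action M S
  for M :: "'w measure" and S :: "'a::euclidean_space \<Rightarrow> 'w \<Rightarrow> 'w" +
  assumes ergodic: "B \<in> sets M \<Longrightarrow> (\<And>x. S x -` B \<inter> space M = B) \<Longrightarrow> prob B = 0 \<or> prob B = 1"
begin

lemma avg_limit_eq_expectation:
  assumes f: "bounded_observable b f"
    and K: "\<And>j. K j \<ge> Suc j" and conv: "AE \<omega> in M. convergent (\<lambda>j. avg (real (K j)) f \<omega>)"
  shows "AE \<omega> in M. (\<lambda>j. avg (real (K j)) f \<omega>) \<longlonglongrightarrow> expectation f"
proof -
  have pos: "real (K j) > 0" for j using K[of j] by simp
  note a = bounded_observable_avg[OF f pos]
  note [measurable] = bounded_observableD(4)[OF a]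
  define h where "h \<omega> = limsup (\<lambda>j. ereal (avg (real (K j)) f \<omega>))" for \<omega>
  define g where "g \<omega> = real_of_ereal (h \<omega>)" for \<omega>
  have [measurable]: "h \<in> borel_measurable M" unfolding h_def by measurable
  have [measurable]: "g \<in> borel_measurable M" unfolding g_def by measurable
  have lim: "AE \<omega> in M. h \<omega> = ereal (g \<omega>) \<and> (\<lambda>j. avg (real (K j)) f \<omega>) \<longlonglongrightarrow> g \<omega>"
    using conv
  proof eventually_elim
    case (elim \<omega>)
    then obtain c where c: "(\<lambda>j. avg (real (K j)) f \<omega>) \<longlonglongrightarrow> c" by (auto simp: convergent_def)
    then have "(\<lambda>j. ereal (avg (real (K j)) f \<omega>)) \<longlonglongrightarrow> ereal c" by simp
    then have "h \<omega> = ereal c" unfolding h_def by (rule lim_imp_Limsup[OF trivial_limit_sequentially])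
    then show ?case using c by (simp add: g_def)
  qed
  have dc: "integrable M g" "(\<lambda>j. expectation (avg (real (K j)) f)) \<longlonglongrightarrow> expectation g"
  proof -
    have bd: "AE \<omega> in M. norm (avg (real (K j)) f \<omega>) \<le> b" for j using bounded_observableD(2)[OF a] by auto
    have lm: "AE \<omega> in M. (\<lambda>j. avg (real (K j)) f \<omega>) \<longlonglongrightarrow> g \<omega>" using lim by eventually_elim simp
    show "integrable M g" by (rule integrable_dominated_convergence[OF _ _ _ lm bd]) auto
    show "(\<lambda>j. expectation (avg (real (K j)) f)) \<longlonglongrightarrow> expectation g"
      by (rule integral_dominated_convergence[OF _ _ _ lm bd]) auto
  qed
  have Eg: "expectation g = expectation f"
    using dc(2) expectation_avg[OF f pos] LIMSEQ_unique[OF _ tendsto_const] by simp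
  define B where "B = {\<omega>\<in>space M. ereal (expectation f) < h \<omega>}"
  have [measurable]: "B \<in> sets M" unfolding B_def by measurable
  have "S x -` B \<inter> space M = B" for x
    using limsup_avg_shift[OF f _ K, of _ x] by (auto simp: B_def h_def S_space)
  then have "prob B = 0 \<or> prob B = 1" by (intro ergodic) auto
  then have "(AE \<omega> in M. g \<omega> \<le> expectation f) \<or> (AE \<omega> in M. expectation f \<le> g \<omega>)"
  proof
    assume "prob B = 0"
    then have "AE \<omega> in M. \<omega> \<notin> B" by (simp add: prob_eq_0)
    then have "AE \<omega> in M. g \<omega> \<le> expectation f"
      using lim AE_space by eventually_elim (auto simp: B_def)
    then show ?thesis ..
  next
    assume "prob B = 1"
    then have "AE \<omega> in M. \<omega> \<in> B" by (simp add: prob_eq_1)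
    then have "AE \<omega> in M. expectation f \<le> g \<omega>"
      using lim by eventually_elim (auto simp: B_def)
    then show ?thesis ..
  qed
  then have "AE \<omega> in M. g \<omega> = expectation f"
  proof
    assume "AE \<omega> in M. g \<omega> \<le> expectation f"
    then have nn: "AE \<omega> in M. 0 \<le> expectation f - g \<omega>" by eventually_elim simp
    have "integrable M (\<lambda>\<omega>. expectation f - g \<omega>)" "expectation (\<lambda>\<omega>. expectation f - g \<omega>) = 0"
      using dc(1) by (simp_all add: Eg prob_space)
    then have "AE \<omega> in M. expectation f - g \<omega> = 0" using integral_nonneg_eq_0_iff_AE[OF _ nn] by blast
    then show ?thesis by eventually_elim simp
  next
    assume "AE \<omega> in M. expectation f \<le> g \<omega>"
    then have nn: "AE \<omega> in M. 0 \<le> g \<omega> - expectation f" by eventually_elim simp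
    have "integrable M (\<lambda>\<omega>. g \<omega> - expectation f)" "expectation (\<lambda>\<omega>. g \<omega> - expectation f) = 0"
      using dc(1) by (simp_all add: Eg prob_space)
    then have "AE \<omega> in M. g \<omega> - expectation f = 0" using integral_nonneg_eq_0_iff_AE[OF _ nn] by blast
    then show ?thesis by eventually_elim simp
  qed
  then show ?thesis using lim by eventually_elim simp
qed

lemma mean_ergodic:
  assumes f: "bounded_observable b f" and e: "e > 0"
  shows "\<exists>K::nat\<ge>1. expectation (\<lambda>\<omega>. \<bar>avg (real K) f \<omega> - expectation f\<bar>) < e"
proof -
  obtain K :: "nat \<Rightarrow> nat" where K: "\<And>j. K j \<ge> Suc j"
    "\<And>j. expectation (\<lambda>\<omega>. \<bar>avg (real (K (Suc j))) f \<omega> - avg (real (K j)) f \<omega>\<bar>) \<le> (1/2) ^ j"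
    using fast_subsequence[OF f] by metis
  have pos: "real (K j) > 0" for j using K(1)[of j] by simp
  note a = bounded_observable_avg[OF f pos]
  note [measurable] = bounded_observableD(4)[OF a]
  have "AE \<omega> in M. convergent (\<lambda>j. avg (real (K j)) f \<omega>)"
    by (rule AE_convergent_summable[OF bounded_observable_integrable[OF a] K(2)])
  then have lim: "AE \<omega> in M. (\<lambda>j. avg (real (K j)) f \<omega>) \<longlonglongrightarrow> expectation f"
    by (rule avg_limit_eq_expectation[OF f K(1)])
  have "(\<lambda>j. expectation (\<lambda>\<omega>. \<bar>avg (real (K j)) f \<omega> - expectation f\<bar>)) \<longlonglongrightarrow> expectation (\<lambda>_. 0)"
  proof (rule integral_dominated_convergence[where w="\<lambda>_. b + \<bar>expectation f\<bar>"])
    show "AE \<omega> in M. (\<lambda>j. \<bar>avg (real (K j)) f \<omega> - expectation f\<bar>) \<longlonglongrightarrow> 0"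
      using lim by eventually_elim (simp add: tendsto_rabs_zero_iff LIM_zero)
    show "AE \<omega> in M. norm \<bar>avg (real (K j)) f \<omega> - expectation f\<bar> \<le> b + \<bar>expectation f\<bar>" for j
      using bounded_observableD(2)[OF a, of _ j] by (intro AE_I2) fastforce
  qed measurable
  then have "eventually (\<lambda>j. expectation (\<lambda>\<omega>. \<bar>avg (real (K j)) f \<omega> - expectation f\<bar>) < e) sequentially"
    using e by (intro order_tendstoD(2)[where y=0]) auto
  then obtain j where "expectation (\<lambda>\<omega>. \<bar>avg (real (K j)) f \<omega> - expectation f\<bar>) < e"
    by (auto simp: eventually_sequentially)
  then show ?thesis using K(1)[of j] by (intro exI[of _ "K j"]) auto
qed

lemma eavg_ennreal:
  assumes f: "bounded_observable b f" and nn: "\<And>\<omega>. f \<omega> \<ge> 0" and \<omega>: "\<omega> \<in> space M" and r: "r > 0"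
  shows "eavg r (\<lambda>\<omega>. ennreal (f \<omega>)) \<omega> = ennreal (avg r f \<omega>)"
proof -
  have "(\<integral>\<^sup>+x. ennreal (f (S x \<omega>)) * indicator (cube r) x \<partial>lborel) = (\<integral>\<^sup>+x. ennreal (f (S x \<omega>) * indicator (cube r) x) \<partial>lborel)"
    by (intro nn_integral_cong) (auto simp: indicator_def)
  also have "\<dots> = ennreal (\<integral>x. f (S x \<omega>) * indicator (cube r) x \<partial>lborel)"
    using nn by (intro nn_integral_eq_integral bounded_observable_path_integrable[OF f \<omega>]) auto
  finally show ?thesis using r nn unfolding eavg_def avg_def
    by (simp add: divide_ennreal integral_nonneg_AE)
qed

lemma maximal_const_nonneg: "maximal_const \<ge> 0"
  unfolding maximal_const_def by (intro mult_nonneg_nonneg) auto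

lemma prob_avg_far:
  assumes f: "bounded_observable b f" and l: "l > 0"
  shows "prob {\<omega>\<in>space M. \<forall>n. \<exists>N\<ge>n. l < \<bar>avg (real N) f \<omega> - expectation f\<bar>} = 0"
    (is "prob ?Bad = 0")
proof (rule ccontr)
  assume "prob ?Bad \<noteq> 0"
  then have p: "prob ?Bad > 0" by (simp add: zero_less_measure_iff)
  define C where "C = maximal_const + 1"
  have C: "C > 0" "maximal_const \<le> C" using maximal_const_nonneg by (auto simp: C_def)
  obtain K :: nat where K: "K \<ge> 1" "expectation (\<lambda>\<omega>. \<bar>avg (real K) f \<omega> - expectation f\<bar>) < l / 2 * prob ?Bad / C"
    using mean_ergodic[OF f, of "l / 2 * prob ?Bad / C"] l p C by auto
  have Kpos: "real K > 0" using K by simp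
  note a = bounded_observable_avg[OF f Kpos]
  define f' where "f' = (\<lambda>\<omega>. \<bar>avg (real K) f \<omega> - expectation f\<bar>)"
  define c where "c = b + \<bar>expectation f\<bar>"
  have d': "bounded_observable c (\<lambda>\<omega>. avg (real K) f \<omega> - expectation f)"
    unfolding bounded_observable_def
  proof (intro conjI ballI)
    show "orbit_measurable (\<lambda>\<omega>. avg (real K) f \<omega> - expectation f)"
      by (rule orbit_measurable_compose[OF bounded_observableD(1)[OF a]]) simp
    fix \<omega> assume "\<omega> \<in> space M"
    from bounded_observableD(2)[OF a this] show "\<bar>avg (real K) f \<omega> - expectation f\<bar> \<le> c" unfolding c_def by linarith
  qed
  have f': "bounded_observable c f'"
    unfolding bounded_observable_def f'_def
    using bounded_observableD(2)[OF d'] orbit_measurable_compose[OF bounded_observableD(1)[OF d'], of abs] by simp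
  let ?E = "{\<omega>\<in>space M. \<exists>r\<ge>1. ennreal (l / 2) < eavg (real (r::nat)) (\<lambda>\<omega>. ennreal (f' \<omega>)) \<omega>}"
  have ome: "orbit_measurable (\<lambda>\<omega>. ennreal (f' \<omega>))"
    by (rule orbit_measurable_compose[OF bounded_observableD(1)[OF f']]) simp
  have [measurable]: "eavg (real r) (\<lambda>\<omega>. ennreal (f' \<omega>)) \<in> borel_measurable M" for r :: nat
    by (rule orbit_measurable_borel[OF orbit_measurable_eavg[OF ome]])
  have E: "?E \<in> sets M" by measurable
  have sub: "?Bad \<subseteq> ?E"
  proof
    fix \<omega> assume "\<omega> \<in> ?Bad"
    then have \<omega>: "\<omega> \<in> space M" and bad: "\<And>n. \<exists>N\<ge>n. l < \<bar>avg (real N) f \<omega> - expectation f\<bar>" by auto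
    have "(\<lambda>N. b * boundary_ratio TYPE('a) (real N) (real K / 2)) \<longlonglongrightarrow> b * 0"
      by (intro tendsto_intros boundary_ratio_tendsto)
    then have "eventually (\<lambda>N. b * boundary_ratio TYPE('a) (real N) (real K / 2) < l / 2) sequentially"
      by (rule order_tendstoD(2)) (use l in simp)
    then obtain n where n: "\<And>N. N \<ge> n \<Longrightarrow> b * boundary_ratio TYPE('a) (real N) (real K / 2) < l / 2"
      by (auto simp: eventually_sequentially)
    obtain N where N: "N \<ge> max 1 n" "l < \<bar>avg (real N) f \<omega> - expectation f\<bar>" using bad by blast
    then have Npos: "real N > 0" by simp
    have "avg (real N) (\<lambda>\<omega>. avg (real K) f \<omega> - expectation f) \<omega> = avg (real N) (avg (real K) f) \<omega> - expectation f"
    proof -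
      have "bounded_observable \<bar>expectation f\<bar> (\<lambda>_. expectation f)"
        by (simp add: bounded_observable_def orbit_measurable_def)
      from avg_diff[OF a this \<omega>, of "real N"] show ?thesis by (simp add: avg_const[OF Npos])
    qed
    then have "\<bar>avg (real N) (avg (real K) f) \<omega> - expectation f\<bar> \<le> avg (real N) f' \<omega>"
      using avg_mono_abs[OF d' \<omega> Npos] by (simp add: f'_def)
    moreover have "\<bar>avg (real N) (avg (real K) f) \<omega> - avg (real N) f \<omega>\<bar> < l / 2"
      using avg_avg_diff[OF f \<omega> Npos Kpos] n[of N] N(1) by simp
    ultimately have "l / 2 < avg (real N) f' \<omega>" using N(2) by linarith
    then have "ennreal (l / 2) < eavg (real N) (\<lambda>\<omega>. ennreal (f' \<omega>)) \<omega>"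
      using eavg_ennreal[OF f' _ \<omega> Npos] l by (simp add: f'_def ennreal_less_iff)
    then show "\<omega> \<in> ?E" using \<omega> N(1) by (auto intro!: exI[of _ N])
  qed
  have "ennreal (l / 2 * prob ?E) = ennreal (l / 2) * emeasure M ?E"
    unfolding emeasure_eq_measure using l by (intro ennreal_mult) auto
  also have "\<dots> \<le> ennreal maximal_const * (\<integral>\<^sup>+\<omega>. ennreal (f' \<omega>) \<partial>M)" by (rule maximal_inequality[OF ome])
  also have "(\<integral>\<^sup>+\<omega>. ennreal (f' \<omega>) \<partial>M) = ennreal (expectation f')"
    by (rule nn_integral_eq_integral[OF bounded_observable_integrable[OF f']]) (simp add: f'_def)
  also have "ennreal maximal_const * ennreal (expectation f') = ennreal (maximal_const * expectation f')"
    using maximal_const_nonneg by (simp add: ennreal_mult' f'_def integral_nonneg_AE)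
  finally have "l / 2 * prob ?E \<le> maximal_const * expectation f'"
    using maximal_const_nonneg by (subst (asm) ennreal_le_iff) (auto simp: f'_def intro!: mult_nonneg_nonneg integral_nonneg_AE)
  also have "\<dots> \<le> C * expectation f'" using C by (intro mult_right_mono) (auto simp: f'_def integral_nonneg_AE)
  also have "\<dots> < l / 2 * prob ?Bad" using K(2) C(1) by (simp add: f'_def pos_less_divide_eq mult.commute)
  finally have "prob ?E < prob ?Bad" using l by simp
  then show False using finite_measure_mono[OF sub E] by simp
qed

lemma pointwise_ergodic_bounded:
  assumes f: "bounded_observable b f"
  shows "AE \<omega> in M. (\<lambda>N. avg (real N) f \<omega>) \<longlonglongrightarrow> expectation f"
proof -
  have [measurable]: "avg (real N) f \<in> borel_measurable M" for N
    by (rule orbit_measurable_borel[OF orbit_measurable_avg[OF bounded_observableD(1)[OF f]]])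
  have "AE \<omega> in M. \<not> (\<forall>n. \<exists>N\<ge>n. 1 / (real j + 1) < \<bar>avg (real N) f \<omega> - expectation f\<bar>)" for j :: nat
  proof -
    have "{\<omega>\<in>space M. \<forall>n. \<exists>N\<ge>n. 1 / (real j + 1) < \<bar>avg (real N) f \<omega> - expectation f\<bar>} \<in> sets M" by measurable
    then show ?thesis using prob_avg_far[OF f, of "1 / (real j + 1)"]
      by (intro AE_I[where N="{\<omega>\<in>space M. \<forall>n. \<exists>N\<ge>n. 1 / (real j + 1) < \<bar>avg (real N) f \<omega> - expectation f\<bar>}"])
         (auto simp: emeasure_eq_measure)
  qed
  then have "AE \<omega> in M. \<forall>j::nat. \<not> (\<forall>n. \<exists>N\<ge>n. 1 / (real j + 1) < \<bar>avg (real N) f \<omega> - expectation f\<bar>)"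
    by (simp only: AE_all_countable) blast
  then show ?thesis
  proof eventually_elim
    case (elim \<omega>)
    show ?case
    proof (rule LIMSEQ_I)
      fix e :: real assume "e > 0"
      then obtain j :: nat where j: "1 / (real j + 1) < e"
        using reals_Archimedean by (metis inverse_eq_divide of_nat_Suc add.commute)
      obtain n where n: "\<And>N. N \<ge> n \<Longrightarrow> \<not> 1 / (real j + 1) < \<bar>avg (real N) f \<omega> - expectation f\<bar>" using elim by blast
      show "\<exists>n. \<forall>N\<ge>n. norm (avg (real N) f \<omega> - expectation f) < e"
        by (intro exI[of _ n] allI impI) (use n j in fastforce)
    qed
  qed
qed

lemma orbit_measurable_min:
  assumes g: "orbit_measurable (g :: 'w \<Rightarrow> ennreal)"
  shows "orbit_measurable (\<lambda>\<omega>. min (g \<omega>) (of_nat k))" "orbit_measurable (\<lambda>\<omega>. g \<omega> - min (g \<omega>) (of_nat k))"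
  by (rule orbit_measurable_compose[OF g]; simp)+

lemma eavg_split:
  assumes g: "orbit_measurable (g :: 'w \<Rightarrow> ennreal)" and \<omega>: "\<omega> \<in> space M"
  shows "eavg r g \<omega> = eavg r (\<lambda>\<omega>. min (g \<omega>) (of_nat k)) \<omega> + eavg r (\<lambda>\<omega>. g \<omega> - min (g \<omega>) (of_nat k)) \<omega>"
proof -
  note [measurable] = orbit_measurable_path[OF orbit_measurable_min(1)[OF g, of k] \<omega>]
    orbit_measurable_path[OF orbit_measurable_min(2)[OF g, of k] \<omega>]
  have "g \<omega>' = min (g \<omega>') (of_nat k) + (g \<omega>' - min (g \<omega>') (of_nat k))" for \<omega>'
    by (rule add_diff_inverse_ennreal[symmetric]) simp
  then have "(\<integral>\<^sup>+x. g (S x \<omega>) * indicator (cube r) x \<partial>lborel) =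
     (\<integral>\<^sup>+x. min (g (S x \<omega>)) (of_nat k) * indicator (cube r) x + (g (S x \<omega>) - min (g (S x \<omega>)) (of_nat k)) * indicator (cube r) x \<partial>lborel)"
    by (intro nn_integral_cong) (metis distrib_right)
  also have "\<dots> = (\<integral>\<^sup>+x. min (g (S x \<omega>)) (of_nat k) * indicator (cube r) x \<partial>lborel) +
      (\<integral>\<^sup>+x. (g (S x \<omega>) - min (g (S x \<omega>)) (of_nat k)) * indicator (cube r) x \<partial>lborel)"
    by (rule nn_integral_add) measurable
  finally show ?thesis by (simp add: eavg_def add_divide_distrib_ennreal)
qed

lemma pointwise_ergodic_truncated:
  assumes g: "orbit_measurable (g :: 'w \<Rightarrow> ennreal)"
  shows "AE \<omega> in M. (\<lambda>N. eavg (real N) (\<lambda>\<omega>. min (g \<omega>) (of_nat k)) \<omega>) \<longlonglongrightarrow> (\<integral>\<^sup>+\<omega>. min (g \<omega>) (of_nat k) \<partial>M)"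
proof -
  define f where "f \<omega> = enn2real (min (g \<omega>) (of_nat k))" for \<omega>
  have fin: "min (g \<omega>) (of_nat k) < \<top>" for \<omega> by (simp add: min_less_iff_disj of_nat_less_top)
  then have gf: "min (g \<omega>) (of_nat k) = ennreal (f \<omega>)" for \<omega> by (simp add: f_def)
  have f: "bounded_observable (real k) f"
    unfolding bounded_observable_def
  proof (intro conjI ballI)
    show "orbit_measurable f" unfolding f_def
      by (rule orbit_measurable_compose[OF orbit_measurable_min(1)[OF g]]) simp
    fix \<omega>
    have "enn2real (min (g \<omega>) (of_nat k)) \<le> enn2real (of_nat k)"
      by (rule enn2real_mono) (auto simp: of_nat_less_top)
    then show "\<bar>f \<omega>\<bar> \<le> real k" by (simp add: f_def)
  qed
  have nn: "f \<omega> \<ge> 0" for \<omega> by (simp add: f_def)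
  have I: "(\<integral>\<^sup>+\<omega>. ennreal (f \<omega>) \<partial>M) = ennreal (expectation f)"
    using nn by (intro nn_integral_eq_integral bounded_observable_integrable[OF f]) auto
  show ?thesis
    using pointwise_ergodic_bounded[OF f] AE_space
  proof eventually_elim
    case (elim \<omega>)
    have "(\<lambda>N. ennreal (avg (real N) f \<omega>)) \<longlonglongrightarrow> ennreal (expectation f)" using elim(1) by (rule tendsto_ennrealI)
    moreover have "eventually (\<lambda>N. ennreal (avg (real N) f \<omega>) = eavg (real N) (\<lambda>\<omega>. min (g \<omega>) (of_nat k)) \<omega>) sequentially"
      using eventually_ge_at_top[of 1]
    proof eventually_elim
      case (elim N)
      then show ?case using eavg_ennreal[OF f nn, of \<omega> "real N"] \<open>\<omega> \<in> space M\<close> by (simp add: gf)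
    qed
    ultimately show ?case unfolding gf I by (rule Lim_transform_eventually)
  qed
qed

theorem pointwise_ergodic:
  assumes g: "orbit_measurable (g :: 'w \<Rightarrow> ennreal)" and fin: "(\<integral>\<^sup>+\<omega>. g \<omega> \<partial>M) < \<infinity>"
  shows "AE \<omega> in M. (\<lambda>N. eavg (real N) g \<omega>) \<longlonglongrightarrow> (\<integral>\<^sup>+\<omega>. g \<omega> \<partial>M)"
proof -
  let ?I = "\<integral>\<^sup>+\<omega>. g \<omega> \<partial>M"
  define J where "J k = (\<integral>\<^sup>+\<omega>. min (g \<omega>) (of_nat k) \<partial>M)" for k :: nat
  note [measurable] = orbit_measurable_borel[OF g] orbit_measurable_borel[OF orbit_measurable_eavg[OF g]]
  have J_le: "J k \<le> ?I" for k unfolding J_def by (intro nn_integral_mono) simp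
  have sup: "(SUP k::nat. min t (of_nat k)) = t" for t :: ennreal
  proof (rule antisym)
    show "t \<le> (SUP k::nat. min t (of_nat k))"
    proof (rule dense_le)
      fix s assume s: "s < t"
      then have "s < \<top>" using less_top less_le_trans top_greatest by blast
      then obtain k :: nat where "s < of_nat k" using ennreal_Ex_less_of_nat by auto
      then show "s \<le> (SUP k::nat. min t (of_nat k))" using s by (intro SUP_upper2[of k]) auto
    qed
  qed (auto intro: SUP_least)
  have inc: "incseq (\<lambda>k \<omega>. min (g \<omega>) (of_nat k :: ennreal))"
    by (auto simp: incseq_def le_fun_def min_le_iff_disj) 
  have Jsup: "(SUP k. J k) = ?I"
    unfolding J_def by (subst nn_integral_monotone_convergence_SUP[OF inc, symmetric]) (simp_all add: sup)
  have upper: "AE \<omega> in M. \<not> (\<forall>n. \<exists>N\<ge>n. ?I + ennreal l < eavg (real N) g \<omega>)" if l: "l > 0" for l :: real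
  proof -
    let ?Bad = "{\<omega>\<in>space M. \<forall>n. \<exists>N\<ge>n. ?I + ennreal l < eavg (real N) g \<omega>}"
    have Bad: "?Bad \<in> sets M" by measurable
    have "ennreal (l / 2) * emeasure M ?Bad \<le> ennreal maximal_const * (?I - J k)" for k
    proof -
      let ?d = "\<lambda>\<omega>. g \<omega> - min (g \<omega>) (of_nat k)"
      let ?E = "{\<omega>\<in>space M. \<exists>r\<ge>1. ennreal (l / 2) < eavg (real (r::nat)) ?d \<omega>}"
      note dm = orbit_measurable_min(2)[OF g, of k]
      have [measurable]: "eavg (real r) ?d \<in> borel_measurable M" for r :: nat
        by (rule orbit_measurable_borel[OF orbit_measurable_eavg[OF dm]])
      have E: "?E \<in> sets M" by measurable
      have "AE \<omega> in M. \<omega> \<in> ?Bad \<longrightarrow> \<omega> \<in> ?E"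
        using pointwise_ergodic_truncated[OF g, of k] AE_space
      proof eventually_elim
        case (elim \<omega>)
        show ?case
        proof
          assume bad: "\<omega> \<in> ?Bad"
          have "J k < ?I + ennreal (l / 2)"
            using J_le[of k] ennreal_add_left_cancel_less[of ?I 0 "ennreal (l/2)"] fin l by (auto intro: le_less_trans)
          then have "eventually (\<lambda>N. eavg (real N) (\<lambda>\<omega>. min (g \<omega>) (of_nat k)) \<omega> < ?I + ennreal (l / 2)) sequentially"
            using elim(1) unfolding J_def by (intro order_tendstoD(2)) 
          then obtain n where n: "\<And>N. N \<ge> n \<Longrightarrow> eavg (real N) (\<lambda>\<omega>. min (g \<omega>) (of_nat k)) \<omega> < ?I + ennreal (l / 2)"
            by (auto simp: eventually_sequentially)
          obtain N where N: "N \<ge> max 1 n" "?I + ennreal l < eavg (real N) g \<omega>" using bad by blast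
          have "ennreal (l / 2) < eavg (real N) ?d \<omega>"
          proof (rule ccontr)
            assume "\<not> ?thesis"
            then have "eavg (real N) ?d \<omega> \<le> ennreal (l / 2)" by simp
            then have "eavg (real N) g \<omega> \<le> (?I + ennreal (l / 2)) + ennreal (l / 2)"
              unfolding eavg_split[OF g elim(2), of _ k] using N(1) by (intro add_mono[OF less_imp_le[OF n[of N]]]) auto
            also have "\<dots> = ?I + ennreal l" using l by (simp add: add.assoc flip: ennreal_plus)
            finally show False using N(2) by simp
          qed
          then show "\<omega> \<in> ?E" using N(1) elim(2) by (auto intro!: exI[of _ N])
        qed
      qed
      then have "emeasure M ?Bad \<le> emeasure M ?E" by (rule emeasure_mono_AE[OF _ E])
      then have "ennreal (l / 2) * emeasure M ?Bad \<le> ennreal (l / 2) * emeasure M ?E" by (rule mult_left_mono) simp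
      also have "\<dots> \<le> ennreal maximal_const * (\<integral>\<^sup>+\<omega>. ?d \<omega> \<partial>M)" by (rule maximal_inequality[OF dm])
      also have "(\<integral>\<^sup>+\<omega>. ?d \<omega> \<partial>M) = ?I - J k"
        unfolding J_def
      proof (rule nn_integral_diff)
        show "(\<integral>\<^sup>+\<omega>. min (g \<omega>) (of_nat k) \<partial>M) \<noteq> \<infinity>" using J_le[of k] fin unfolding J_def by (auto simp: top_unique)
      qed auto
      finally show ?thesis .
    qed
    then have "ennreal (l / 2) * emeasure M ?Bad \<le> (INF k. ennreal maximal_const * (?I - J k))" by (intro INF_greatest)
    also have "\<dots> = 0"
    proof -
      have "(\<lambda>k. ennreal maximal_const * (?I - J k)) \<longlonglongrightarrow> ennreal maximal_const * (?I - ?I)"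
      proof (intro ennreal_tendsto_cmult tendsto_diff_ennreal_general tendsto_const)
        have "incseq J" unfolding J_def using inc by (auto simp: incseq_def le_fun_def intro!: nn_integral_mono)
        then show "J \<longlonglongrightarrow> ?I" using LIMSEQ_SUP[of J] Jsup by simp
      qed (use fin in auto)
      then have lim: "(\<lambda>k. ennreal maximal_const * (?I - J k)) \<longlonglongrightarrow> 0" using fin by simp
      have "(INF k. ennreal maximal_const * (?I - J k)) \<le> 0"
        by (rule LIMSEQ_le_const[OF lim]) (auto intro: INF_lower)
      then show ?thesis by simp
    qed
    finally have "emeasure M ?Bad = 0" using l by (auto simp: ennreal_zero_less_divide)
    then show ?thesis using Bad by (intro AE_I[where N="?Bad"]) auto
  qed
  have "AE \<omega> in M. \<forall>j::nat. \<not> (\<forall>n. \<exists>N\<ge>n. ?I + ennreal (1 / (real j + 1)) < eavg (real N) g \<omega>)"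
    unfolding AE_all_countable by (intro allI upper) simp
  moreover have "AE \<omega> in M. \<forall>k. (\<lambda>N. eavg (real N) (\<lambda>\<omega>. min (g \<omega>) (of_nat k)) \<omega>) \<longlonglongrightarrow> J k"
    unfolding AE_all_countable J_def by (intro allI pointwise_ergodic_truncated[OF g])
  ultimately show ?thesis using AE_space
  proof eventually_elim
    case (elim \<omega>)
    show ?case
    proof (rule order_tendstoI)
      fix a assume "a < ?I"
      then obtain k where k: "a < J k" unfolding Jsup[symmetric] less_SUP_iff by auto
      then have "eventually (\<lambda>N. a < eavg (real N) (\<lambda>\<omega>. min (g \<omega>) (of_nat k)) \<omega>) sequentially"
        by (rule order_tendstoD(1)[OF elim(2)[rule_format]])
      then show "eventually (\<lambda>N. a < eavg (real N) g \<omega>) sequentially"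
      proof eventually_elim
        case (elim N)
        also have "eavg (real N) (\<lambda>\<omega>. min (g \<omega>) (of_nat k)) \<omega> \<le> eavg (real N) g \<omega>"
          unfolding eavg_split[OF g \<open>\<omega> \<in> space M\<close>, of _ k] by simp
        finally show ?case .
      qed
    next
      fix a assume a: "?I < a"
      have "(\<lambda>j. ?I + ennreal (1 / (real j + 1))) \<longlonglongrightarrow> ?I + ennreal 0"
        using LIMSEQ_inverse_real_of_nat by (intro tendsto_add tendsto_const tendsto_ennrealI) (simp add: inverse_eq_divide add.commute)
      then have "eventually (\<lambda>j. ?I + ennreal (1 / (real j + 1)) < a) sequentially"
        by (rule order_tendstoD(2)) (use a in simp)
      then obtain j where j: "?I + ennreal (1 / (real j + 1)) < a" by (auto simp: eventually_sequentially)
      obtain n where "\<And>N. N \<ge> n \<Longrightarrow> \<not> ?I + ennreal (1 / (real j + 1)) < eavg (real N) g \<omega>" using elim(1) by blast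
      then show "eventually (\<lambda>N. eavg (real N) g \<omega> < a) sequentially"
        unfolding eventually_sequentially using j by (intro exI[of _ n] allI impI) (meson le_less_trans not_less)
    qed
  qed
qed

end

section \<open>The estimator\<close>

lemma topspace_fell: "topspace fell_topology = {F. closed F}"
  unfolding fell_topology_def topology_generated_by_topspace
proof (intro set_eqI iffI)
  fix F :: "'a set" assume "F \<in> {F. closed F}"
  then have "F \<in> {F. closed F \<and> F \<inter> {} = {}}" by simp
  moreover have "{F. closed F \<and> F \<inter> {} = {}} \<in> {{F :: 'a set. closed F \<and> F \<inter> K = {}} | K. compact K}"
    by (rule CollectI, rule exI[of _ "{}"]) simp
  ultimately show "F \<in> \<Union> ({{F. closed F \<and> F \<inter> K = {}} | K. compact K} \<union> {{F. closed F \<and> F \<inter> G \<noteq> {}} | G. open G})"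
    by (meson UnI1 UnionI)
qed auto

lemma shift_Int_eq_empty_iff: "shift h F \<inter> K = {} \<longleftrightarrow> F \<inter> (\<lambda>x. x + h) ` K = {}"
  for F :: "'a::ab_group_add set"
proof -
  have "x - h \<in> K \<longleftrightarrow> x \<in> (\<lambda>x. x + h) ` K" for x by (force simp: image_iff)
  then show ?thesis by (auto simp: shift_def)
qed

lemma closed_shift: "closed F \<Longrightarrow> closed (shift h F)"
  for F :: "'a::real_normed_vector set"
  using closed_translation[of F "- h"] by (simp add: shift_def)

lemma continuous_map_shift:
  "continuous_map fell_topology fell_topology (shift (h :: 'a::real_normed_vector))"
proof -
  let ?gen = "{{F :: 'a set. closed F \<and> F \<inter> K = {}} | K. compact K} \<union> {{F. closed F \<and> F \<inter> G \<noteq> {}} | G. open G}"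
  have gen: "openin fell_topology U" if "U \<in> ?gen" for U
    unfolding fell_topology_def using that by (rule topology_generated_by_Basis)
  have "continuous_map fell_topology (topology_generated_by ?gen) (shift h)"
  proof (rule continuous_on_generated_topo)
    fix U assume "U \<in> ?gen"
    then have "shift h -` U \<inter> {F. closed F} \<in> ?gen"
    proof
      assume "U \<in> {{F. closed F \<and> F \<inter> K = {}} | K. compact K}"
      then obtain K where K: "compact K" "U = {F. closed F \<and> F \<inter> K = {}}" by blast
      then have "shift h -` U \<inter> {F. closed F} = {F. closed F \<and> F \<inter> (\<lambda>x. x + h) ` K = {}}"
        by (auto simp: closed_shift shift_Int_eq_empty_iff)
      moreover have "compact ((\<lambda>x. x + h) ` K)" using compact_translation[OF K(1), of h] by (simp add: add.commute)
      ultimately show ?thesis by blast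
    next
      assume "U \<in> {{F. closed F \<and> F \<inter> G \<noteq> {}} | G. open G}"
      then obtain G where G: "open G" "U = {F. closed F \<and> F \<inter> G \<noteq> {}}" by blast
      then have "shift h -` U \<inter> {F. closed F} = {F. closed F \<and> F \<inter> (\<lambda>x. x + h) ` G \<noteq> {}}"
        by (auto simp: closed_shift shift_Int_eq_empty_iff)
      moreover have "open ((\<lambda>x. x + h) ` G)" using open_translation[OF G(1), of h] by (simp add: add.commute)
      ultimately show ?thesis by blast
    qed
    then show "openin fell_topology (shift h -` U \<inter> topspace fell_topology)"
      unfolding topspace_fell by (rule gen)
  next
    have "\<Union> ?gen = {F. closed F}" using topspace_fell[where 'a='a] by (simp only: fell_topology_def topology_generated_by_topspace)
    then show "shift h ` topspace fell_topology \<subseteq> \<Union> ?gen" by (auto simp: topspace_fell closed_shift)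
  qed
  then show ?thesis by (simp only: fell_topology_def[symmetric])
qed

lemma measurable_shift [measurable]: "shift (h :: 'a::real_normed_vector) \<in> measurable fell_borel fell_borel"
  unfolding fell_borel_def
proof (rule measurable_measure_of)
  show "{U :: 'a set set. openin fell_topology U} \<subseteq> Pow {F. closed F}" by (auto dest: openin_fell_closed)
  show "shift h \<in> space (sigma {F. closed F} {U. openin fell_topology U}) \<rightarrow> {F. closed F}"
    using space_fell_borel by (auto simp: closed_shift simp flip: fell_borel_def)
  fix U :: "'a set set" assume "U \<in> {U. openin fell_topology U}"
  then have "openin fell_topology {F \<in> topspace fell_topology. shift h F \<in> U}"
    using openin_continuous_map_preimage[OF continuous_map_shift] by auto
  moreover have "{F \<in> topspace fell_topology. shift h F \<in> U} = shift h -` U \<inter> space fell_borel"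
    by (auto simp: topspace_fell)
  ultimately show "shift h -` U \<inter> space (sigma {F. closed F} {U. openin fell_topology U}) \<in> sets (sigma {F. closed F} {U. openin fell_topology U})"
    using sets_fell_borel_open unfolding fell_borel_def by metis
qed

text \<open>The hyperplane group acts through the projection of the whole space onto it, so that ergodic
  averages over full-dimensional cubes can be used.\<close>

definition hyper_shift :: "'n::finite \<Rightarrow> real^'n \<Rightarrow> (real^'n) set \<Rightarrow> (real^'n) set" where
  "hyper_shift d x F = shift (proj d x) F"

lemma ergodic_action_hyper_shift:
  fixes \<Xi> :: "'w \<Rightarrow> (real^'n::finite) set"
  assumes prob: "prob_space M" and rcs: "random_closed_set M \<Xi>" and erg: "stationary_ergodic M (H_in d) \<Xi>"
  shows "ergodic_euclidean_action (distr M fell_borel \<Xi>) (hyper_shift d)"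
proof -
  interpret M: prob_space M by (rule prob)
  have \<Xi>[measurable]: "\<Xi> \<in> measurable M fell_borel" using rcs by (simp add: random_closed_set_def)
  obtain T where T: "preserving_group M (H_in d) T"
     "\<And>x \<omega>. x \<in> H_in d \<Longrightarrow> \<omega> \<in> space M \<Longrightarrow> \<Xi> (T x \<omega>) = shift x (\<Xi> \<omega>)"
     "stationary_on M (H_in d) \<Xi>" "ergodic_under M (H_in d) T \<Xi>"
    using erg unfolding stationary_ergodic_def by blast
  interpret D: prob_space "distr M fell_borel \<Xi>" by (rule M.prob_space_distr[OF \<Xi>])
  show ?thesis
  proof
    fix x y :: "real^'n" and F :: "(real^'n) set" and B :: "(real^'n) set set"
    show "hyper_shift d x \<in> measurable (distr M fell_borel \<Xi>) (distr M fell_borel \<Xi>)"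
      unfolding hyper_shift_def by measurable
    have "distr (distr M fell_borel \<Xi>) fell_borel (shift (proj d x)) = distr M fell_borel \<Xi>"
      using T(3) by (subst distr_distr) (auto simp: stationary_on_def o_def)
    then show "distr (distr M fell_borel \<Xi>) (distr M fell_borel \<Xi>) (hyper_shift d x) = distr M fell_borel \<Xi>"
      unfolding hyper_shift_def[abs_def] by (subst (asm) distr_cong[OF refl _ refl, of _ "distr M fell_borel \<Xi>"]) simp_all
    show "hyper_shift d 0 F = F" by (simp add: hyper_shift_def shift_def)
    show "hyper_shift d (x + y) F = hyper_shift d x (hyper_shift d y F)"
      by (auto simp: hyper_shift_def shift_def proj_add image_image algebra_simps)
    assume B: "B \<in> sets (distr M fell_borel \<Xi>)"
      and inv: "\<And>x. hyper_shift d x -` B \<inter> space (distr M fell_borel \<Xi>) = B"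
    define E where "E = \<Xi> -` B \<inter> space M"
    have "T x -` E \<inter> space M = E" if x: "x \<in> H_in d" for x
    proof (intro set_eqI)
      fix \<omega>
      have Tsp: "T x \<omega> \<in> space M" if "\<omega> \<in> space M"
        using T(1) x that by (auto simp: preserving_group_def intro: measurable_space)
      have "shift x (\<Xi> \<omega>) \<in> B \<longleftrightarrow> \<Xi> \<omega> \<in> B" if "\<omega> \<in> space M"
      proof -
        have "\<Xi> \<omega> \<in> B \<longleftrightarrow> \<Xi> \<omega> \<in> hyper_shift d x -` B \<inter> space (distr M fell_borel \<Xi>)" by (simp only: inv)
        also have "\<dots> \<longleftrightarrow> shift x (\<Xi> \<omega>) \<in> B"
          unfolding hyper_shift_def proj_id[OF x] vimage_def using measurable_space[OF \<Xi> that] by (simp only: space_distr Int_iff mem_Collect_eq simp_thms)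
        finally show ?thesis by simp
      qed
      then show "\<omega> \<in> T x -` E \<inter> space M \<longleftrightarrow> \<omega> \<in> E" using Tsp T(2)[OF x] by (auto simp: E_def)
    qed
    then have "measure M E = 0 \<or> measure M E = 1"
      using T(4) B unfolding ergodic_under_def Let_def E_def by simp
    then show "D.prob B = 0 \<or> D.prob B = 1" using B by (simp add: measure_distr E_def)
  qed
qed

lemma mem_cube_vec: "x \<in> cube r \<longleftrightarrow> (\<forall>i. \<bar>x $ i\<bar> \<le> r / 2)" for x :: "real^'n::finite"
  by (auto simp: cube_def Basis_vec_def inner_axis)

lemma mem_H_in_window: "x \<in> H_in_window d N \<longleftrightarrow> x $ d = 0 \<and> (\<forall>i. \<bar>x $ i\<bar> \<le> real N / 2)"
  for x :: "real^'n::finite"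
proof -
  have "\<bar>t\<bar> \<le> real N / 2 \<longleftrightarrow> - real N / 2 \<le> t \<and> t \<le> real N / 2" for t by linarith
  then have "(\<forall>i. i \<noteq> d \<longrightarrow> x $ i \<in> {- real N / 2 .. real N / 2}) \<longleftrightarrow> (\<forall>i. i \<noteq> d \<longrightarrow> \<bar>x $ i\<bar> \<le> real N / 2)" by simp
  moreover have "\<dots> \<longleftrightarrow> (\<forall>i. \<bar>x $ i\<bar> \<le> real N / 2)" if "x $ d = 0"
  proof (intro iffI allI impI)
    fix i assume "\<forall>i. i \<noteq> d \<longrightarrow> \<bar>x $ i\<bar> \<le> real N / 2"
    then show "\<bar>x $ i\<bar> \<le> real N / 2" using that by (cases "i = d") auto
  qed auto
  ultimately show ?thesis by (auto simp: H_in_window_def H_in_def window_def)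
qed

lemma H_in_window_borel [measurable]: "H_in_window d N \<in> sets borel"
proof -
  have "H_in_window d N = {x. x $ d = 0 \<and> (\<forall>i. \<bar>x $ i\<bar> \<le> real N / 2)}" using mem_H_in_window by blast
  also have "\<dots> \<in> sets borel" by measurable
  finally show ?thesis .
qed

definition window_length :: "'n::finite \<Rightarrow> nat \<Rightarrow> (real^'n \<Rightarrow> ennreal) \<Rightarrow> ennreal" where
  "window_length d N G = (\<integral>\<^sup>+x. (if G (proj d x) < \<infinity> then G (proj d x) else 0) * indicator (cube (real N)) x \<partial>lborel)"

definition window_area :: "'n::finite \<Rightarrow> nat \<Rightarrow> (real^'n \<Rightarrow> ennreal) \<Rightarrow> ennreal" where
  "window_area d N G = (\<integral>\<^sup>+x. (if G (proj d x) < \<infinity> then 1 else 0) * indicator (cube (real N)) x \<partial>lborel)"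

definition window_ratio :: "'n::finite \<Rightarrow> nat \<Rightarrow> (real^'n \<Rightarrow> ennreal) \<Rightarrow> ennreal" where
  "window_ratio d N G = (if window_area d N G = 0 then \<infinity> else window_length d N G / window_area d N G)"

lemma window_ratio_cong:
  assumes "\<And>x. x \<in> H_in_window d N \<Longrightarrow> G x = G' x"
  shows "window_ratio d N G = window_ratio d N G'"
proof -
  have *: "G (proj d x) = G' (proj d x)" if "x \<in> cube (real N)" for x
    using that by (intro assms) (auto simp: mem_H_in_window mem_cube_vec)
  then have "window_length d N G = window_length d N G'" "window_area d N G = window_area d N G'"
    unfolding window_length_def window_area_def by (auto intro!: nn_integral_cong simp: indicator_def)
  then show ?thesis by (simp add: window_ratio_def)
qed

lemma hausdorff_ratio_eq_window_ratio:
  fixes d :: "'n::finite" and G :: "real^'n \<Rightarrow> ennreal"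
  assumes [measurable]: "G \<in> borel_measurable borel" and N: "N \<ge> 1"
  defines "\<mu> \<equiv> hausdorff_measure (CARD('n) - 1)" and "A \<equiv> {x\<in>H_in_window d N. G x < \<infinity>}"
  shows "(if emeasure \<mu> A = 0 then \<infinity> else (\<integral>\<^sup>+x\<in>A. G x \<partial>\<mu>) / emeasure \<mu> A) = window_ratio d N G"
proof -
  have [measurable]: "A \<in> sets borel" unfolding A_def by measurable
  have s[measurable_cong]: "sets \<mu> = sets borel" by (simp add: \<mu>_def)
  have AH: "A \<subseteq> H_in d" by (auto simp: A_def H_in_window_def)
  obtain c :: real where c: "c > 0"
    "density \<mu> (indicator (H_in d)) = scale_measure (ennreal c) (slab_measure d (real N / 2))"
    using hausdorff_measure_H_in_eq_slab[of "real N / 2" d] N unfolding \<mu>_def by auto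
  have key: "(\<integral>\<^sup>+x. u x * indicator A x \<partial>\<mu>) =
      ennreal c * (\<integral>\<^sup>+x. (if G (proj d x) < \<infinity> then u (proj d x) else 0) * indicator (cube (real N)) x \<partial>lborel)"
    if [measurable]: "u \<in> borel_measurable borel" for u :: "real^'n \<Rightarrow> ennreal"
  proof -
    have "(\<integral>\<^sup>+x. u x * indicator A x \<partial>\<mu>) = (\<integral>\<^sup>+x. indicator (H_in d) x * (u x * indicator A x) \<partial>\<mu>)"
      using AH by (intro nn_integral_cong) (auto simp: indicator_def)
    also have "\<dots> = (\<integral>\<^sup>+x. u x * indicator A x \<partial>density \<mu> (indicator (H_in d)))"
      by (rule nn_integral_density[symmetric]) measurable
    also have "\<dots> = ennreal c * (\<integral>\<^sup>+x. u x * indicator A x \<partial>slab_measure d (real N / 2))"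
      unfolding c(2) by (rule nn_integral_scale_measure) measurable
    also have "(\<integral>\<^sup>+x. u x * indicator A x \<partial>slab_measure d (real N / 2)) =
        (\<integral>\<^sup>+x. indicator {x. \<bar>x $ d\<bar> \<le> real N / 2} x * (u (proj d x) * indicator A (proj d x)) \<partial>lborel)"
      by (rule nn_integral_slab_measure) measurable
    also have "\<dots> = (\<integral>\<^sup>+x. (if G (proj d x) < \<infinity> then u (proj d x) else 0) * indicator (cube (real N)) x \<partial>lborel)"
    proof (rule nn_integral_cong)
      fix x :: "real^'n"
      have "x \<in> cube (real N) \<longleftrightarrow> \<bar>x $ d\<bar> \<le> real N / 2 \<and> proj d x \<in> H_in_window d N"
        by (auto simp: mem_cube_vec mem_H_in_window)
      then show "indicator {x. \<bar>x $ d\<bar> \<le> real N / 2} x * (u (proj d x) * indicator A (proj d x)) =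
        (if G (proj d x) < \<infinity> then u (proj d x) else 0) * indicator (cube (real N)) x"
        by (auto simp: indicator_def A_def)
    qed
    finally show ?thesis .
  qed
  have 1: "(\<integral>\<^sup>+x\<in>A. G x \<partial>\<mu>) = ennreal c * window_length d N G"
    using key[of G] by (simp add: window_length_def)
  have 2: "emeasure \<mu> A = ennreal c * window_area d N G"
    using key[of "\<lambda>_. 1"] by (simp add: window_area_def)
  have "ennreal c * window_length d N G / (ennreal c * window_area d N G) = window_length d N G / window_area d N G"
    using divide_mult_eq[of "ennreal c" "window_length d N G" "window_area d N G"] c(1) by (simp add: mult.commute)
  then show ?thesis using c(1) by (simp add: 1 2 window_ratio_def)
qed

lemma tortuosity_estimator_eq_window_ratio:
  fixes d :: "'n::finite"
  assumes "(\<lambda>x. geodesic_length (X N) (F \<inter> dilated_window d \<alpha> N) x (H_out d)) \<in> borel_measurable borel" and "N \<ge> 1"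
  shows "tortuosity_estimator d X \<alpha> N F = window_ratio d N (\<lambda>x. geodesic_length (X N) (F \<inter> dilated_window d \<alpha> N) x (H_out d))"
proof -
  have "connected_points (X N) (F \<inter> dilated_window d \<alpha> N) (H_out d) \<inter> H_in_window d N =
     {x\<in>H_in_window d N. geodesic_length (X N) (F \<inter> dilated_window d \<alpha> N) x (H_out d) < \<infinity>}"
    using connected_points_iff by blast
  then show ?thesis unfolding tortuosity_estimator_def Let_def
    by (simp only: hausdorff_ratio_eq_window_ratio[OF assms, of d])
qed

lemma tortuosity_estimator_0:
  fixes d :: "'n::finite"
  assumes "CARD('n) \<ge> 2"
  shows "tortuosity_estimator d X \<alpha> 0 F = \<infinity>"
proof -
  let ?S = "connected_points (X 0) (F \<inter> dilated_window d \<alpha> 0) (H_out d) \<inter> H_in_window d 0"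
  have S: "?S \<subseteq> {0}" by (auto simp: mem_H_in_window vec_eq_iff)
  have "hausdorff_outer (CARD('n) - 1) {0 :: real^'n} \<le> 0"
    using assms by (intro hausdorff_outer_finite_cover exI[of _ "{{0}}"]) (auto simp: hausdorff_weight_def)
  then have "emeasure (hausdorff_measure (CARD('n) - 1)) {0 :: real^'n} = 0"
    by (simp add: emeasure_hausdorff_measure)
  then have "emeasure (hausdorff_measure (CARD('n) - 1)) ?S = 0"
    using emeasure_mono[OF S, of "hausdorff_measure (CARD('n) - 1)"] by simp
  then show ?thesis unfolding tortuosity_estimator_def Let_def by simp
qed

definition window_radius :: "real \<Rightarrow> nat \<Rightarrow> real" where
  "window_radius \<alpha> N = real N / 2 + real N powr \<alpha>"

lemma mem_dilated_window:
  "x \<in> dilated_window d \<alpha> N \<longleftrightarrow> (\<forall>i. i \<noteq> d \<longrightarrow> \<bar>x $ i\<bar> \<le> window_radius \<alpha> N) \<and> - (real N powr \<alpha>) \<le> x $ d \<and> x $ d \<le> 1"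
  for x :: "real^'n::finite"
proof
  assume "x \<in> dilated_window d \<alpha> N"
  then obtain a b where ab: "x = a + b" "a \<in> window d N"
    "\<And>i. i \<noteq> d \<Longrightarrow> b $ i \<in> {- (real N powr \<alpha>) .. real N powr \<alpha>}" "b $ d \<in> {- (real N powr \<alpha>) .. 0}"
    unfolding dilated_window_def by (auto simp: set_plus_def)
  have "\<bar>x $ i\<bar> \<le> window_radius \<alpha> N" if "i \<noteq> d" for i
  proof -
    have "- (real N / 2) \<le> a $ i" "a $ i \<le> real N / 2" using ab(2) that by (auto simp: window_def)
    moreover have "- (real N powr \<alpha>) \<le> b $ i" "b $ i \<le> real N powr \<alpha>" using ab(3)[OF that] by auto
    ultimately show ?thesis unfolding ab(1) window_radius_def vector_add_component by linarith
  qed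
  then show "(\<forall>i. i \<noteq> d \<longrightarrow> \<bar>x $ i\<bar> \<le> window_radius \<alpha> N) \<and> - (real N powr \<alpha>) \<le> x $ d \<and> x $ d \<le> 1"
    using ab(2,4) unfolding ab(1) window_def by simp
next
  assume x: "(\<forall>i. i \<noteq> d \<longrightarrow> \<bar>x $ i\<bar> \<le> window_radius \<alpha> N) \<and> - (real N powr \<alpha>) \<le> x $ d \<and> x $ d \<le> 1"
  define a where "a = (\<chi> i. if i = d then max 0 (x $ d) else max (- (real N / 2)) (min (real N / 2) (x $ i)))"
  have "a \<in> window d N" using x by (auto simp: window_def a_def)
  moreover have "x - a \<in> {x. (\<forall>i. i \<noteq> d \<longrightarrow> x $ i \<in> {- (real N powr \<alpha>) .. real N powr \<alpha>}) \<and> x $ d \<in> {- (real N powr \<alpha>) .. 0}}"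
  proof -
    have "(x - a) $ i \<in> {- (real N powr \<alpha>) .. real N powr \<alpha>}" if "i \<noteq> d" for i
    proof -
      have "\<bar>x $ i\<bar> \<le> real N / 2 + real N powr \<alpha>" using x that by (simp add: window_radius_def)
      moreover have "0 \<le> real N powr \<alpha>" by simp
      ultimately show ?thesis using that by (simp add: a_def max_def min_def abs_le_iff split: if_splits)
    qed
    moreover have "(x - a) $ d \<in> {- (real N powr \<alpha>) .. 0}" using x by (auto simp: a_def max_def)
    ultimately show ?thesis by blast
  qed
  ultimately have "a + (x - a) \<in> dilated_window d \<alpha> N" unfolding dilated_window_def by (rule set_plus_intro)
  then show "x \<in> dilated_window d \<alpha> N" by simp
qed

lemma dilated_window_eq_cbox:
  fixes d :: "'n::finite"
  shows "dilated_window d \<alpha> N = cbox (\<chi> i. if i = d then - (real N powr \<alpha>) else - window_radius \<alpha> N)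
     (\<chi> i. if i = d then 1 else window_radius \<alpha> N)"
proof (intro set_eqI)
  fix x :: "real^'n"
  have abs: "\<bar>x $ i\<bar> \<le> r \<longleftrightarrow> - r \<le> x $ i \<and> x $ i \<le> r" for i r by linarith
  have "(\<forall>i. P i) \<longleftrightarrow> (\<forall>i. i \<noteq> d \<longrightarrow> P i) \<and> P d" for P by metis
  from this[of "\<lambda>i. (if i = d then - (real N powr \<alpha>) else - window_radius \<alpha> N) \<le> x $ i \<and> x $ i \<le> (if i = d then 1 else window_radius \<alpha> N)"]
  show "x \<in> dilated_window d \<alpha> N \<longleftrightarrow> x \<in> cbox (\<chi> i. if i = d then - (real N powr \<alpha>) else - window_radius \<alpha> N)
     (\<chi> i. if i = d then 1 else window_radius \<alpha> N)"
    by (simp add: mem_dilated_window mem_box_cart abs)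
qed

lemma geodesic_length_window_euclidean:
  fixes F :: "(real^'n::finite) set"
  shows "geodesic_length euclidean (F \<inter> dilated_window d \<alpha> N) x (H_out d) = \<infinity>"
proof -
  have "x \<notin> H_out d" if xi: "x \<in> interior (F \<inter> dilated_window d \<alpha> N)" for x
  proof
    assume xo: "x \<in> H_out d"
    obtain e where e: "e > 0" "ball x e \<subseteq> F \<inter> dilated_window d \<alpha> N" using xi unfolding mem_interior by blast
    define y where "y = x + (e / 2) *\<^sub>R axis d 1"
    have "dist x y < e" using e(1) by (simp add: y_def dist_norm)
    then have "y \<in> dilated_window d \<alpha> N" using e(2) by auto
    then have "y $ d \<le> 1" by (simp add: mem_dilated_window)
    then show False using xo e(1) by (simp add: y_def H_out_def)
  qed
  then have "lipschitz_paths euclidean (F \<inter> dilated_window d \<alpha> N) x (H_out d) = {}"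
    unfolding lipschitz_paths_euclidean by (auto simp: image_subset_iff dest!: bspec[where x=1])
  then show ?thesis by (simp add: geodesic_length_def)
qed

lemma ball_H_in_window_subset:
  assumes "N \<ge> 1" "x \<in> H_in_window d N"
  shows "\<exists>e>0. ball x e \<subseteq> dilated_window d \<alpha> N"
proof (intro exI conjI)
  have p: "real N powr \<alpha> > 0" using assms by simp
  let ?e = "min 1 (real N powr \<alpha>)"
  show "?e > 0" using p by simp
  show "ball x ?e \<subseteq> dilated_window d \<alpha> N"
  proof
    fix y assume "y \<in> ball x ?e"
    then have n: "norm (y - x) < ?e" by (simp add: dist_norm norm_minus_commute)
    have c: "\<bar>y $ i - x $ i\<bar> < ?e" for i using component_le_norm_cart[of "y - x" i] n by simp
    have "\<bar>y $ i\<bar> \<le> window_radius \<alpha> N" for i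
    proof -
      have "\<bar>y $ i - x $ i\<bar> < real N powr \<alpha>" using c[of i] by simp
      moreover have "\<bar>x $ i\<bar> \<le> real N / 2" using assms(2) by (simp add: mem_H_in_window)
      ultimately show ?thesis unfolding window_radius_def by linarith
    qed
    moreover have "x $ d = 0" using assms(2) by (simp add: mem_H_in_window)
    ultimately show "y \<in> dilated_window d \<alpha> N"
      using c[of d] unfolding mem_dilated_window by auto
  qed
qed

lemma rational_approx_H_in_window:
  fixes x :: "real^'n::finite"
  assumes N: "N \<ge> 1" and x: "x \<in> H_in_window d N" and e: "e > 0"
  shows "\<exists>y\<in>H_in_window d N \<inter> rational_points. dist x y < e"
proof -
  define \<delta> where "\<delta> = e / (2 * real CARD('n))"
  have \<delta>: "\<delta> > 0" using e by (simp add: \<delta>_def)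
  have "\<exists>q\<in>\<rat>. \<bar>q\<bar> \<le> real N / 2 \<and> \<bar>x $ i - q\<bar> \<le> \<delta>" for i
  proof -
    let ?a = "max (- (real N / 2)) (x $ i - \<delta>)" and ?b = "min (real N / 2) (x $ i + \<delta>)"
    have "\<bar>x $ i\<bar> \<le> real N / 2" using x by (simp add: mem_H_in_window)
    moreover have "real N \<ge> 1" using N by simp
    ultimately have "?a < ?b" using \<delta>
      unfolding max_less_iff_conj min_less_iff_conj by (intro conjI; linarith)
    then obtain q where "q \<in> \<rat>" "?a < q" "q < ?b" using Rats_dense_in_real by blast
    then show ?thesis by (intro bexI[of _ q]) auto
  qed
  then obtain q where q: "\<And>i. q i \<in> \<rat>" "\<And>i. \<bar>q i\<bar> \<le> real N / 2" "\<And>i. \<bar>x $ i - q i\<bar> \<le> \<delta>" by metis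
  define y where "y = (\<chi> i. if i = d then 0 else q i)"
  have "y \<in> H_in_window d N \<inter> rational_points"
    using q by (auto simp: y_def mem_H_in_window rational_points_def)
  moreover have "dist x y < e"
  proof -
    have "\<bar>(x - y) $ i\<bar> \<le> \<delta>" for i using q(3)[of i] x \<delta> by (simp add: y_def mem_H_in_window)
    then have "norm (x - y) \<le> (\<Sum>i\<in>(UNIV::'n set). \<delta>)"
      by (intro order_trans[OF norm_le_l1_cart] sum_mono)
    also have "\<dots> = e / 2" by (simp add: \<delta>_def)
    also have "\<dots> < e" using e by simp
    finally show ?thesis by (simp add: dist_norm)
  qed
  ultimately show ?thesis by blast
qed

lemma geodesic_length_finite_interior:
  "geodesic_length X S x T < \<infinity> \<Longrightarrow> x \<in> X interior_of S"
  unfolding geodesic_length_def INF_less_iff lipschitz_paths_def by (force simp: image_subset_iff)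

lemma geodesic_length_euclidean_triangle:
  fixes F :: "'a::euclidean_space set"
  assumes "closed_segment x y \<subseteq> interior F"
  shows "geodesic_length euclidean F x T \<le> geodesic_length euclidean F y T + ennreal (dist x y)"
  using geodesic_length_triangle[of UNIV x y F T] assms by simp

lemma geodesic_length_eq_from_rational:
  fixes F :: "(real^'n::finite) set" and d :: 'n and X :: "nat \<Rightarrow> (real^'n) topology" and \<alpha> :: real and N :: nat
  defines "g \<equiv> \<lambda>x. geodesic_length euclidean F x (H_out d)"
    and "G \<equiv> \<lambda>x. geodesic_length (X N) (F \<inter> dilated_window d \<alpha> N) x (H_out d)"
  assumes N: "N \<ge> 1" and X: "X N = top_of_set (dilated_window d \<alpha> N) \<or> X N = euclidean"
    and eq: "\<And>y. y \<in> H_in_window d N \<inter> rational_points \<Longrightarrow> g y = G y"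
    and x: "x \<in> H_in_window d N"
  shows "g x = G x"
proof -
  let ?W = "dilated_window d \<alpha> N"
  have W: "convex ?W" unfolding dilated_window_eq_cbox by (rule convex_box)
  obtain \<rho> where \<rho>: "\<rho> > 0" "ball x \<rho> \<subseteq> ?W" using ball_H_in_window_subset[OF N x] by blast
  show ?thesis
  proof (cases "x \<in> interior F")
    case False
    have "g x = \<infinity>"
      using geodesic_length_finite_interior[of euclidean F x "H_out d"] False by (auto simp: g_def less_top[symmetric])
    moreover have "x \<notin> X N interior_of (F \<inter> ?W)"
    proof
      assume xi: "x \<in> X N interior_of (F \<inter> ?W)"
      have "x \<in> interior F"
        using X
      proof
        assume "X N = euclidean"
        then show ?thesis using xi by simp
      next
        assume "X N = top_of_set ?W"
        then obtain O' where O': "open O'" "X N interior_of (F \<inter> ?W) = ?W \<inter> O'"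
          using openin_interior_of[of "top_of_set ?W" "F \<inter> ?W"] unfolding openin_open by metis
        have "?W \<inter> O' \<subseteq> F" using interior_of_subset[of "X N" "F \<inter> ?W"] O'(2) by blast
        then have "ball x \<rho> \<inter> O' \<subseteq> F" using \<rho>(2) by blast
        moreover have "x \<in> ball x \<rho> \<inter> O'" using xi O'(2) \<rho>(1) by simp
        moreover have "open (ball x \<rho> \<inter> O')" using O'(1) by blast
        ultimately show ?thesis by (meson interiorI)
      qed
      then show False using False by simp
    qed
    then have "G x = \<infinity>"
      using geodesic_length_finite_interior[of "X N" "F \<inter> ?W" x "H_out d"] by (auto simp: G_def less_top[symmetric])
    ultimately show ?thesis by simp
  next
    case True
    then obtain \<sigma> where \<sigma>: "\<sigma> > 0" "ball x \<sigma> \<subseteq> F" unfolding mem_interior by blast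
    define e where "e = min \<rho> \<sigma>"
    have "ball x e \<subseteq> ball x \<rho>" "ball x e \<subseteq> ball x \<sigma>" by (simp_all add: e_def subset_ball)
    then have e: "e > 0" "ball x e \<subseteq> ?W" "ball x e \<subseteq> F" "ball x e \<subseteq> interior F"
      using \<rho> \<sigma> by (simp_all add: e_def interior_maximal)
    have seg: "closed_segment x y \<subseteq> ball x e" "closed_segment y x \<subseteq> ball x e" if "dist x y < e" for y
      by (rule closed_segment_subset; use that e(1) in simp)+
    have g: "g x \<le> g y + ennreal (dist x y)" "g y \<le> g x + ennreal (dist x y)" if "dist x y < e" for y
      using geodesic_length_euclidean_triangle[of x y F "H_out d"] geodesic_length_euclidean_triangle[of y x F "H_out d"]
        seg[OF that] e(4) by (auto simp: g_def dist_commute)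
    have near: "\<exists>y. dist x y < e \<and> dist x y < \<eta> \<and> g y = G y" if "\<eta> > 0" for \<eta>
      using rational_approx_H_in_window[OF N x, of "min e \<eta>"] e(1) that eq by auto
    from X show ?thesis
    proof
      assume X: "X N = euclidean"
      have G: "G y = \<infinity>" for y using geodesic_length_window_euclidean by (simp add: G_def X)
      obtain y where y: "dist x y < e" "g y = G y" using near[of 1] by auto
      have "g x = \<infinity>" using g(2)[OF y(1)] y(2) G[of y] by (auto simp: top_unique ennreal_add_eq_top)
      then show ?thesis using G by simp
    next
      assume X: "X N = top_of_set ?W"
      have "ball x e \<subseteq> top_of_set ?W interior_of (F \<inter> ?W)"
      proof (rule interior_of_maximal)
        show "openin (top_of_set ?W) (ball x e)" using e(2) by (auto simp: openin_open intro!: exI[of _ "ball x e"])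
      qed (use e in auto)
      then have Gl: "G x \<le> G y + ennreal (dist x y)" "G y \<le> G x + ennreal (dist x y)" if "dist x y < e" for y
        using geodesic_length_triangle[OF W, of x y F "H_out d"] geodesic_length_triangle[OF W, of y x F "H_out d"]
          seg[OF that] by (auto simp: G_def X dist_commute)
      show ?thesis
      proof (rule antisym; rule ennreal_le_epsilon)
        fix \<eta> :: real assume "0 < \<eta>"
        then obtain y where y: "dist x y < e" "dist x y < \<eta> / 2" "g y = G y" using near[of "\<eta> / 2"] by auto
        have d: "ennreal (dist x y) + ennreal (dist x y) \<le> ennreal \<eta>"
          using y(2) by (simp add: ennreal_plus[symmetric] ennreal_leI del: ennreal_plus)
        have "g x \<le> G y + ennreal (dist x y)" using g(1)[OF y(1)] y(3) by simp
        also have "\<dots> \<le> G x + ennreal (dist x y) + ennreal (dist x y)" by (rule add_right_mono[OF Gl(2)[OF y(1)]])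
        also have "\<dots> \<le> G x + ennreal \<eta>" using d by (simp add: add.assoc add_left_mono)
        finally show "g x \<le> G x + ennreal \<eta>" .
      next
        fix \<eta> :: real assume "0 < \<eta>"
        then obtain y where y: "dist x y < e" "dist x y < \<eta> / 2" "g y = G y" using near[of "\<eta> / 2"] by auto
        have d: "ennreal (dist x y) + ennreal (dist x y) \<le> ennreal \<eta>"
          using y(2) by (simp add: ennreal_plus[symmetric] ennreal_leI del: ennreal_plus)
        have "G x \<le> g y + ennreal (dist x y)" using Gl(1)[OF y(1)] y(3) by simp
        also have "\<dots> \<le> g x + ennreal (dist x y) + ennreal (dist x y)" by (rule add_right_mono[OF g(2)[OF y(1)]])
        also have "\<dots> \<le> g x + ennreal \<eta>" using d by (simp add: add.assoc add_left_mono)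
        finally show "G x \<le> g x + ennreal \<eta>" .
      qed
    qed
  qed
qed

lemma measurable_window_ratio:
  fixes K :: "real^'n::finite \<Rightarrow> 'b \<Rightarrow> ennreal"
  assumes K: "(\<lambda>(x, F). K x F) \<in> borel_measurable (borel \<Otimes>\<^sub>M L)"
  shows "(\<lambda>F. window_ratio d N (\<lambda>x. K x F)) \<in> borel_measurable L"
proof -
  have "(\<lambda>(x, F). (proj d x, F)) \<in> measurable (borel \<Otimes>\<^sub>M L) (borel \<Otimes>\<^sub>M L)" unfolding split_beta' by measurable
  from measurable_compose[OF this K]
  have [measurable]: "(\<lambda>p. K (proj d (fst p)) (snd p)) \<in> borel_measurable (borel \<Otimes>\<^sub>M L)" by (simp add: split_beta')
  have "(\<lambda>p. (if K (proj d (fst p)) (snd p) < \<infinity> then K (proj d (fst p)) (snd p) else 0) * indicator (cube (real N)) (fst p)) \<in> borel_measurable (borel \<Otimes>\<^sub>M L)"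
    by measurable
  from measurable_nn_integral_lborel[OF this]
  have [measurable]: "(\<lambda>F. window_length d N (\<lambda>x. K x F)) \<in> borel_measurable L" by (simp add: window_length_def cong: if_cong)
  have "(\<lambda>p. (if K (proj d (fst p)) (snd p) < \<infinity> then 1 else 0) * indicator (cube (real N)) (fst p) :: ennreal) \<in> borel_measurable (borel \<Otimes>\<^sub>M L)"
    by measurable
  from measurable_nn_integral_lborel[OF this]
  have [measurable]: "(\<lambda>F. window_area d N (\<lambda>x. K x F)) \<in> borel_measurable L" by (simp add: window_area_def cong: if_cong)
  show ?thesis unfolding window_ratio_def by measurable
qed

lemma tendsto_divide_ennreal:
  fixes a b :: "nat \<Rightarrow> ennreal"
  assumes a: "a \<longlonglongrightarrow> A" "A < \<infinity>" and b: "b \<longlonglongrightarrow> B" "0 < B" "B < \<infinity>"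
  shows "(\<lambda>n. a n / b n) \<longlonglongrightarrow> A / B"
proof -
  have "(\<lambda>n. enn2real (a n) / enn2real (b n)) \<longlonglongrightarrow> enn2real A / enn2real B"
    using a b by (intro tendsto_divide tendsto_enn2real) (auto simp: enn2real_eq_0_iff)
  then have "(\<lambda>n. ennreal (enn2real (a n) / enn2real (b n))) \<longlonglongrightarrow> ennreal (enn2real A / enn2real B)"
    by (rule tendsto_ennrealI)
  moreover have conv: "ennreal (enn2real s / enn2real t) = s / t" if "s < \<infinity>" "0 < t" "t < \<infinity>" for s t
    using that divide_ennreal[of "enn2real s" "enn2real t"] by (simp add: enn2real_positive_iff)
  have "eventually (\<lambda>n. a n < \<infinity>) sequentially" "eventually (\<lambda>n. 0 < b n) sequentially" "eventually (\<lambda>n. b n < \<infinity>) sequentially"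
    using a b by (auto intro: order_tendstoD)
  then have "eventually (\<lambda>n. ennreal (enn2real (a n) / enn2real (b n)) = a n / b n) sequentially"
    by eventually_elim (rule conv)
  ultimately show ?thesis unfolding conv[OF a(2) b(2,3)] by (rule Lim_transform_eventually)
qed

lemma ideal_ratio_tendsto:
  fixes M :: "'w measure" and \<Xi> :: "'w \<Rightarrow> (real^'n::finite) set"
  assumes prob: "prob_space M" and rcs: "random_closed_set M \<Xi>" and erg: "stationary_ergodic M (H_in d) \<Xi>"
    and integrable: "(\<integral>\<^sup>+\<omega>. geodesic_length euclidean (\<Xi> \<omega>) 0 (H_out d) *
           indicator {\<omega>. 0 \<in> connected_points euclidean (\<Xi> \<omega>) (H_out d)} \<omega> \<partial>M) < \<infinity>"
  shows "AE \<omega> in M. (\<lambda>N. window_ratio d N (\<lambda>x. geodesic_length euclidean (\<Xi> \<omega>) x (H_out d))) \<longlonglongrightarrow> mean_tortuosity M d \<Xi>"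
proof -
  interpret M: prob_space M by (rule prob)
  have \<Xi>[measurable]: "\<Xi> \<in> measurable M fell_borel" using rcs by (simp add: random_closed_set_def)
  define D where "D = distr M fell_borel \<Xi>"
  interpret E: ergodic_euclidean_action D "hyper_shift d" unfolding D_def by (rule ergodic_action_hyper_shift[OF prob rcs erg])
  have sD[measurable_cong, simp]: "sets D = sets fell_borel" by (simp add: D_def)
  define g where "g F x = geodesic_length euclidean F x (H_out d)" for F :: "(real^'n) set" and x
  have gm: "(\<lambda>(x, F). g F x) \<in> borel_measurable (borel \<Otimes>\<^sub>M fell_borel)"
    using measurable_geodesic_length[of UNIV "H_out d"] by (simp add: g_def)
  have gs: "g (hyper_shift d x F) 0 = g F (proj d x)" for x F
    unfolding g_def hyper_shift_def using geodesic_length_shift[of "proj d x" "H_out d" F 0] by (simp add: H_out_def)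
  define f1 where "f1 F = (if g F 0 < \<infinity> then g F 0 else 0)" for F
  define f2 where "f2 F = (if g F 0 < \<infinity> then 1 else 0 :: ennreal)" for F
  have gp[measurable]: "(\<lambda>p. g (snd p) (proj d (fst p))) \<in> borel_measurable (borel \<Otimes>\<^sub>M D)"
  proof -
    have "(\<lambda>p. (proj d (fst p), snd p)) \<in> measurable (borel \<Otimes>\<^sub>M D) (borel \<Otimes>\<^sub>M fell_borel)" by measurable
    from measurable_compose[OF this gm] show ?thesis by simp
  qed
  have om1: "E.orbit_measurable f1" unfolding E.orbit_measurable_def f1_def gs split_beta' by measurable
  have om2: "E.orbit_measurable f2" unfolding E.orbit_measurable_def f2_def gs split_beta' by measurable
  have e1: "E.eavg (real N) f1 F = window_length d N (g F) / ennreal (real N ^ DIM(real^'n))" for N F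
    unfolding E.eavg_def window_length_def f1_def gs ..
  have e2: "E.eavg (real N) f2 F = window_area d N (g F) / ennreal (real N ^ DIM(real^'n))" for N F
    unfolding E.eavg_def window_area_def f2_def gs ..
  have [measurable]: "f1 \<in> borel_measurable fell_borel" "f2 \<in> borel_measurable fell_borel"
    using E.orbit_measurable_borel[OF om1] E.orbit_measurable_borel[OF om2] by (simp_all cong: measurable_cong_sets)
  define A where "A = {\<omega>\<in>space M. 0 \<in> connected_points euclidean (\<Xi> \<omega>) (H_out d)}"
  have A_eq: "A = {\<omega>\<in>space M. f2 (\<Xi> \<omega>) = 1}" unfolding A_def connected_points_iff f2_def g_def by auto
  have [measurable]: "A \<in> sets M" unfolding A_eq by measurable
  have I1: "(\<integral>\<^sup>+F. f1 F \<partial>D) = (\<integral>\<^sup>+\<omega>\<in>A. g (\<Xi> \<omega>) 0 \<partial>M)"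
    unfolding D_def by (subst nn_integral_distr) (auto intro!: nn_integral_cong simp: A_def connected_points_iff f1_def g_def indicator_def)
  have I2: "(\<integral>\<^sup>+F. f2 F \<partial>D) = emeasure M A"
  proof -
    have "(\<integral>\<^sup>+F. f2 F \<partial>D) = (\<integral>\<^sup>+\<omega>. indicator A \<omega> \<partial>M)"
      unfolding D_def by (subst nn_integral_distr) (auto intro!: nn_integral_cong simp: A_def connected_points_iff f2_def g_def indicator_def)
    then show ?thesis by simp
  qed
  have I1fin: "(\<integral>\<^sup>+F. f1 F \<partial>D) < \<infinity>"
  proof -
    have "(\<integral>\<^sup>+\<omega>\<in>A. g (\<Xi> \<omega>) 0 \<partial>M) = (\<integral>\<^sup>+\<omega>. geodesic_length euclidean (\<Xi> \<omega>) 0 (H_out d) *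
           indicator {\<omega>. 0 \<in> connected_points euclidean (\<Xi> \<omega>) (H_out d)} \<omega> \<partial>M)"
      by (intro nn_integral_cong) (auto simp: A_def g_def indicator_def)
    then show ?thesis using integrable by (simp add: I1)
  qed
  have I2fin: "(\<integral>\<^sup>+F. f2 F \<partial>D) < \<infinity>" unfolding I2 by (simp add: M.emeasure_eq_measure)
  have "AE F in D. (\<lambda>N. window_ratio d N (g F)) \<longlonglongrightarrow> mean_tortuosity M d \<Xi>"
  proof (cases "measure M A > 0")
    case True
    then have pos: "0 < (\<integral>\<^sup>+F. f2 F \<partial>D)" by (simp add: I2 M.emeasure_eq_measure)
    have \<tau>: "mean_tortuosity M d \<Xi> = (\<integral>\<^sup>+F. f1 F \<partial>D) / (\<integral>\<^sup>+F. f2 F \<partial>D)"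
      using True unfolding mean_tortuosity_def Let_def I1 I2 g_def A_def by simp
    show ?thesis
      using E.pointwise_ergodic[OF om1 I1fin] E.pointwise_ergodic[OF om2 I2fin]
    proof eventually_elim
      case (elim F)
      have "(\<lambda>N. E.eavg (real N) f1 F / E.eavg (real N) f2 F) \<longlonglongrightarrow> mean_tortuosity M d \<Xi>"
        unfolding \<tau> by (rule tendsto_divide_ennreal[OF elim(1) I1fin elim(2) pos I2fin])
      moreover have "eventually (\<lambda>N. E.eavg (real N) f1 F / E.eavg (real N) f2 F = window_ratio d N (g F)) sequentially"
        using order_tendstoD(1)[OF elim(2) pos] eventually_ge_at_top[of 1]
      proof eventually_elim
        case (elim N)
        define c where "c = ennreal (real N ^ DIM(real^'n))"
        have c: "c \<noteq> 0" "c \<noteq> \<top>" using elim(2) by (auto simp: c_def)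
        have ci: "inverse c \<noteq> 0" "inverse c \<noteq> \<infinity>" using c by (auto simp: ennreal_inverse_eq_0_iff)
        have "window_area d N (g F) \<noteq> 0" using elim(1) by (auto simp: e2)
        then show ?case unfolding window_ratio_def e1 e2
          using divide_mult_eq[OF ci, of "window_length d N (g F)" "window_area d N (g F)"]
          by (simp add: divide_ennreal_def c_def)
      qed
      ultimately show ?case by (rule Lim_transform_eventually)
    qed
  next
    case False
    then have zero: "(\<integral>\<^sup>+F. f2 F \<partial>D) = 0" by (simp add: I2 M.emeasure_eq_measure zero_less_measure_iff)
    have \<tau>: "mean_tortuosity M d \<Xi> = \<infinity>"
      using False unfolding mean_tortuosity_def Let_def A_def by simp
    have "AE F in D. \<forall>j::nat. \<not> (\<exists>r\<ge>1. ennreal (1 / (real j + 1)) < E.eavg (real (r::nat)) f2 F)"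
      unfolding AE_all_countable
    proof
      fix j :: nat
      let ?B = "{F\<in>space D. \<exists>r\<ge>1. ennreal (1 / (real j + 1)) < E.eavg (real (r::nat)) f2 F}"
      have [measurable]: "E.eavg (real r) f2 \<in> borel_measurable D" for r :: nat
        by (rule E.orbit_measurable_borel[OF E.orbit_measurable_eavg[OF om2]])
      have B: "?B \<in> sets D" by measurable
      have "ennreal (1 / (real j + 1)) * emeasure D ?B \<le> 0"
        using E.maximal_inequality[OF om2, of "ennreal (1 / (real j + 1))"] zero by simp
      moreover have "ennreal (1 / (real j + 1)) \<noteq> 0" by simp
      ultimately have "emeasure D ?B = 0" unfolding le_zero_eq mult_eq_0_iff by (elim disjE) simp_all
      then have "AE F in D. F \<notin> ?B" using B by (intro AE_not_in null_setsI)
      then show "AE F in D. \<not> (\<exists>r\<ge>1. ennreal (1 / (real j + 1)) < E.eavg (real (r::nat)) f2 F)"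
        using AE_space by eventually_elim blast
    qed
    then show ?thesis
    proof eventually_elim
      case (elim F)
      have "eventually (\<lambda>N. \<infinity> = window_ratio d N (g F)) sequentially"
        using eventually_ge_at_top[of 1]
      proof eventually_elim
        case (elim N)
        have "E.eavg (real N) f2 F \<le> ennreal (1 / (real j + 1))" for j :: nat
          using \<open>\<forall>j::nat. \<not> _ j\<close> elim by (meson not_less)
        moreover have "(\<lambda>j. ennreal (1 / (real j + 1))) \<longlonglongrightarrow> ennreal 0"
          using LIMSEQ_inverse_real_of_nat by (intro tendsto_ennrealI) (simp add: inverse_eq_divide add.commute)
        ultimately have "E.eavg (real N) f2 F \<le> ennreal 0" by (intro LIMSEQ_le_const) auto
        then have "window_area d N (g F) = 0" using elim by (simp add: e2 ennreal_divide_eq_0_iff)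
        then show ?case by (simp add: window_ratio_def)
      qed
      then show ?case unfolding \<tau> by (rule Lim_transform_eventually[OF tendsto_const])
    qed
  qed
  from AE_distrD[OF \<Xi> this[unfolded D_def]] show ?thesis by (simp only: g_def[abs_def])
qed

theorem corollary4:
  fixes M :: "'w measure"
    and \<Xi> :: "'w \<Rightarrow> (real^'n::finite) set"
    and d :: 'n
    and \<alpha> :: real
    and X :: "nat \<Rightarrow> (real^'n) topology"
  assumes dim: "CARD('n) \<ge> 2"
    and alpha: "\<alpha> > 0"
    and prob: "prob_space M"
    and complete: "complete_measure M"
    and rcs: "random_closed_set M \<Xi>"
    and erg: "stationary_ergodic M (H_in d) \<Xi>"
    and integrable: "(\<integral>\<^sup>+\<omega>. geodesic_length euclidean (\<Xi> \<omega>) 0 (H_out d) *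
           indicator {\<omega>. 0 \<in> connected_points euclidean (\<Xi> \<omega>) (H_out d)} \<omega> \<partial>M) < \<infinity>"
    and interior_in: "X = (\<lambda>N. top_of_set (dilated_window d \<alpha> N)) \<or> X = (\<lambda>N. euclidean)"
  shows "((\<exists>N0 :: 'w \<Rightarrow> ennreal. N0 \<in> borel_measurable M \<and>
            (AE \<omega> in M. 1 \<le> N0 \<omega> \<and> N0 \<omega> < \<infinity> \<and>
               (\<forall>N::nat\<ge>1. N0 \<omega> \<le> of_nat N \<longrightarrow> \<omega> \<in> R_event M d \<Xi> X \<alpha> N)))
          \<longrightarrow> (AE \<omega> in M. (\<lambda>N. tortuosity_estimator d X \<alpha> N (\<Xi> \<omega>)) \<longlonglongrightarrow> mean_tortuosity M d \<Xi>))
       \<and> ((\<lambda>N. measure M (R_event M d \<Xi> X \<alpha> N)) \<longlonglongrightarrow> 1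
          \<longrightarrow> converges_in_prob M (\<lambda>N \<omega>. tortuosity_estimator d X \<alpha> N (\<Xi> \<omega>)) (mean_tortuosity M d \<Xi>))"
proof -
  interpret M: prob_space M by (rule prob)
  have \<Xi>[measurable]: "\<Xi> \<in> measurable M fell_borel" using rcs by (simp add: random_closed_set_def)
  have XN: "X N = top_of_set (dilated_window d \<alpha> N) \<or> X N = euclidean" for N using interior_in by auto
  let ?\<tau> = "mean_tortuosity M d \<Xi>"
  define est where "est N \<omega> = tortuosity_estimator d X \<alpha> N (\<Xi> \<omega>)" for N \<omega>
  define ideal where "ideal N \<omega> = window_ratio d N (\<lambda>x. geodesic_length euclidean (\<Xi> \<omega>) x (H_out d))" for N \<omega>
  define G where "G N F x = geodesic_length (X N) (F \<inter> dilated_window d \<alpha> N) x (H_out d)" for N F x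
  have Gm: "(\<lambda>(x, F). G N F x) \<in> borel_measurable (borel \<Otimes>\<^sub>M fell_borel)" for N
    using XN[of N]
  proof
    assume X: "X N = top_of_set (dilated_window d \<alpha> N)"
    have "convex (dilated_window d \<alpha> N)" "closed (dilated_window d \<alpha> N)" unfolding dilated_window_eq_cbox by auto
    then show ?thesis unfolding G_def X by (rule measurable_geodesic_length)
  next
    assume X: "X N = euclidean"
    show ?thesis unfolding G_def X geodesic_length_window_euclidean by simp
  qed
  have est_eq: "est N \<omega> = window_ratio d N (G N (\<Xi> \<omega>))" if "\<omega> \<in> space M" "N \<ge> 1" for N \<omega>
  proof -
    have "\<Xi> \<omega> \<in> space fell_borel" using measurable_space[OF \<Xi> that(1)] .
    from measurable_compose[OF measurable_Pair2'[OF this, of borel] Gm[of N]]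
    have "G N (\<Xi> \<omega>) \<in> borel_measurable borel" by simp
    then show ?thesis unfolding est_def G_def[abs_def] by (rule tortuosity_estimator_eq_window_ratio) (rule that)
  qed
  have estm[measurable]: "est N \<in> borel_measurable M" for N
  proof (cases "N = 0")
    case True
    then show ?thesis using tortuosity_estimator_0[OF dim] by (simp add: est_def[abs_def])
  next
    case False
    have "(\<lambda>\<omega>. window_ratio d N (G N (\<Xi> \<omega>))) \<in> borel_measurable M"
      using measurable_compose[OF \<Xi> measurable_window_ratio[OF Gm[of N]]] by simp
    then show ?thesis using est_eq False by (subst measurable_cong) auto
  qed
  have idealm[measurable]: "ideal N \<in> borel_measurable M" for N
    using measurable_compose[OF \<Xi> measurable_window_ratio[OF measurable_geodesic_length[of UNIV "H_out d"]]]
    by (simp add: ideal_def[abs_def])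
  have R: "est N \<omega> = ideal N \<omega>" if "\<omega> \<in> R_event M d \<Xi> X \<alpha> N" "N \<ge> 1" for N \<omega>
  proof -
    have \<omega>: "\<omega> \<in> space M" using that(1) by (simp add: R_event_def)
    have "geodesic_length euclidean (\<Xi> \<omega>) x (H_out d) = G N (\<Xi> \<omega>) x" if "x \<in> H_in_window d N" for x
      unfolding G_def using \<open>\<omega> \<in> R_event M d \<Xi> X \<alpha> N\<close>
      by (intro geodesic_length_eq_from_rational[where X=X and N=N, OF \<open>N \<ge> 1\<close> XN _ that]) (auto simp: R_event_def)
    then show ?thesis unfolding est_eq[OF \<omega> that(2)] ideal_def by (intro window_ratio_cong) simp
  qed
  have lim: "AE \<omega> in M. (\<lambda>N. ideal N \<omega>) \<longlonglongrightarrow> ?\<tau>"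
    unfolding ideal_def by (rule ideal_ratio_tendsto[OF prob rcs erg integrable])
  have strong: "AE \<omega> in M. (\<lambda>N. est N \<omega>) \<longlonglongrightarrow> ?\<tau>"
    if N0: "AE \<omega> in M. 1 \<le> N0 \<omega> \<and> N0 \<omega> < \<infinity> \<and> (\<forall>N::nat\<ge>1. N0 \<omega> \<le> of_nat N \<longrightarrow> \<omega> \<in> R_event M d \<Xi> X \<alpha> N)"
    for N0 :: "'w \<Rightarrow> ennreal"
    using lim N0
  proof eventually_elim
    case (elim \<omega>)
    then obtain n :: nat where n: "N0 \<omega> < of_nat n" using ennreal_Ex_less_of_nat[of "N0 \<omega>"] by auto
    have "eventually (\<lambda>N. ideal N \<omega> = est N \<omega>) sequentially"
      using eventually_ge_at_top[of "max 1 n"]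
    proof eventually_elim
      case (elim N)
      have "N0 \<omega> \<le> of_nat N" using n elim by (meson less_imp_le max.boundedE of_nat_mono order_trans)
      then have "\<omega> \<in> R_event M d \<Xi> X \<alpha> N"
        using \<open>1 \<le> N0 \<omega> \<and> _\<close> elim by auto
      then show ?case using R elim by simp
    qed
    then show ?case using elim(1) by (rule Lim_transform_eventually[rotated])
  qed
  have weak: "converges_in_prob M est ?\<tau>" if R1: "(\<lambda>N. measure M (R_event M d \<Xi> X \<alpha> N)) \<longlonglongrightarrow> 1"
    unfolding converges_in_prob_def
  proof (intro conjI allI impI)
    fix U :: "ennreal set" assume U: "open U \<and> ?\<tau> \<in> U"
    then have [measurable]: "U \<in> sets borel" by simp
    have "(\<lambda>N. M.expectation (indicator {\<omega>\<in>space M. ideal N \<omega> \<notin> U})) \<longlonglongrightarrow> M.expectation (\<lambda>_. 0 :: real)"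
    proof (rule integral_dominated_convergence[where w="\<lambda>_. 1"])
      show "AE \<omega> in M. (\<lambda>N. indicator {\<omega>\<in>space M. ideal N \<omega> \<notin> U} \<omega>) \<longlonglongrightarrow> (0 :: real)"
        using lim
      proof eventually_elim
        case (elim \<omega>)
        then have "eventually (\<lambda>N. ideal N \<omega> \<in> U) sequentially" using U by (auto intro: topological_tendstoD)
        then show ?case by (intro tendsto_eventually) (auto elim!: eventually_mono simp: indicator_def)
      qed
    qed (auto simp: indicator_def)
    then have I0: "(\<lambda>N. measure M {\<omega>\<in>space M. ideal N \<omega> \<notin> U}) \<longlonglongrightarrow> 0" by simp
    have "(\<lambda>N. measure M {\<omega>\<in>space M. ideal N \<omega> \<notin> U} + (1 - measure M (R_event M d \<Xi> X \<alpha> N))) \<longlonglongrightarrow> 0 + (1 - 1)"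
      by (intro tendsto_intros I0 R1)
    then have up: "(\<lambda>N. measure M {\<omega>\<in>space M. ideal N \<omega> \<notin> U} + (1 - measure M (R_event M d \<Xi> X \<alpha> N))) \<longlonglongrightarrow> 0" by simp
    have "eventually (\<lambda>N. measure M (R_event M d \<Xi> X \<alpha> N) > 0) sequentially"
      by (rule order_tendstoD(1)[OF R1]) simp
    then have "eventually (\<lambda>N. measure M {\<omega>\<in>space M. est N \<omega> \<notin> U} \<le>
        measure M {\<omega>\<in>space M. ideal N \<omega> \<notin> U} + (1 - measure M (R_event M d \<Xi> X \<alpha> N))) sequentially"
      using eventually_ge_at_top[of 1]
    proof eventually_elim
      case (elim N)
      let ?R = "R_event M d \<Xi> X \<alpha> N"
      (* R_N need not be measurable, but its measure would then be the junk value 0. *)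
      have Rm: "?R \<in> sets M" using elim(1) measure_notin_sets by (metis less_irrefl)
      have "measure M {\<omega>\<in>space M. est N \<omega> \<notin> U} \<le> measure M ({\<omega>\<in>space M. ideal N \<omega> \<notin> U} \<union> (space M - ?R))"
        using Rm R elim(2) by (intro M.finite_measure_mono) auto
      also have "\<dots> \<le> measure M {\<omega>\<in>space M. ideal N \<omega> \<notin> U} + measure M (space M - ?R)"
        using Rm by (intro measure_Un_le) auto
      also have "measure M (space M - ?R) = 1 - measure M ?R" using Rm by (rule M.prob_compl)
      finally show ?case .
    qed
    then show "(\<lambda>N. measure M {\<omega>\<in>space M. est N \<omega> \<notin> U}) \<longlonglongrightarrow> 0"
      by (intro tendsto_sandwich[OF _ _ tendsto_const up]) auto
  qed (rule estm)
  show ?thesis using strong weak unfolding est_def[abs_def] by blast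
qed

end
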